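(* Let $m<n$ be positive integers. Suppose $U$ is an open subset of $\mathbf{R}^m$, $1\le q<\infty$, $T\in\mathscr{D}'(U,\mathbf{R}^{n-m})$ and $A$ denotes the set of all $a\in U$ such that $$\limsup_{r\to0+} r^{-1-m/q}\,|T|_{-1,q;a,r}<\infty .$$ Then for $\mathscr{L}^m$ almost every $a\in A$ there exists a unique constant distribution $T_a\in\mathscr{D}'(U,\mathbf{R}^{n-m})$ such that $$\lim_{r\to0+} r^{-1-m/q}\,|T-T_a|_{-1,q;a,r}=0 .$$
   Context: $\mathscr{D}(U,\mathbf{R}^{n-m})$ is the space of smooth compactly supported functions $U\to\mathbf{R}^{n-m}$ and $\mathscr{D}'(U,\mathbf{R}^{n-m})$ is the space of distributions, i.e. continuous linear functionals $\mathscr{D}(U,\mathbf{R}^{n-m})\to\mathbf{R}$. $\mathbf{U}(a,r)$ is the open ball. For $1\le q\le\infty$, $1/p+1/q=1$ and $\mathbf{U}(a,r)\subset U$, $$|T|_{-1,q;a,r}=\sup\{T(\theta):\theta\in\mathscr{D}(U,\mathbf{R}^{n-m}),\ \mathrm{spt}\,\theta\subset\mathbf{U}(a,r),\ |D\theta|_{p;a,r}\le1\},$$ where $|f|_{p;a,r}$ is the $\mathbf{L}_p$ norm of $|f|$ on $\mathbf{U}(a,r)$ with respect to Lebesgue measure $\mathscr{L}^m$ and $\mathrm{Hom}(\mathbf{R}^m,\mathbf{R}^{n-m})$ carries the norm of the inner product $\sigma\bullet\tau=\mathrm{trace}(\sigma^*\circ\tau)$. A distribution $S\in\mathscr{D}'(U,\mathbf{R}^{n-m})$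 is constant if for some linear $\alpha:\mathbf{R}^{n-m}\to\mathbf{R}$ there holds $S(\theta)=\int_U\alpha\circ\theta\,d\mathscr{L}^m$ for all $\theta\in\mathscr{D}(U,\mathbf{R}^{n-m})$. *)

theory Defs
  imports "HOL-Analysis.Analysis" "HOL-Probability.Essential_Supremum"
begin

section \<open>Test functions\<close>

primrec iter_deriv ::
  "'a::euclidean_space list \<Rightarrow> ('a \<Rightarrow> 'b::euclidean_space) \<Rightarrow> 'a \<Rightarrow> 'b" where
  "iter_deriv [] f = f"
| "iter_deriv (v # vs) f = (\<lambda>x. frechet_derivative (iter_deriv vs f) (at x) v)"

definition smooth :: "('a::euclidean_space \<Rightarrow> 'b::euclidean_space) \<Rightarrow> bool" where
  "smooth f \<longleftrightarrow> (\<forall>vs x. iter_deriv vs f differentiable (at x))"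

definition spt :: "('a::topological_space \<Rightarrow> 'b::zero) \<Rightarrow> 'a set" where
  "spt f = closure {x. f x \<noteq> 0}"

text \<open>A compactly supported smooth function on an open set \<open>U\<close> is represented by its
  extension by zero to the whole space.\<close>

definition test_functions ::
  "'a::euclidean_space set \<Rightarrow> ('a \<Rightarrow> 'b::euclidean_space) set" where
  "test_functions U = {\<theta>. smooth \<theta> \<and> compact (spt \<theta>) \<and> spt \<theta> \<subseteq> U}"

text \<open>The topology of uniform convergence of all partial derivatives on the test functions
  supported in a fixed compact set \<open>K\<close>.\<close>

definition test_nbhd ::
  "'a::euclidean_space set \<Rightarrow> ('a \<Rightarrow> 'b::euclidean_space) \<Rightarrow> nat \<Rightarrow> real \<Rightarrow> ('a \<Rightarrow> 'b) set" where
  "test_nbhd K \<theta> N e = {\<eta> \<in> test_functions K.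
     \<forall>vs. set vs \<subseteq> Basis \<and> length vs \<le> N \<longrightarrow>
       (\<forall>x. norm (iter_deriv vs \<eta> x - iter_deriv vs \<theta> x) < e)}"

definition test_topology_on ::
  "'a::euclidean_space set \<Rightarrow> ('a \<Rightarrow> 'b::euclidean_space) topology" where
  "test_topology_on K = topology (\<lambda>V. V \<subseteq> test_functions K \<and>
     (\<forall>\<theta>\<in>V. \<exists>N e. e > 0 \<and> test_nbhd K \<theta> N e \<subseteq> V))"

text \<open>The topology of \<open>\<D>(U)\<close> is the largest one making all inclusions of the spaces
  \<open>\<D>\<^sub>K(U)\<close>, \<open>K \<subseteq> U\<close> compact, continuous (Federer, Geometric Measure Theory, 4.1.1).
  It has the same continuous linear functionals as the locally convex inductive limit.\<close>

definition test_topology ::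
  "'a::euclidean_space set \<Rightarrow> ('a \<Rightarrow> 'b::euclidean_space) topology" where
  "test_topology U = topology (\<lambda>W. W \<subseteq> test_functions U \<and>
     (\<forall>K. compact K \<and> K \<subseteq> U \<longrightarrow> openin (test_topology_on K) (W \<inter> test_functions K)))"

lemma test_nbhd_mono:
  "M \<le> N \<Longrightarrow> d \<le> e \<Longrightarrow> test_nbhd K \<theta> N d \<subseteq> test_nbhd K \<theta> M e"
  unfolding test_nbhd_def by (fastforce intro: order.strict_trans2)

lemma openin_test_topology_on:
  "openin (test_topology_on K) V \<longleftrightarrow> V \<subseteq> test_functions K \<and>
     (\<forall>\<theta>\<in>V. \<exists>N e. e > 0 \<and> test_nbhd K \<theta> N e \<subseteq> V)"
proof -
  have "istopology (\<lambda>V :: ('a \<Rightarrow> 'b) set. V \<subseteq> test_functions K \<and>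
     (\<forall>\<theta>\<in>V. \<exists>N e. e > 0 \<and> test_nbhd K \<theta> N e \<subseteq> V))" (is "istopology ?P")
    unfolding istopology_def
  proof (intro conjI allI impI)
    fix S T :: "('a \<Rightarrow> 'b) set"
    assume S: "?P S" and T: "?P T"
    show "S \<inter> T \<subseteq> test_functions K" using S by blast
    show "\<forall>\<theta>\<in>S \<inter> T. \<exists>N e. e > 0 \<and> test_nbhd K \<theta> N e \<subseteq> S \<inter> T"
    proof
      fix \<theta> assume \<theta>: "\<theta> \<in> S \<inter> T"
      obtain N d where 1: "d > 0" "test_nbhd K \<theta> N d \<subseteq> S" using S \<theta> by blast
      obtain M e where 2: "e > 0" "test_nbhd K \<theta> M e \<subseteq> T" using T \<theta> by blast
      have "test_nbhd K \<theta> (max N M) (min d e) \<subseteq> S \<inter> T"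
        using 1(2) 2(2) test_nbhd_mono[of N "max N M" "min d e" d K \<theta>]
          test_nbhd_mono[of M "max N M" "min d e" e K \<theta>] by auto
      then show "\<exists>N e. e > 0 \<and> test_nbhd K \<theta> N e \<subseteq> S \<inter> T"
        using 1(1) 2(1) by (metis min_less_iff_conj)
    qed
  next
    fix \<K> :: "('a \<Rightarrow> 'b) set set"
    assume *: "\<forall>V\<in>\<K>. ?P V"
    show "\<Union>\<K> \<subseteq> test_functions K" using * by blast
    show "\<forall>\<theta>\<in>\<Union>\<K>. \<exists>N e. e > 0 \<and> test_nbhd K \<theta> N e \<subseteq> \<Union>\<K>"
      using * by (meson UnionE Union_upper subset_trans)
  qed
  then show ?thesis
    by (simp add: test_topology_on_def)
qed

lemma openin_test_topology:
  "openin (test_topology U) W \<longleftrightarrow> W \<subseteq> test_functions U \<and>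
     (\<forall>K. compact K \<and> K \<subseteq> U \<longrightarrow> openin (test_topology_on K) (W \<inter> test_functions K))"
proof -
  have "istopology (\<lambda>W :: ('a \<Rightarrow> 'b) set. W \<subseteq> test_functions U \<and>
     (\<forall>K. compact K \<and> K \<subseteq> U \<longrightarrow> openin (test_topology_on K) (W \<inter> test_functions K)))"
    (is "istopology ?P")
    unfolding istopology_def
  proof (intro conjI allI impI)
    fix S T :: "('a \<Rightarrow> 'b) set"
    assume S: "?P S" and T: "?P T"
    show "S \<inter> T \<subseteq> test_functions U" using S by blast
    fix K :: "'a set" assume "compact K \<and> K \<subseteq> U"
    then have "openin (test_topology_on K) ((S \<inter> test_functions K) \<inter> (T \<inter> test_functions K))"
      by (intro openin_Int[OF S[THEN conjunct2, rule_format] T[THEN conjunct2, rule_format]])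
    then show "openin (test_topology_on K) (S \<inter> T \<inter> test_functions K)"
      by (simp add: Int_ac)
  next
    fix \<K> :: "('a \<Rightarrow> 'b) set set"
    assume *: "\<forall>V\<in>\<K>. ?P V"
    show "\<Union>\<K> \<subseteq> test_functions U" using * by blast
    fix K :: "'a set" assume "compact K \<and> K \<subseteq> U"
    then have "openin (test_topology_on K) (\<Union>V\<in>\<K>. V \<inter> test_functions K)"
      using * by (intro openin_Union) auto
    then show "openin (test_topology_on K) (\<Union>\<K> \<inter> test_functions K)"
      by (simp only: Int_Union2)
  qed
  then show ?thesis
    by (simp add: test_topology_def)
qed

lemma topspace_test_topology_on: "topspace (test_topology_on K) = test_functions K"
proof -
  have "openin (test_topology_on K) (test_functions K)"
    unfolding openin_test_topology_on test_nbhd_def by (auto intro: exI[of _ 1])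
  then show ?thesis
    by (metis openin_test_topology_on openin_subset openin_topspace subset_antisym)
qed

lemma test_functions_mono: "K \<subseteq> U \<Longrightarrow> test_functions K \<subseteq> test_functions U"
  by (auto simp: test_functions_def)

lemma topspace_test_topology: "topspace (test_topology U) = test_functions U"
proof -
  have "openin (test_topology U) (test_functions U)"
    unfolding openin_test_topology
    by (metis inf.absorb2 openin_topspace order_refl test_functions_mono topspace_test_topology_on)
  then show ?thesis
    by (metis openin_test_topology openin_subset openin_topspace subset_antisym)
qed


section \<open>Distributions\<close>

text \<open>Elements of \<open>\<D>'(U)\<close> are extensional functions on \<open>test_functions U\<close>, so that equality
  of distributions is equality in HOL.\<close>

definition distributions ::
  "'a::euclidean_space set \<Rightarrow> (('a \<Rightarrow> 'b::euclidean_space) \<Rightarrow> real) set" where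
  "distributions U = {T \<in> extensional (test_functions U).
     (\<forall>\<theta>\<in>test_functions U. \<forall>\<eta>\<in>test_functions U. T (\<lambda>x. \<theta> x + \<eta> x) = T \<theta> + T \<eta>) \<and>
     (\<forall>c. \<forall>\<theta>\<in>test_functions U. T (\<lambda>x. c *\<^sub>R \<theta> x) = c * T \<theta>) \<and>
     continuous_map (test_topology U) euclideanreal T}"

definition distribution_diff ::
  "'a::euclidean_space set \<Rightarrow> (('a \<Rightarrow> 'b::euclidean_space) \<Rightarrow> real) \<Rightarrow>
    (('a \<Rightarrow> 'b) \<Rightarrow> real) \<Rightarrow> (('a \<Rightarrow> 'b) \<Rightarrow> real)" where
  "distribution_diff U S T = (\<lambda>\<theta>\<in>test_functions U. S \<theta> - T \<theta>)"

definition constant_distribution ::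
  "'a::euclidean_space set \<Rightarrow> (('a \<Rightarrow> 'b::euclidean_space) \<Rightarrow> real) \<Rightarrow> bool" where
  "constant_distribution U S \<longleftrightarrow>
     (\<exists>\<alpha>. linear \<alpha> \<and>
       (\<forall>\<theta>\<in>test_functions U. S \<theta> = set_lebesgue_integral lebesgue U (\<alpha> \<circ> \<theta>)))"


section \<open>The seminorms\<close>

definition hom_inner :: "(real^'m \<Rightarrow> real^'k) \<Rightarrow> (real^'m \<Rightarrow> real^'k) \<Rightarrow> real" where
  "hom_inner \<sigma> \<tau> = trace (matrix (adjoint \<sigma> \<circ> \<tau>))"

definition hom_norm :: "(real^'m \<Rightarrow> real^'k) \<Rightarrow> real" where
  "hom_norm \<sigma> = sqrt (hom_inner \<sigma> \<sigma>)"

definition Lp_norm :: "ennreal \<Rightarrow> 'a measure \<Rightarrow> ('a \<Rightarrow> real) \<Rightarrow> ennreal" where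
  "Lp_norm p M f =
     (if p = \<infinity> then esssup M (\<lambda>x. ennreal \<bar>f x\<bar>)
      else let I = (\<integral>\<^sup>+ x. ennreal (\<bar>f x\<bar> powr enn2real p) \<partial>M)
           in if I = \<infinity> then \<infinity> else ennreal (enn2real I powr (1 / enn2real p)))"

definition conjugate_exponent :: "ennreal \<Rightarrow> ennreal" where
  "conjugate_exponent q = (THE p. 1 \<le> p \<and> 1 / p + 1 / q = 1)"

lemma conjugate_exponent_unique:
  assumes "1 \<le> q"
  shows "\<exists>!p::ennreal. 1 \<le> p \<and> 1 / p + 1 / q = 1"
proof -
  have inv1: "1 \<le> inverse x" if "x \<le> 1" for x :: ennreal
  proof (cases "x = 0")
    case True
    then show ?thesis by simp
  next
    case False
    with that show ?thesis
      by (cases x) (auto simp: inverse_ennreal one_le_inverse_iff top_unique)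
  qed
  have le: "inverse q \<le> 1"
    using assms by (cases q) (auto simp: inverse_ennreal ennreal_1[symmetric] field_simps simp del: ennreal_1)
  let ?p = "inverse (1 - inverse q)"
  have "1 - inverse q \<le> 1"
    by simp
  then have "1 \<le> ?p"
    by (rule inv1)
  moreover have "1 / ?p + 1 / q = 1"
    by (metis add.commute divide_ennreal_def ennreal_ineq_diff_add le mult_1
        one_divide_one_divide_ennreal)
  moreover have "p = ?p" if p: "1 / p + 1 / q = 1" for p
  proof -
    have "inverse q \<noteq> \<infinity>"
      using le by (auto simp: top_unique)
    then have "inverse p = 1 - inverse q"
      using p by (metis divide_ennreal_def ennreal_add_diff_cancel_right infinity_ennreal_def mult_1)
    then show ?thesis
      by (metis divide_ennreal_def mult_1 one_divide_one_divide_ennreal)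
  qed
  ultimately show ?thesis
    by blast
qed

text \<open>\<open>neg_norm q U a r T\<close> is \<open>|T|\<^bsub>-1,q;a,r\<^esub>\<close>. It is intended for \<open>ball a r \<subseteq> U\<close>; since \<open>U\<close>
  is open, this holds for all small \<open>r > 0\<close>, so limits as \<open>r\<close> tends to \<open>0\<close> only see
  such radii.\<close>

definition neg_norm ::
  "ennreal \<Rightarrow> (real^'m) set \<Rightarrow> real^'m \<Rightarrow> real \<Rightarrow> ((real^'m \<Rightarrow> real^'k) \<Rightarrow> real) \<Rightarrow> ereal" where
  "neg_norm q U a r T =
     (SUP \<theta> \<in> {\<theta> \<in> test_functions U. spt \<theta> \<subseteq> ball a r \<and>
         Lp_norm (conjugate_exponent q) (lebesgue_on (ball a r))
           (\<lambda>x. hom_norm (frechet_derivative \<theta> (at x))) \<le> 1}. ereal (T \<theta>))"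

end

theory Submission
  imports Defs
begin

text \<open>
  Write \<open>m\<close> for the dimension of the domain and \<open>1 / p + 1 / q = 1\<close>.  Multiplying a test function by a
  power of \<open>r\<close> turns the scaled norm of \<open>T\<close> on the ball of radius \<open>r\<close> around \<open>a\<close> into the least \<open>\<kappa>\<close> with
  \<open>T v \<le> \<kappa> * r ^ m\<close> for all \<open>v\<close> supported in that ball with \<open>\<integral> G (r \<bar>Dv\<bar>) \<le> r ^ m\<close>, where \<open>G s = s\<^sup>p\<close>
  or, if \<open>p = \<infinity>\<close>, \<open>G\<close> is \<open>0\<close> on \<open>[0, 1]\<close> and \<open>\<infinity>\<close> beyond (\<open>neg_norm_le_iff\<close>).  In this form all
  exponents are treated at once: \<open>G\<close> is a convex Young function of superlinear growth, the latter being
  the assumption \<open>q < \<infinity>\<close>.  What has to be shown is that \<open>T\<close>, which satisfies such bounds at the points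
  of \<open>A\<close> for some \<open>\<kappa>\<close>, satisfies them for every \<open>\<kappa> > 0\<close> after subtraction of a constant.

  The set \<open>A\<close> is a countable union of closed sets \<open>C\<close> on each of which \<open>\<kappa>\<close> and the range of radii are
  fixed.  Cut a test function along a partition of unity whose scale at \<open>x\<close> is comparable to the larger
  of \<open>\<epsilon>\<close> and the distance of \<open>x\<close> to \<open>C\<close>.  The bounds at nearby points of \<open>C\<close> control each piece.  As
  \<open>\<epsilon>\<close> tends to \<open>0\<close>, the pieces close to \<open>C\<close> add up to at most a multiple of \<open>\<integral> \<bar>v\<bar>\<close>; the others are
  Whitney pieces in the complement of \<open>C\<close> and define a seminorm \<open>P v\<close>.  Hence
  \<open>T v \<le> K \<integral> \<bar>v\<bar> + P v\<close> (\<open>T_le_L1_far\<close>).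

  This inequality says that a convex functional of the form \<open>\<integral> \<Phi>(u) + P u - T u\<close> is bounded below if
  \<open>\<Phi>\<close> grows linearly with slope \<open>K\<close>.  A near-minimiser \<open>u\<close> yields a continuous density \<open>w = \<Phi>'(u)\<close> with
  \<open>T v - \<integral> w \<bullet> v \<le> P v\<close> up to small errors, for all \<open>v\<close> at once (\<open>approximate_density\<close>).

  Suppose that at a point \<open>a\<close> of \<open>C\<close> no constant approximates \<open>T\<close> up to \<open>\<epsilon>\<close>.  Then \<open>w a\<close> does not, and as
  \<open>w\<close> is continuous there are arbitrarily small balls around \<open>a\<close> with a bad competitor \<open>v\<close>, that is,
  \<open>T v - \<integral> w \<bullet> v \<ge> \<epsilon> / 2 * r ^ m\<close>.  Add the bad competitors of a disjoint Vitali family.  On the left one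
  gets a multiple of the total volume of the balls.  On the right, the Whitney balls that enter \<open>P\<close>
  lie in a small neighbourhood of \<open>C\<close> but outside \<open>C\<close>, a set of small measure, and superlinearity of \<open>G\<close>
  makes their contribution small (\<open>far_part\<close>).  So the total volume is arbitrarily small, and the set of
  these points is negligible (\<open>negligible_bad_points\<close>).

  Outside the exceptional sets for \<open>\<epsilon> = 1, 1/2, 1/3, ...\<close> the approximating constants form a Cauchy
  sequence, since a bump function detects the difference of two constants; the same argument gives
  uniqueness (\<open>approximable_constants_close\<close>).
\<close>

section \<open>Smooth functions\<close>

lemma iter_deriv_append: "iter_deriv (vs @ ws) f = iter_deriv vs (iter_deriv ws f)"
  by (induction vs) auto

lemma smooth_differentiable: "smooth f \<Longrightarrow> f differentiable (at x)"
  unfolding smooth_def by (metis iter_deriv.simps(1))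

lemma smooth_frechet_derivative:
  assumes "smooth f"
  shows "smooth (\<lambda>x. frechet_derivative f (at x) v)"
proof -
  have "iter_deriv vs (\<lambda>x. frechet_derivative f (at x) v) = iter_deriv (vs @ [v]) f" for vs
    by (simp add: iter_deriv_append)
  then show ?thesis
    using assms unfolding smooth_def by metis
qed

lemma smooth_continuous_on: "smooth f \<Longrightarrow> continuous_on S f"
  by (intro differentiable_imp_continuous_on)
    (auto simp: differentiable_on_def intro: differentiable_at_withinI smooth_differentiable)

lemma smooth_has_derivative:
  "smooth f \<Longrightarrow> (f has_derivative frechet_derivative f (at x)) (at x)"
  using frechet_derivative_works smooth_differentiable by blast

inductive_set finite_sums :: "('a \<Rightarrow> 'b::comm_monoid_add) set \<Rightarrow> ('a \<Rightarrow> 'b) set"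
  for F where
  base: "f \<in> F \<Longrightarrow> f \<in> finite_sums F"
| add: "f \<in> finite_sums F \<Longrightarrow> g \<in> finite_sums F \<Longrightarrow> (\<lambda>x. f x + g x) \<in> finite_sums F"

text \<open>A coinduction principle: a family of differentiable functions that is closed under
  directional derivatives up to finite sums consists of smooth functions.  All closure
  properties below are instances, each with a family that absorbs the Leibniz or chain rule.\<close>

lemma smooth_coinduct:
  fixes F :: "('a::euclidean_space \<Rightarrow> 'b::euclidean_space) set"
  assumes f: "f \<in> F"
    and step: "\<And>f. f \<in> F \<Longrightarrow> \<exists>f'. (\<forall>x. (f has_derivative f' x) (at x)) \<and>
        (\<forall>v. (\<lambda>x. f' x v) \<in> finite_sums F)"
  shows "smooth f"
proof -
  have step': "\<exists>f'. (\<forall>x. (f has_derivative f' x) (at x)) \<and> (\<forall>v. (\<lambda>x. f' x v) \<in> finite_sums F)"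
    if "f \<in> finite_sums F" for f
    using that
  proof induction
    case (base f)
    then show ?case by (rule step)
  next
    case (add f g)
    then obtain f' g' where
      "\<And>x. (f has_derivative f' x) (at x)" "\<And>v. (\<lambda>x. f' x v) \<in> finite_sums F"
      "\<And>x. (g has_derivative g' x) (at x)" "\<And>v. (\<lambda>x. g' x v) \<in> finite_sums F"
      by blast
    then have "(\<forall>x. ((\<lambda>x. f x + g x) has_derivative (\<lambda>v. f' x v + g' x v)) (at x)) \<and>
        (\<forall>v. (\<lambda>x. f' x v + g' x v) \<in> finite_sums F)"
      by (auto intro: has_derivative_add finite_sums.add)
    then show ?case
      by (intro exI[of _ "\<lambda>x v. f' x v + g' x v"]) simp
  qed
  have fd: "f differentiable (at x)" "(\<lambda>x. frechet_derivative f (at x) v) \<in> finite_sums F"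
    if mem: "f \<in> finite_sums F" for f x v
  proof -
    obtain f' where f': "\<And>x. (f has_derivative f' x) (at x)" "\<And>v. (\<lambda>x. f' x v) \<in> finite_sums F"
      using step'[OF mem] by blast
    show "f differentiable (at x)"
      using f'(1) by (auto simp: differentiable_def)
    have "frechet_derivative f (at x) = f' x" for x
      using frechet_derivative_at[OF f'(1)] by simp
    then show "(\<lambda>x. frechet_derivative f (at x) v) \<in> finite_sums F"
      using f'(2) by simp
  qed
  have "iter_deriv vs f \<in> finite_sums F" for vs
    by (induction vs) (auto intro: fd f finite_sums.base)
  then show ?thesis
    unfolding smooth_def using fd(1) by blast
qed

lemma smooth_const: "smooth (\<lambda>x. c)"
proof (rule smooth_coinduct)
  show "(\<lambda>x. c) \<in> range (\<lambda>c x. c)" by blast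
  show "\<exists>f'. (\<forall>x. (f has_derivative f' x) (at x)) \<and> (\<forall>v. (\<lambda>x. f' x v) \<in> finite_sums (range (\<lambda>c x. c)))"
    if "f \<in> range (\<lambda>c x. c)" for f :: "'a \<Rightarrow> 'b"
    using that by (intro exI[of _ "\<lambda>x v. 0"]) (auto intro: finite_sums.base)
qed

lemma smooth_bounded_linear:
  assumes "bounded_linear f"
  shows "smooth f"
proof (rule smooth_coinduct)
  let ?F = "{f} \<union> range (\<lambda>c x. c)"
  show "f \<in> ?F" by blast
  show "\<exists>f'. (\<forall>x. (g has_derivative f' x) (at x)) \<and> (\<forall>v. (\<lambda>x. f' x v) \<in> finite_sums ?F)"
    if "g \<in> ?F" for g
  proof (cases "g = f")
    case True
    then show ?thesis
      using assms by (intro exI[of _ "\<lambda>x. f"]) (auto intro: finite_sums.base bounded_linear_imp_has_derivative)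
  next
    case False
    then show ?thesis
      using that by (intro exI[of _ "\<lambda>x v. 0"]) (auto intro: finite_sums.base)
  qed
qed

lemma smooth_add:
  assumes "smooth f" "smooth g"
  shows "smooth (\<lambda>x. f x + g x)"
proof (rule smooth_coinduct)
  let ?F = "{\<lambda>x. f x + g x | f g :: 'a \<Rightarrow> 'b. smooth f \<and> smooth g}"
  show "(\<lambda>x. f x + g x) \<in> ?F" using assms by auto
  fix h assume "h \<in> ?F"
  then obtain f g where fg: "h = (\<lambda>x. f x + g x)" "smooth f" "smooth g" by blast
  show "\<exists>f'. (\<forall>x. (h has_derivative f' x) (at x)) \<and> (\<forall>v. (\<lambda>x. f' x v) \<in> finite_sums ?F)"
  proof (intro exI[of _ "\<lambda>x. \<lambda>v. frechet_derivative f (at x) v + frechet_derivative g (at x) v"] conjI allI)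
    show "(h has_derivative (\<lambda>v. frechet_derivative f (at x) v + frechet_derivative g (at x) v)) (at x)" for x
      unfolding fg(1) by (rule has_derivative_add[OF fg(2,3)[THEN smooth_has_derivative]])
    show "(\<lambda>x. frechet_derivative f (at x) v + frechet_derivative g (at x) v) \<in> finite_sums ?F" for v
      by (rule finite_sums.base, intro CollectI exI conjI, rule refl) (intro smooth_frechet_derivative fg)+
  qed
qed

lemma smooth_scaleR:
  fixes g :: "'a::euclidean_space \<Rightarrow> 'b::euclidean_space"
  assumes "smooth f" "smooth g"
  shows "smooth (\<lambda>x. f x *\<^sub>R g x)"
proof (rule smooth_coinduct)
  let ?F = "{\<lambda>x. f x *\<^sub>R g x | f (g :: 'a \<Rightarrow> 'b). smooth f \<and> smooth g}"
  show "(\<lambda>x. f x *\<^sub>R g x) \<in> ?F" using assms by blast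
  fix h assume "h \<in> ?F"
  then obtain f g where fg: "h = (\<lambda>x. f x *\<^sub>R g x)" "smooth f" "smooth g" by blast
  show "\<exists>f'. (\<forall>x. (h has_derivative f' x) (at x)) \<and> (\<forall>v. (\<lambda>x. f' x v) \<in> finite_sums ?F)"
  proof (intro exI[of _ "\<lambda>x. \<lambda>v. f x *\<^sub>R frechet_derivative g (at x) v + frechet_derivative f (at x) v *\<^sub>R g x"] conjI allI)
    show "(h has_derivative (\<lambda>v. f x *\<^sub>R frechet_derivative g (at x) v + frechet_derivative f (at x) v *\<^sub>R g x)) (at x)" for x
      unfolding fg(1) by (rule has_derivative_scaleR[OF fg(2,3)[THEN smooth_has_derivative]])
    show "(\<lambda>x. f x *\<^sub>R frechet_derivative g (at x) v + frechet_derivative f (at x) v *\<^sub>R g x) \<in> finite_sums ?F" for v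
      by (rule finite_sums.add; rule finite_sums.base, intro CollectI exI conjI, rule refl)
        (intro smooth_frechet_derivative fg)+
  qed
qed

lemma smooth_mult:
  fixes f g :: "'a::euclidean_space \<Rightarrow> real"
  shows "smooth f \<Longrightarrow> smooth g \<Longrightarrow> smooth (\<lambda>x. f x * g x)"
  using smooth_scaleR[of f g] by simp

lemma smooth_diff:
  assumes "smooth f" "smooth g"
  shows "smooth (\<lambda>x. f x - g x)"
  using smooth_add[OF assms(1) smooth_scaleR[OF smooth_const assms(2), of "-1"]] by simp

lemma smooth_sum:
  assumes "finite I" "\<And>i. i \<in> I \<Longrightarrow> smooth (f i)"
  shows "smooth (\<lambda>x. \<Sum>i\<in>I. f i x)"
  using assms by (induction I) (auto intro: smooth_const smooth_add)

lemma smooth_compose_affine: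
  fixes f :: "'a::euclidean_space \<Rightarrow> 'b::euclidean_space"
  assumes "smooth f"
  shows "smooth (\<lambda>x. f (c *\<^sub>R x + a))"
proof (rule smooth_coinduct)
  let ?F = "{\<lambda>x. f (c *\<^sub>R x + a) | f :: 'a \<Rightarrow> 'b. smooth f}"
  show "(\<lambda>x. f (c *\<^sub>R x + a)) \<in> ?F" using assms by blast
  fix h assume "h \<in> ?F"
  then obtain f where f: "h = (\<lambda>x. f (c *\<^sub>R x + a))" "smooth f" by blast
  show "\<exists>f'. (\<forall>x. (h has_derivative f' x) (at x)) \<and> (\<forall>v. (\<lambda>x. f' x v) \<in> finite_sums ?F)"
  proof (intro exI[of _ "\<lambda>x. \<lambda>v. frechet_derivative f (at (c *\<^sub>R x + a)) (c *\<^sub>R v)"] conjI allI)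
    show "(h has_derivative (\<lambda>v. frechet_derivative f (at (c *\<^sub>R x + a)) (c *\<^sub>R v))) (at x)" for x
      unfolding f(1)
      by (rule has_derivative_compose[of "\<lambda>x. c *\<^sub>R x + a", OF _ smooth_has_derivative[OF f(2)]])
        (auto intro!: derivative_eq_intros)
    show "(\<lambda>x. frechet_derivative f (at (c *\<^sub>R x + a)) (c *\<^sub>R v)) \<in> finite_sums ?F" for v
      by (rule finite_sums.base, intro CollectI exI conjI, rule refl) (rule smooth_frechet_derivative[OF f(2)])
  qed
qed

lemma smooth_compose_real:
  fixes s :: "'a::euclidean_space \<Rightarrow> real" and \<phi> :: "real \<Rightarrow> real"
  assumes "smooth \<phi>" "smooth s"
  shows "smooth (\<lambda>x. \<phi> (s x))"
proof (rule smooth_coinduct)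
  let ?F = "{\<lambda>x. \<phi> (s x) * g x | \<phi> g :: 'a \<Rightarrow> real. smooth \<phi> \<and> smooth g}"
  show "(\<lambda>x. \<phi> (s x)) \<in> ?F"
    by (intro CollectI exI[of _ \<phi>] exI[of _ "\<lambda>x. 1"] conjI) (auto intro: assms smooth_const)
  fix h assume "h \<in> ?F"
  then obtain \<phi> g where f: "h = (\<lambda>x. \<phi> (s x) * g x)" "smooth \<phi>" "smooth g" by blast
  define \<phi>' where "\<phi>' = (\<lambda>t. frechet_derivative \<phi> (at t) 1)"
  have lin: "frechet_derivative \<phi> (at t) v = \<phi>' t * v" for t v
    using linear_scale[OF has_derivative_linear[OF smooth_has_derivative[OF f(2), of t]], of v 1]
    by (simp add: \<phi>'_def)
  show "\<exists>f'. (\<forall>x. (h has_derivative f' x) (at x)) \<and> (\<forall>v. (\<lambda>x. f' x v) \<in> finite_sums ?F)"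
  proof (intro exI[of _ "\<lambda>x. \<lambda>v. \<phi> (s x) * frechet_derivative g (at x) v + (\<phi>' (s x) * frechet_derivative s (at x) v) * g x"] conjI allI)
    have 1: "((\<lambda>x. \<phi> (s x)) has_derivative (\<lambda>v. \<phi>' (s x) * frechet_derivative s (at x) v)) (at x)" for x
      using has_derivative_compose[OF smooth_has_derivative[OF assms(2)] smooth_has_derivative[OF f(2)]]
      by (simp add: lin)
    show "(h has_derivative (\<lambda>v. \<phi> (s x) * frechet_derivative g (at x) v +
        (\<phi>' (s x) * frechet_derivative s (at x) v) * g x)) (at x)" for x
      unfolding f(1) using has_derivative_mult[OF 1 smooth_has_derivative[OF f(3)]] .
    have \<phi>': "smooth \<phi>'"
      unfolding \<phi>'_def by (rule smooth_frechet_derivative[OF f(2)])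
    have *: "(\<lambda>x. \<phi> (s x) * g x) \<in> finite_sums ?F" if "smooth \<phi>" "smooth g" for \<phi> g
      using that by (auto intro!: finite_sums.base)
    show "(\<lambda>x. \<phi> (s x) * frechet_derivative g (at x) v +
        (\<phi>' (s x) * frechet_derivative s (at x) v) * g x) \<in> finite_sums ?F" for v
      unfolding mult.assoc
      by (intro finite_sums.add * f \<phi>' assms smooth_mult smooth_frechet_derivative)
  qed
qed

lemma smooth_divide:
  fixes f g :: "'a::euclidean_space \<Rightarrow> real"
  assumes "smooth f" "smooth g" "\<And>x. g x \<noteq> 0"
  shows "smooth (\<lambda>x. f x / g x)"
proof (rule smooth_coinduct)
  let ?F = "{\<lambda>x. f x / g x ^ n | f n. smooth f}"
  show "(\<lambda>x. f x / g x) \<in> ?F"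
    by (intro CollectI exI[of _ f] exI[of _ 1] conjI) (auto intro: assms)
  fix h assume "h \<in> ?F"
  then obtain f n where f: "h = (\<lambda>x. f x / g x ^ n)" "smooth f" by blast
  show "\<exists>f'. (\<forall>x. (h has_derivative f' x) (at x)) \<and> (\<forall>v. (\<lambda>x. f' x v) \<in> finite_sums ?F)"
  proof -
    let ?n = "\<lambda>x v. frechet_derivative f (at x) v * g x - real n * (f x * frechet_derivative g (at x) v)"
    have "(h has_derivative (\<lambda>v. ?n x v / g x ^ Suc n)) (at x)" for x
    proof -
      have "(h has_derivative (\<lambda>v. (frechet_derivative f (at x) v * g x ^ n -
          f x * (of_nat n * frechet_derivative g (at x) v * g x ^ (n - 1))) / (g x ^ n * g x ^ n))) (at x)"
        unfolding f(1) using assms(3)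
        by (intro has_derivative_divide'[OF smooth_has_derivative[OF f(2)]
              has_derivative_power[OF smooth_has_derivative[OF assms(2)]]]) simp
      moreover have "(frechet_derivative f (at x) v * g x ^ n -
          f x * (of_nat n * frechet_derivative g (at x) v * g x ^ (n - 1))) / (g x ^ n * g x ^ n)
          = ?n x v / g x ^ Suc n" for v
        using assms(3)[of x] by (cases n) (auto simp: field_simps)
      ultimately show ?thesis by simp
    qed
    moreover have "smooth (\<lambda>x. ?n x v)" for v
      by (intro smooth_diff smooth_mult smooth_const smooth_frechet_derivative f assms)
    then have "(\<lambda>x. ?n x v / g x ^ Suc n) \<in> finite_sums ?F" for v
      by (intro finite_sums.base CollectI exI[of _ "\<lambda>x. ?n x v"] exI[of _ "Suc n"]) blast
    ultimately show ?thesis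
      by (intro exI[of _ "\<lambda>x v. ?n x v / g x ^ Suc n"]) blast
  qed
qed

subsection \<open>Cut-off functions\<close>

text \<open>The family that is closed under differentiation in the classical construction of a flat function:
  each derivative of \<open>exp (- 1 / t)\<close> is a combination of these.\<close>

definition flat_exp :: "nat \<Rightarrow> real \<Rightarrow> real" where
  "flat_exp n t = (if t > 0 then (1 / t) ^ n * exp (- (1 / t)) else 0)"

lemma flat_exp_tendsto_0: "(flat_exp n \<longlongrightarrow> 0) (at 0)"
proof -
  have "((\<lambda>t::real. (inverse t) ^ n / exp (inverse t)) \<longlongrightarrow> 0) (at_right 0)"
    by (rule filterlim_compose[OF tendsto_power_div_exp_0 filterlim_inverse_at_top_right])
  moreover have "eventually (\<lambda>t::real. t > 0) (at_right 0)"
    by (simp add: eventually_at_right_less)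
  ultimately have "(flat_exp n \<longlongrightarrow> 0) (at_right 0)"
    by (elim Lim_transform_eventually eventually_mono)
      (auto simp: flat_exp_def exp_minus field_simps)
  moreover have "eventually (\<lambda>t::real. t < 0) (at_left 0)"
    by (simp add: eventually_at_left_real eventually_at_filter)
  then have "(flat_exp n \<longlongrightarrow> 0) (at_left 0)"
    by (intro tendsto_eventually, elim eventually_mono) (auto simp: flat_exp_def)
  ultimately show ?thesis
    by (simp add: filterlim_split_at)
qed

lemma flat_exp_has_derivative:
  "(flat_exp n has_real_derivative (flat_exp (n + 2) t - real n * flat_exp (n + 1) t)) (at t)"
proof -
  consider "t < 0" | "t = 0" | "t > 0" by linarith
  then show ?thesis
  proof cases
    case 1
    have "((\<lambda>t. 0) has_real_derivative 0) (at t)" by simp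
    then have "(flat_exp n has_real_derivative 0) (at t)"
      by (rule has_field_derivative_transform_within_open[where S = "{..<0}"])
        (use 1 in \<open>auto simp: flat_exp_def\<close>)
    then show ?thesis using 1 by (simp add: flat_exp_def)
  next
    case 2
    have "((\<lambda>h. (flat_exp n (0 + h) - flat_exp n 0) / h) \<longlongrightarrow> 0) (at 0)"
      using flat_exp_tendsto_0[of "Suc n"]
      by (rule Lim_transform_eventually) (auto simp: flat_exp_def field_simps intro!: always_eventually)
    then show ?thesis using 2 by (simp add: DERIV_def flat_exp_def)
  next
    case 3
    have "((\<lambda>t. (1 / t) ^ n * exp (- (1 / t))) has_real_derivative
        (flat_exp (n + 2) t - real n * flat_exp (n + 1) t)) (at t)"
    proof -
      have d: "((\<lambda>t. 1 / t) has_real_derivative - ((1 / t)\<^sup>2)) (at t)"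
        using 3 by (auto intro!: derivative_eq_intros simp: power2_eq_square)
      have D: "((\<lambda>t. (1 / t) ^ n * exp (- (1 / t))) has_real_derivative
          (real n * (1 / t) ^ (n - 1) * - ((1 / t)\<^sup>2)) * exp (- (1 / t)) +
          exp (- (1 / t)) * - (- ((1 / t)\<^sup>2)) * (1 / t) ^ n) (at t)"
        using DERIV_mult[OF DERIV_power[OF d, of n] DERIV_fun_exp[OF DERIV_minus[OF d]]]
        by (simp add: mult.commute mult.left_commute)
      have eq: "real n * (1 / t) ^ (n - 1) * - ((1 / t)\<^sup>2) = - (real n * (1 / t) ^ (n + 1))"
        by (cases n) (auto simp: power2_eq_square)
      show ?thesis
        by (rule DERIV_cong[OF D[unfolded eq]]) (use 3 in \<open>simp add: flat_exp_def algebra_simps power2_eq_square\<close>)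
    qed
    then show ?thesis
      by (rule has_field_derivative_transform_within_open[where S = "{0<..}"])
        (use 3 in \<open>auto simp: flat_exp_def\<close>)
  qed
qed

lemma smooth_flat_exp: "smooth (flat_exp n)"
proof (rule smooth_coinduct)
  let ?F = "{\<lambda>t. c * flat_exp n t | c n. True}"
  show "flat_exp n \<in> ?F"
    by (intro CollectI exI[of _ 1] exI[of _ n] conjI) auto
  fix h assume "h \<in> ?F"
  then obtain c n where h: "h = (\<lambda>t. c * flat_exp n t)" by blast
  show "\<exists>f'. (\<forall>x. (h has_derivative f' x) (at x)) \<and> (\<forall>v. (\<lambda>x. f' x v) \<in> finite_sums ?F)"
  proof (intro exI[of _ "\<lambda>t. \<lambda>v. (v * c) * flat_exp (n + 2) t + (v * c * - real n) * flat_exp (n + 1) t"] conjI allI)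
    show "(h has_derivative (\<lambda>v. (v * c) * flat_exp (n + 2) t + (v * c * - real n) * flat_exp (n + 1) t)) (at t)" for t
    proof -
      have "(h has_real_derivative (c * (flat_exp (n + 2) t - real n * flat_exp (n + 1) t))) (at t)"
        unfolding h by (rule DERIV_cmult[OF flat_exp_has_derivative])
      then show ?thesis
        unfolding has_field_derivative_def by (rule has_derivative_eq_rhs) (simp add: algebra_simps fun_eq_iff)
    qed
    show "(\<lambda>t. (v * c) * flat_exp (n + 2) t + (v * c * - real n) * flat_exp (n + 1) t) \<in> finite_sums ?F" for v
      by (intro finite_sums.add; intro finite_sums.base CollectI exI conjI, rule refl) simp_all
  qed
qed

lemma smooth_step_ex:
  obtains \<phi> :: "real \<Rightarrow> real"
  where "smooth \<phi>" "\<And>t. 0 \<le> \<phi> t" "\<And>t. \<phi> t \<le> 1" "\<And>t. t \<le> 0 \<Longrightarrow> \<phi> t = 0" "\<And>t. t \<ge> 1 \<Longrightarrow> \<phi> t = 1"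
proof
  let ?E = "flat_exp 0"
  let ?d = "\<lambda>t. ?E t + ?E ((-1) *\<^sub>R t + 1)"
  have nn: "?E t \<ge> 0" for t by (simp add: flat_exp_def)
  have pos: "?d t > 0" for t by (cases "t > 0") (auto simp: flat_exp_def add_pos_nonneg)
  show "smooth (\<lambda>t. ?E t / ?d t)"
    by (intro smooth_divide smooth_add smooth_flat_exp smooth_compose_affine) (metis pos less_irrefl)
  show "0 \<le> ?E t / ?d t" for t
    using nn pos[of t] by simp
  show "?E t / ?d t \<le> 1" for t
    using nn pos[of t] by (simp add: divide_le_eq)
  show "?E t / ?d t = 0" if "t \<le> 0" for t
    using that by (simp add: flat_exp_def)
  show "?E t / ?d t = 1" if "t \<ge> 1" for t
    using that by (simp add: flat_exp_def)
qed

text \<open>The radii fit the partitions of unity below: if a disjoint family of balls is maximal, then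
  the balls of three times the radius cover.\<close>

lemma smooth_bump_ex:
  obtains \<beta> :: "'a::euclidean_space \<Rightarrow> real"
  where "smooth \<beta>" "\<And>x. 0 \<le> \<beta> x" "\<And>x. \<beta> x \<le> 1"
    "\<And>x. norm x \<le> 3 \<Longrightarrow> \<beta> x = 1" "\<And>x. norm x \<ge> 5 \<Longrightarrow> \<beta> x = 0"
proof -
  obtain \<phi> :: "real \<Rightarrow> real" where \<phi>: "smooth \<phi>" "\<And>t. 0 \<le> \<phi> t" "\<And>t. \<phi> t \<le> 1"
    "\<And>t. t \<le> 0 \<Longrightarrow> \<phi> t = 0" "\<And>t. t \<ge> 1 \<Longrightarrow> \<phi> t = 1"
    using smooth_step_ex by blast
  let ?s = "\<lambda>x::'a. 25 - (\<Sum>b\<in>Basis. (x \<bullet> b) * (x \<bullet> b))"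
  have s: "?s x = 25 - (norm x)\<^sup>2" for x
    by (simp add: power2_norm_eq_inner euclidean_inner[of x x])
  show ?thesis
  proof
    have "smooth ?s"
      by (intro smooth_diff smooth_const smooth_sum smooth_mult smooth_bounded_linear
          bounded_linear_inner_left finite_Basis)
    then show "smooth (\<lambda>x. \<phi> (?s x))"
      by (rule smooth_compose_real[OF \<phi>(1)])
    fix x :: 'a
    show "0 \<le> \<phi> (?s x)" "\<phi> (?s x) \<le> 1" by (fact \<phi>)+
    show "\<phi> (?s x) = 1" if "norm x \<le> 3"
    proof -
      have "(norm x)\<^sup>2 \<le> 3\<^sup>2" using that by (intro power_mono) auto
      then show ?thesis unfolding s by (intro \<phi>(5)) simp
    qed
    show "\<phi> (?s x) = 0" if "norm x \<ge> 5"
    proof -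
      have "5\<^sup>2 \<le> (norm x)\<^sup>2" using that by (intro power_mono) auto
      then show ?thesis unfolding s by (intro \<phi>(4)) simp
    qed
  qed
qed

section \<open>The norm of the gradient\<close>

definition grad_norm :: "('a::euclidean_space \<Rightarrow> 'b::euclidean_space) \<Rightarrow> 'a \<Rightarrow> real" where
  "grad_norm f x = L2_set (\<lambda>b. norm (frechet_derivative f (at x) b)) Basis"

lemma grad_norm_nonneg [simp]: "0 \<le> grad_norm f x"
  by (simp add: grad_norm_def L2_set_nonneg)

lemma grad_norm_eqI:
  assumes "(f has_derivative f') (at x)"
  shows "grad_norm f x = L2_set (\<lambda>b. norm (f' b)) Basis"
  unfolding grad_norm_def using frechet_derivative_at[OF assms] by simp

lemma grad_norm_add:
  assumes "smooth f" "smooth g"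
  shows "grad_norm (\<lambda>x. f x + g x) x \<le> grad_norm f x + grad_norm g x"
proof -
  have "grad_norm (\<lambda>x. f x + g x) x =
      L2_set (\<lambda>b. norm (frechet_derivative f (at x) b + frechet_derivative g (at x) b)) Basis"
    by (intro grad_norm_eqI has_derivative_add smooth_has_derivative assms)
  also have "\<dots> \<le> L2_set (\<lambda>b. norm (frechet_derivative f (at x) b) + norm (frechet_derivative g (at x) b)) Basis"
    by (intro L2_set_mono norm_triangle_ineq) simp
  also have "\<dots> \<le> grad_norm f x + grad_norm g x"
    unfolding grad_norm_def by (rule L2_set_triangle_ineq)
  finally show ?thesis .
qed

lemma grad_norm_scaleR:
  assumes "smooth \<psi>" "smooth f"
  shows "grad_norm (\<lambda>x. \<psi> x *\<^sub>R f x) x \<le> \<bar>\<psi> x\<bar> * grad_norm f x + norm (f x) * grad_norm \<psi> x"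
proof -
  have "grad_norm (\<lambda>x. \<psi> x *\<^sub>R f x) x =
      L2_set (\<lambda>b. norm (\<psi> x *\<^sub>R frechet_derivative f (at x) b + frechet_derivative \<psi> (at x) b *\<^sub>R f x)) Basis"
    by (intro grad_norm_eqI has_derivative_scaleR smooth_has_derivative assms)
  also have "\<dots> \<le> L2_set (\<lambda>b. \<bar>\<psi> x\<bar> * norm (frechet_derivative f (at x) b) +
      norm (f x) * norm (frechet_derivative \<psi> (at x) b)) Basis"
    by (intro L2_set_mono order_trans[OF norm_triangle_ineq]) (auto simp: mult.commute)
  also have "\<dots> \<le> L2_set (\<lambda>b. \<bar>\<psi> x\<bar> * norm (frechet_derivative f (at x) b)) Basis +
      L2_set (\<lambda>b. norm (f x) * norm (frechet_derivative \<psi> (at x) b)) Basis"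
    by (rule L2_set_triangle_ineq)
  also have "\<dots> = \<bar>\<psi> x\<bar> * grad_norm f x + norm (f x) * grad_norm \<psi> x"
    unfolding grad_norm_def by (simp add: L2_set_right_distrib)
  finally show ?thesis .
qed

lemma grad_norm_cmult:
  assumes "smooth f"
  shows "grad_norm (\<lambda>x. c *\<^sub>R f x) x = \<bar>c\<bar> * grad_norm f x"
proof -
  have "grad_norm (\<lambda>x. c *\<^sub>R f x) x = L2_set (\<lambda>b. norm (c *\<^sub>R frechet_derivative f (at x) b)) Basis"
    by (intro grad_norm_eqI has_derivative_scaleR_right smooth_has_derivative assms)
  then show ?thesis
    by (simp add: grad_norm_def L2_set_right_distrib)
qed

lemma grad_norm_compose_affine:
  assumes "smooth f"
  shows "grad_norm (\<lambda>x. f (c *\<^sub>R x + a)) x = \<bar>c\<bar> * grad_norm f (c *\<^sub>R x + a)"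
proof -
  let ?D = "frechet_derivative f (at (c *\<^sub>R x + a))"
  have "((\<lambda>x. f (c *\<^sub>R x + a)) has_derivative (\<lambda>v. ?D (c *\<^sub>R v))) (at x)"
    by (rule has_derivative_compose[of "\<lambda>x. c *\<^sub>R x + a", OF _ smooth_has_derivative[OF assms]])
      (auto intro!: derivative_eq_intros)
  note D = grad_norm_eqI[OF this]
  have "linear ?D"
    using has_derivative_linear[OF smooth_has_derivative[OF assms]] .
  then show ?thesis
    unfolding D by (simp add: linear_scale grad_norm_def L2_set_right_distrib)
qed

lemma grad_norm_const [simp]: "grad_norm (\<lambda>x. c) x = 0"
  by (simp add: grad_norm_def L2_set_def)

lemma grad_norm_cong_ev:
  assumes "eventually (\<lambda>y. f y = g y) (nhds x)" "smooth g"
  shows "grad_norm f x = grad_norm g x"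
proof -
  have ev: "eventually (\<lambda>y. g y = f y) (nhds x)"
    using assms(1) by eventually_elim simp
  have "(f has_derivative frechet_derivative g (at x)) (at x)"
    using has_derivative_transform_eventually[OF smooth_has_derivative[OF assms(2)], of f x]
      ev eventually_nhds_x_imp_x[OF ev] by (auto simp: eventually_nhds_conv_at)
  from grad_norm_eqI[OF this] show ?thesis
    by (simp add: grad_norm_def)
qed

lemma eventually_zero_outside_spt: "x \<notin> spt f \<Longrightarrow> eventually (\<lambda>y. f y = 0) (nhds x)"
  unfolding eventually_nhds using closure_subset[of "{x. f x \<noteq> 0}"]
  by (intro exI[of _ "- spt f"]) (auto simp: spt_def)

lemma zero_outside_spt: "x \<notin> spt f \<Longrightarrow> f x = 0"
  using closure_subset[of "{x. f x \<noteq> 0}"] by (auto simp: spt_def)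

lemma grad_norm_outside_spt: "x \<notin> spt f \<Longrightarrow> grad_norm f x = 0"
  using grad_norm_cong_ev[OF eventually_zero_outside_spt smooth_const] by simp

text \<open>The Euclidean norm of the gradient dominates the operator norm, by the Cauchy-Schwarz inequality.\<close>

lemma norm_derivative_le_grad_norm:
  assumes "smooth f"
  shows "norm (frechet_derivative f (at x) h) \<le> grad_norm f x * norm h"
proof -
  let ?D = "frechet_derivative f (at x)"
  have lin: "linear ?D"
    using has_derivative_linear[OF smooth_has_derivative[OF assms]] .
  have "?D h = ?D (\<Sum>b\<in>Basis. (h \<bullet> b) *\<^sub>R b)"
    by (simp add: euclidean_representation)
  also have "\<dots> = (\<Sum>b\<in>Basis. (h \<bullet> b) *\<^sub>R ?D b)"
    by (simp add: linear_sum[OF lin] linear_scale[OF lin])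
  finally have "norm (?D h) \<le> (\<Sum>b\<in>Basis. \<bar>norm (?D b)\<bar> * \<bar>h \<bullet> b\<bar>)"
    using norm_sum[of "\<lambda>b. (h \<bullet> b) *\<^sub>R ?D b" Basis] by (simp add: mult.commute)
  also have "\<dots> \<le> L2_set (\<lambda>b. norm (?D b)) Basis * L2_set (\<lambda>b. h \<bullet> b) Basis"
    by (rule L2_set_mult_ineq)
  also have "L2_set (\<lambda>b. h \<bullet> b) Basis = norm h"
    by (simp add: norm_eq_sqrt_inner euclidean_inner[of h h] L2_set_def power2_eq_square)
  finally show ?thesis
    by (simp add: grad_norm_def)
qed

lemma continuous_on_grad_norm:
  assumes "smooth f"
  shows "continuous_on S (grad_norm f)"
proof -
  have "continuous_on S (\<lambda>x. L2_set (\<lambda>b. norm (frechet_derivative f (at x) b)) Basis)"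
    unfolding L2_set_def using smooth_continuous_on[OF smooth_frechet_derivative[OF assms]]
    by (intro continuous_intros) auto
  then show ?thesis
    by (simp add: grad_norm_def[abs_def])
qed

lemma grad_norm_bounded:
  assumes "smooth f" "compact (spt f)"
  obtains B where "B > 0" "\<And>x. grad_norm f x \<le> B"
proof -
  have "compact (grad_norm f ` spt f)"
    by (intro compact_continuous_image continuous_on_grad_norm assms)
  then obtain B where "B > 0" "\<forall>y\<in>grad_norm f ` spt f. norm y \<le> B"
    using compact_imp_bounded bounded_pos by blast
  then have B: "B > 0" "\<And>x. x \<in> spt f \<Longrightarrow> grad_norm f x \<le> B"
    by auto
  moreover have "grad_norm f x \<le> B" for x
    using B grad_norm_outside_spt[of x f] by (cases "x \<in> spt f") auto
  ultimately show thesis using that by blast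
qed

lemma norm_diff_le_grad_norm:
  assumes "smooth f" "\<And>x. grad_norm f x \<le> B"
  shows "norm (f x - f y) \<le> B * norm (x - y)"
proof (rule differentiable_bound[of UNIV f "\<lambda>x. frechet_derivative f (at x)"])
  fix z
  show "(f has_derivative frechet_derivative f (at z)) (at z within UNIV)"
    by (rule smooth_has_derivative[OF assms(1)])
  show "onorm (frechet_derivative f (at z)) \<le> B"
    by (rule onorm_le)
      (rule order_trans[OF norm_derivative_le_grad_norm[OF assms(1)] mult_right_mono[OF assms(2) norm_ge_zero]])
qed auto

section \<open>Test functions\<close>

lemma spt_subset_closed: "closed S \<Longrightarrow> (\<And>x. x \<notin> S \<Longrightarrow> f x = 0) \<Longrightarrow> spt f \<subseteq> S"
  unfolding spt_def by (rule closure_minimal) auto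

lemma closed_spt [simp]: "closed (spt f)"
  by (simp add: spt_def)

lemma test_functionsD:
  assumes "v \<in> test_functions U"
  shows "smooth v" "compact (spt v)" "spt v \<subseteq> U"
  using assms by (auto simp: test_functions_def)

lemma test_functionsI_closed:
  assumes "smooth v" "closed S" "S \<subseteq> K" "compact K" "K \<subseteq> U" "\<And>x. x \<notin> S \<Longrightarrow> v x = 0"
  shows "v \<in> test_functions U"
proof -
  have "spt v \<subseteq> S" by (rule spt_subset_closed) (use assms in auto)
  moreover have "compact (spt v)"
    using closed_spt assms \<open>spt v \<subseteq> S\<close> compact_Int_closed[of K "spt v"] by (metis inf.absorb_iff2 order_trans)
  ultimately show ?thesis
    using assms by (auto simp: test_functions_def)
qed

lemma test_functions_add:
  assumes "u \<in> test_functions U" "v \<in> test_functions U"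
  shows "(\<lambda>x. u x + v x) \<in> test_functions U"
  by (rule test_functionsI_closed[where S = "spt u \<union> spt v" and K = "spt u \<union> spt v"])
    (use assms zero_outside_spt[of _ u] zero_outside_spt[of _ v]
      in \<open>auto simp: test_functions_def intro: smooth_add compact_Un\<close>)

lemma test_functions_scaleR:
  assumes "smooth \<psi>" "v \<in> test_functions U"
  shows "(\<lambda>x. \<psi> x *\<^sub>R v x) \<in> test_functions U"
  by (rule test_functionsI_closed[where S = "spt v" and K = "spt v"])
    (use assms zero_outside_spt[of _ v] in \<open>auto simp: test_functions_def intro: smooth_scaleR\<close>)

lemma test_functions_cmult:
  "v \<in> test_functions U \<Longrightarrow> (\<lambda>x. c *\<^sub>R v x) \<in> test_functions U"
  by (rule test_functions_scaleR[OF smooth_const])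

lemma test_functions_zero: "(\<lambda>x. 0) \<in> test_functions U"
  by (rule test_functionsI_closed[where S = "{}" and K = "{}"]) (auto intro: smooth_const)

lemma test_functions_sum:
  assumes "finite I" "\<And>i. i \<in> I \<Longrightarrow> v i \<in> test_functions U"
  shows "(\<lambda>x. \<Sum>i\<in>I. v i x) \<in> test_functions U"
  using assms by (induction I) (auto intro: test_functions_zero test_functions_add)

lemma spt_scaleR:
  fixes v :: "'a::euclidean_space \<Rightarrow> 'b::euclidean_space"
  shows "spt (\<lambda>x. \<psi> x *\<^sub>R v x) \<subseteq> spt \<psi> \<inter> spt v"
  by (rule spt_subset_closed) (use zero_outside_spt[of _ \<psi>] zero_outside_spt[of _ v] in auto)

lemma spt_cmult:
  fixes v :: "'a::euclidean_space \<Rightarrow> 'b::euclidean_space"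
  shows "spt (\<lambda>x. c *\<^sub>R v x) \<subseteq> spt v"
  by (rule spt_subset_closed) (use zero_outside_spt[of _ v] in auto)

section \<open>Partitions of unity of slowly varying scale\<close>

text \<open>All counting of balls below is done by comparing volumes.\<close>

lemma sum_ball_volumes_le:
  fixes S :: "'a::euclidean_space set"
  assumes "finite F" "\<And>x. x \<in> F \<Longrightarrow> 0 \<le> h x" "S \<in> lmeasurable"
    and "\<And>x. x \<in> F \<Longrightarrow> ball x (h x) \<subseteq> S"
    and "disjoint_family_on (\<lambda>x. ball x (h x)) F"
  shows "(\<Sum>x\<in>F. h x ^ DIM('a)) * unit_ball_vol (DIM('a)) \<le> measure lebesgue S"
proof -
  have fin: "emeasure lborel (ball x (h x)) \<noteq> \<infinity>" for x
    using emeasure_lborel_ball_finite[of x "h x"] by auto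
  have "(\<Sum>x\<in>F. h x ^ DIM('a)) * unit_ball_vol (DIM('a)) = (\<Sum>x\<in>F. measure lebesgue (ball x (h x)))"
    by (simp add: sum_distrib_left content_ball assms mult.commute[of _ "unit_ball_vol _"])
  also have "\<dots> = measure lebesgue (\<Union>x\<in>F. ball x (h x))"
    by (rule measure_finite_Union[symmetric]) (use assms fin in auto)
  also have "\<dots> \<le> measure lebesgue S"
    by (rule measure_mono_fmeasurable) (use assms in auto)
  finally show ?thesis .
qed

lemma card_disjoint_balls_le:
  fixes F :: "'a::euclidean_space set"
  assumes "finite F" "0 < s" "0 \<le> R" "\<And>x. x \<in> F \<Longrightarrow> ball x s \<subseteq> ball a R"
    and "disjoint_family_on (\<lambda>x. ball x s) F"
  shows "real (card F) \<le> (R / s) ^ DIM('a)"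
proof -
  have "(\<Sum>x\<in>F. s ^ DIM('a)) * unit_ball_vol (DIM('a)) \<le> measure lebesgue (ball a R)"
    by (rule sum_ball_volumes_le) (use assms in auto)
  then have "real (card F) * s ^ DIM('a) \<le> R ^ DIM('a)"
    using assms by (simp add: content_ball mult.commute[of _ "unit_ball_vol _"] mult.left_commute)
  then show ?thesis
    using assms by (simp add: power_divide field_simps)
qed

text \<open>A finite disjoint family of balls \<open>ball x (h x)\<close> whose radii vary slowly: the dilated balls
  have bounded overlap because radii of overlapping dilated balls are comparable.\<close>

locale slow_balls =
  fixes F :: "'a::euclidean_space set" and h :: "'a \<Rightarrow> real"
  assumes finite: "finite F"
    and pos: "x \<in> F \<Longrightarrow> 0 < h x"
    and slow: "x \<in> F \<Longrightarrow> y \<in> F \<Longrightarrow> h x \<le> h y + dist x y / 20"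
    and disjoint: "disjoint_family_on (\<lambda>x. ball x (h x)) F"
begin

lemma comparable:
  assumes "x \<in> F" "z \<in> F" "dist x y \<le> 6 * h x" "dist z y \<le> 6 * h z"
  shows "h x \<le> 2 * h z"
  using slow[OF assms(1,2)] pos[OF assms(2)] assms(3,4) dist_triangle[of x z y] dist_commute[of z y] by linarith

text \<open>If \<open>x0\<close> is one of the centres counted, the balls of radius \<open>h x0 / 2\<close> around all of them are disjoint
  and lie in the ball of radius \<open>19 * h x0\<close> around \<open>x0\<close>.\<close>

lemma overlap: "card {x \<in> F. dist x y \<le> 6 * h x} \<le> 38 ^ DIM('a)"
proof (cases "{x \<in> F. dist x y \<le> 6 * h x} = {}")
  case True
  then show ?thesis by (metis card.empty zero_le)
next
  case False
  then obtain x0 where x0: "x0 \<in> F" "dist x0 y \<le> 6 * h x0" by auto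
  let ?G = "{x \<in> F. dist x y \<le> 6 * h x}"
  have "real (card ?G) \<le> (19 * h x0 / (h x0 / 2)) ^ DIM('a)"
  proof (rule card_disjoint_balls_le)
    have sub: "ball x (h x0 / 2) \<subseteq> ball x (h x)" if "x \<in> ?G" for x
      using comparable[of x0 x y] x0 that by auto
    show "disjoint_family_on (\<lambda>x. ball x (h x0 / 2)) ?G"
      using disjoint sub unfolding disjoint_family_on_def by blast
    show "ball x (h x0 / 2) \<subseteq> ball x0 (19 * h x0)" if x: "x \<in> ?G" for x
    proof
      fix w assume "w \<in> ball x (h x0 / 2)"
      then have "dist x w < h x0 / 2" by simp
      moreover have "h x \<le> 2 * h x0" using comparable[of x x0 y] x x0 by auto
      ultimately show "w \<in> ball x0 (19 * h x0)"
        using x x0 pos[of x0] dist_triangle[of x0 w x] dist_triangle[of x0 x y] dist_commute[of x y]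
        by auto
    qed
  qed (use pos[OF x0(1)] finite in auto)
  also have "19 * h x0 / (h x0 / 2) = 38" using pos[OF x0(1)] by simp
  finally show ?thesis
    by (metis of_nat_le_iff of_nat_numeral of_nat_power)
qed

end

lemma maximal_disjoint_balls_ex:
  fixes K :: "'a::euclidean_space set"
  assumes "compact K" "0 < h0" "\<And>x. x \<in> K \<Longrightarrow> h0 \<le> h x"
  shows "\<exists>F. finite F \<and> F \<subseteq> K \<and> disjoint_family_on (\<lambda>x. ball x (h x)) F \<and>
    (\<forall>y\<in>K. \<exists>x\<in>F. ball x (h x) \<inter> ball y (h y) \<noteq> {})"
proof -
  obtain R where R: "R > 0" "K \<subseteq> ball 0 R"
    by (metis assms(1) bounded_subset_ballD compact_imp_bounded)
  let ?P = "\<lambda>F. finite F \<and> F \<subseteq> K \<and> disjoint_family_on (\<lambda>x. ball x (h x)) F"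
  have bound: "card F < Suc (nat \<lceil>((R + h0) / h0) ^ DIM('a)\<rceil>)" if F: "?P F" for F
  proof -
    have "real (card F) \<le> ((R + h0) / h0) ^ DIM('a)"
    proof (rule card_disjoint_balls_le[of F h0 "R + h0" 0])
      show "disjoint_family_on (\<lambda>x. ball x h0) F"
        unfolding disjoint_family_on_def
      proof (intro ballI impI)
        fix x y assume xy: "x \<in> F" "y \<in> F" "x \<noteq> y"
        then have "ball x (h x) \<inter> ball y (h y) = {}"
          using F by (auto simp: disjoint_family_on_def)
        moreover have "ball x h0 \<subseteq> ball x (h x)" "ball y h0 \<subseteq> ball y (h y)"
          using xy F assms(3) by (auto intro!: subset_ball)
        ultimately show "ball x h0 \<inter> ball y h0 = {}" by blast
      qed
      show "ball x h0 \<subseteq> ball 0 (R + h0)" if "x \<in> F" for x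
      proof
        fix w assume "w \<in> ball x h0"
        moreover have "norm x < R" using that F R by auto
        ultimately show "w \<in> ball 0 (R + h0)"
          using dist_triangle[of 0 w x] by simp
      qed
    qed (use F R assms in auto)
    then show ?thesis by linarith
  qed
  have "?P {}" by (simp add: disjoint_family_on_def)
  then have "\<exists>F. ?P F \<and> (\<forall>G. ?P G \<longrightarrow> card G \<le> card F)"
    by (rule ex_has_greatest_nat) (intro allI impI, erule bound)
  then obtain F where F: "?P F" and max: "\<And>G. ?P G \<Longrightarrow> card G \<le> card F"
    by (elim exE conjE) blast
  show ?thesis
  proof (intro exI[of _ F] conjI ballI)
    fix y assume y: "y \<in> K"
    show "\<exists>x\<in>F. ball x (h x) \<inter> ball y (h y) \<noteq> {}"
    proof (rule ccontr)
      assume "\<not> ?thesis"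
      then have *: "ball x (h x) \<inter> ball y (h y) = {}" if "x \<in> F" for x
        using that by blast
      have "y \<in> ball y (h y)" using assms(2) assms(3)[OF y] by simp
      then have "y \<notin> F" using * by blast
      moreover have "?P (insert y F)"
        using F y * by (auto simp: disjoint_family_on_def)
      ultimately show False
        using max[of "insert y F"] F by simp
    qed
  qed (use F in auto)
qed

text \<open>Subordinating a partition of unity to functions \<open>\<phi> x\<close> without dividing: take
  \<open>\<phi> x * (\<Prod>z. 1 - \<phi> z)\<close>, the product running over the points that come before \<open>x\<close>.\<close>

lemma telescoping_partition:
  fixes \<phi> :: "'i \<Rightarrow> 'a::euclidean_space \<Rightarrow> real"
  assumes "finite F" "\<And>x. x \<in> F \<Longrightarrow> smooth (\<phi> x)"
    and "\<And>x y. x \<in> F \<Longrightarrow> 0 \<le> \<phi> x y" "\<And>x y. x \<in> F \<Longrightarrow> \<phi> x y \<le> 1"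
  shows "\<exists>\<psi>. (\<forall>x\<in>F. smooth (\<psi> x) \<and> (\<forall>y. 0 \<le> \<psi> x y \<and> \<psi> x y \<le> \<phi> x y \<and>
        grad_norm (\<psi> x) y \<le> (\<Sum>z\<in>F. grad_norm (\<phi> z) y))) \<and>
      (\<forall>y. (\<Sum>x\<in>F. \<psi> x y) = 1 - (\<Prod>x\<in>F. 1 - \<phi> x y))"
proof -
  have grad_le: "grad_norm (\<lambda>y. f y * g y) y \<le> grad_norm f y + grad_norm g y"
    if "smooth f" "smooth g" "\<And>y. 0 \<le> f y \<and> f y \<le> 1" "\<And>y. 0 \<le> g y \<and> g y \<le> 1"
    for f g :: "'a \<Rightarrow> real" and y
  proof -
    have "grad_norm (\<lambda>y. f y * g y) y \<le> \<bar>f y\<bar> * grad_norm g y + \<bar>g y\<bar> * grad_norm f y"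
      using grad_norm_scaleR[OF that(1,2)] by simp
    also have "\<dots> \<le> 1 * grad_norm g y + 1 * grad_norm f y"
      using that by (intro add_mono mult_right_mono) auto
    finally show ?thesis by simp
  qed
  have grad_compl: "grad_norm (\<lambda>y. 1 - f y) y \<le> grad_norm f y" if f: "smooth f" for f :: "'a \<Rightarrow> real" and y
  proof -
    have "grad_norm (\<lambda>y. 1 + (-1) *\<^sub>R f y) y \<le> grad_norm (\<lambda>y. 1::real) y + grad_norm (\<lambda>y. (-1) *\<^sub>R f y) y"
      by (intro grad_norm_add smooth_const smooth_scaleR f)
    then show ?thesis
      using grad_norm_cmult[OF f, of "-1"] by simp
  qed
  have "(\<exists>\<psi>. (\<forall>x\<in>F. smooth (\<psi> x) \<and> (\<forall>y. 0 \<le> \<psi> x y \<and> \<psi> x y \<le> \<phi> x y \<and>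
        grad_norm (\<psi> x) y \<le> (\<Sum>z\<in>F. grad_norm (\<phi> z) y))) \<and>
      (\<forall>y. (\<Sum>x\<in>F. \<psi> x y) = 1 - (\<Prod>x\<in>F. 1 - \<phi> x y))) \<and>
      smooth (\<lambda>y. \<Prod>x\<in>F. 1 - \<phi> x y) \<and>
      (\<forall>y. grad_norm (\<lambda>y. \<Prod>x\<in>F. 1 - \<phi> x y) y \<le> (\<Sum>z\<in>F. grad_norm (\<phi> z) y))"
    using assms
  proof (induction F rule: finite_induct)
    case empty
    then show ?case by (auto intro: smooth_const)
  next
    case (insert a F)
    let ?\<pi> = "\<lambda>y. \<Prod>x\<in>F. 1 - \<phi> x y"
    let ?S = "\<lambda>F y. \<Sum>z\<in>F. grad_norm (\<phi> z) y"
    have "smooth (\<phi> x)" "0 \<le> \<phi> x y" "\<phi> x y \<le> 1" if "x \<in> F" for x y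
      using insert.prems that by auto
    note IH = insert.IH[OF this, simplified]
    have \<pi>: "smooth ?\<pi>" "\<forall>y. grad_norm ?\<pi> y \<le> ?S F y"
      using IH by simp_all
    obtain \<psi> where "(\<forall>x\<in>F. smooth (\<psi> x) \<and> (\<forall>y. 0 \<le> \<psi> x y \<and> \<psi> x y \<le> \<phi> x y \<and>
          grad_norm (\<psi> x) y \<le> ?S F y)) \<and> (\<forall>y. (\<Sum>x\<in>F. \<psi> x y) = 1 - ?\<pi> y)"
      using conjunct1[OF IH] by (rule exE)
    then have \<psi>: "\<And>x. x \<in> F \<Longrightarrow> smooth (\<psi> x)"
        "\<And>x y. x \<in> F \<Longrightarrow> 0 \<le> \<psi> x y \<and> \<psi> x y \<le> \<phi> x y \<and> grad_norm (\<psi> x) y \<le> ?S F y"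
        "\<And>y. (\<Sum>x\<in>F. \<psi> x y) = 1 - ?\<pi> y"
      by auto
    have \<pi>01: "0 \<le> ?\<pi> y \<and> ?\<pi> y \<le> 1" for y
      using insert.prems by (auto intro!: prod_nonneg prod_le_1)
    have a: "smooth (\<phi> a)" "0 \<le> \<phi> a y \<and> \<phi> a y \<le> 1" for y
      using insert.prems by auto
    have S: "?S (insert a F) y = grad_norm (\<phi> a) y + ?S F y" for y
      using insert by simp
    let ?\<psi> = "\<psi>(a := \<lambda>y. \<phi> a y * ?\<pi> y)"
    have new: "grad_norm (\<lambda>y. \<phi> a y * ?\<pi> y) y \<le> ?S (insert a F) y" for y
      using grad_le[OF a(1) \<pi>(1) a(2) \<pi>01, of y] spec[OF \<pi>(2), of y] S[of y] by linarith
    have "smooth (?\<psi> x) \<and> (\<forall>y. 0 \<le> ?\<psi> x y \<and> ?\<psi> x y \<le> \<phi> x y \<and> grad_norm (?\<psi> x) y \<le> ?S (insert a F) y)"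
      if "x \<in> insert a F" for x
    proof (cases "x = a")
      case True
      have "0 \<le> \<phi> a y * ?\<pi> y \<and> \<phi> a y * ?\<pi> y \<le> \<phi> a y" for y
        using a(2)[of y] \<pi>01[of y] by (auto intro: mult_left_le)
      then show ?thesis
        using True new a(1) \<pi>(1) by (simp add: smooth_mult)
    next
      case False
      then have "x \<in> F" using that by blast
      moreover have "grad_norm (\<psi> x) y \<le> ?S (insert a F) y" for y
        using \<psi>(2)[OF \<open>x \<in> F\<close>, of y] unfolding S by (simp add: add_increasing)
      ultimately show ?thesis
        using \<psi> False by simp
    qed
    moreover have "(\<Sum>x\<in>insert a F. ?\<psi> x y) = 1 - (\<Prod>x\<in>insert a F. 1 - \<phi> x y)" for y
    proof -
      have "(\<Sum>x\<in>F. ?\<psi> x y) = (\<Sum>x\<in>F. \<psi> x y)"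
        using insert by (intro sum.cong) auto
      then show ?thesis
        using insert \<psi>(3)[of y] by (simp add: algebra_simps)
    qed
    moreover have "smooth (\<lambda>y. \<Prod>x\<in>insert a F. 1 - \<phi> x y)"
      using insert smooth_mult[OF smooth_diff[OF smooth_const a(1)] \<pi>(1)] by simp
    moreover have "grad_norm (\<lambda>y. \<Prod>x\<in>insert a F. 1 - \<phi> x y) y \<le> ?S (insert a F) y" for y
    proof -
      have "grad_norm (\<lambda>y. (1 - \<phi> a y) * ?\<pi> y) y \<le> grad_norm (\<lambda>y. 1 - \<phi> a y) y + grad_norm ?\<pi> y"
        by (rule grad_le) (use a \<pi> \<pi>01 in \<open>auto intro: smooth_diff smooth_const\<close>)
      then show ?thesis
        using insert(1,2) grad_compl[OF a(1), of y] spec[OF \<pi>(2), of y] S[of y] by simp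
    qed
    ultimately show ?case by blast
  qed
  then show ?thesis by blast
qed

definition cutoff :: "real \<Rightarrow> real \<Rightarrow> 'a::euclidean_space \<Rightarrow> ('a \<Rightarrow> real) \<Rightarrow> bool" where
  "cutoff B h x \<psi> \<longleftrightarrow> smooth \<psi> \<and> (\<forall>y. 0 \<le> \<psi> y \<and> \<psi> y \<le> 1 \<and> grad_norm \<psi> y \<le> B / h) \<and>
     spt \<psi> \<subseteq> cball x (5 * h)"

lemma cutoffD:
  assumes "cutoff B h x \<psi>"
  shows "smooth \<psi>" "0 \<le> \<psi> y" "\<psi> y \<le> 1" "grad_norm \<psi> y \<le> B / h" "spt \<psi> \<subseteq> cball x (5 * h)"
  using assms by (auto simp: cutoff_def)

text \<open>A maximal disjoint family of balls \<open>ball x (h x)\<close> has the property that the balls of three times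
  the radius cover, because \<open>h\<close> varies slowly.  Only boundedly many of the bumps on these balls meet
  at a point, and they have comparable scales, so that the telescoping construction
  keeps the gradient of each piece of the order of the inverse of its scale.\<close>

lemma slowly_varying_partition:
  obtains B where "B \<ge> 1"
    "\<And>(K :: 'a::euclidean_space set) h h0. \<lbrakk>compact K; 0 < h0; \<And>x. x \<in> K \<Longrightarrow> h0 \<le> h x;
       \<And>x y. x \<in> K \<Longrightarrow> y \<in> K \<Longrightarrow> h x \<le> h y + dist x y / 20\<rbrakk>
     \<Longrightarrow> \<exists>F \<psi>. F \<subseteq> K \<and> slow_balls F h \<and> (\<forall>x\<in>F. cutoff B (h x) x (\<psi> x)) \<and>
          (\<forall>y\<in>K. (\<Sum>x\<in>F. \<psi> x y) = 1)"
proof -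
  obtain \<beta> :: "'a \<Rightarrow> real" where \<beta>: "smooth \<beta>" "\<And>x. 0 \<le> \<beta> x" "\<And>x. \<beta> x \<le> 1"
    "\<And>x. norm x \<le> 3 \<Longrightarrow> \<beta> x = 1" "\<And>x. norm x \<ge> 5 \<Longrightarrow> \<beta> x = 0"
    using smooth_bump_ex by blast
  have spt\<beta>: "spt \<beta> \<subseteq> cball 0 5"
    by (rule spt_subset_closed) (auto intro: \<beta>(5))
  then have "compact (spt \<beta>)"
    using compact_Int_closed[OF compact_cball closed_spt, of 0 5 \<beta>] by (simp add: inf.absorb2)
  then obtain B0 where B0: "B0 > 0" "\<And>x. grad_norm \<beta> x \<le> B0"
    using grad_norm_bounded[OF \<beta>(1)] by blast
  define B where "B = max 1 (2 * 38 ^ DIM('a) * B0)"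
  show thesis
  proof (rule that)
    show "B \<ge> 1" unfolding B_def by (rule max.cobounded1)
    fix K :: "'a set" and h :: "'a \<Rightarrow> real" and h0 :: real
    assume K: "compact K" and h0: "0 < h0" "\<And>x. x \<in> K \<Longrightarrow> h0 \<le> h x"
      and slowK: "\<And>x y. x \<in> K \<Longrightarrow> y \<in> K \<Longrightarrow> h x \<le> h y + dist x y / 20"
    obtain F where "finite F \<and> F \<subseteq> K \<and> disjoint_family_on (\<lambda>x. ball x (h x)) F \<and>
        (\<forall>y\<in>K. \<exists>x\<in>F. ball x (h x) \<inter> ball y (h y) \<noteq> {})"
      using maximal_disjoint_balls_ex[OF K h0] by (rule exE)
    then have F: "finite F" "F \<subseteq> K" "disjoint_family_on (\<lambda>x. ball x (h x)) F"
      and max: "\<And>y. y \<in> K \<Longrightarrow> \<exists>x\<in>F. ball x (h x) \<inter> ball y (h y) \<noteq> {}"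
      by simp_all
    have pos: "0 < h x" if "x \<in> F" for x
      using h0 F that by force
    interpret slow_balls F h
      by unfold_locales (use F(1,3) pos slowK[OF subsetD[OF F(2)] subsetD[OF F(2)]] in auto)
    define \<phi> where "\<phi> x y = \<beta> ((1 / h x) *\<^sub>R y + (- (1 / h x)) *\<^sub>R x)" for x y
    have arg: "(1 / h x) *\<^sub>R y + (- (1 / h x)) *\<^sub>R x = (1 / h x) *\<^sub>R (y - x)" for x y
      by (simp add: scaleR_diff_right)
    have narg: "norm ((1 / h x) *\<^sub>R (y - x)) = dist x y / h x" if "x \<in> F" for x y
      using pos[OF that] by (simp add: dist_norm norm_minus_commute)
    have \<phi>: "smooth (\<phi> x)" "0 \<le> \<phi> x y" "\<phi> x y \<le> 1" for x y
      unfolding \<phi>_def by (intro smooth_compose_affine \<beta>)+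
    have \<phi>1: "\<phi> x y = 1" if "x \<in> F" "dist x y \<le> 3 * h x" for x y
      unfolding \<phi>_def arg by (rule \<beta>(4)) (use that pos[of x] narg in \<open>simp add: field_simps\<close>)
    have \<phi>0: "\<phi> x y = 0" if "x \<in> F" "dist x y \<ge> 5 * h x" for x y
      unfolding \<phi>_def arg by (rule \<beta>(5)) (use that pos[of x] narg in \<open>simp add: field_simps\<close>)
    have spt\<phi>: "spt f \<subseteq> cball x (5 * h x)" if "x \<in> F" "\<And>y. 0 \<le> f y \<and> f y \<le> \<phi> x y" for x f
    proof (rule spt_subset_closed)
      fix y assume "y \<notin> cball x (5 * h x)"
      then have "\<phi> x y = 0" using \<phi>0[OF that(1), of y] by simp
      then show "f y = 0" using that(2)[of y] by simp
    qed simp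
    have grad\<phi>: "grad_norm (\<phi> x) y \<le> (if y \<in> cball x (5 * h x) then B0 / h x else 0)" if "x \<in> F" for x y
    proof (cases "y \<in> cball x (5 * h x)")
      case True
      have "grad_norm (\<phi> x) y \<le> \<bar>1 / h x\<bar> * B0"
        unfolding \<phi>_def grad_norm_compose_affine[OF \<beta>(1)] by (intro mult_left_mono B0) auto
      then show ?thesis using True pos[OF that] by simp
    next
      case False
      then have "y \<notin> spt (\<phi> x)" using spt\<phi>[OF that, of "\<phi> x"] \<phi> by auto
      then show ?thesis using False by (simp add: grad_norm_outside_spt)
    qed
    obtain \<psi> where "(\<forall>x\<in>F. smooth (\<psi> x) \<and> (\<forall>y. 0 \<le> \<psi> x y \<and> \<psi> x y \<le> \<phi> x y \<and>
        grad_norm (\<psi> x) y \<le> (\<Sum>z\<in>F. grad_norm (\<phi> z) y))) \<and>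
        (\<forall>y. (\<Sum>x\<in>F. \<psi> x y) = 1 - (\<Prod>x\<in>F. 1 - \<phi> x y))"
      using telescoping_partition[of F \<phi>, OF F(1) \<phi>] by (rule exE)
    then have \<psi>: "\<And>x. x \<in> F \<Longrightarrow> smooth (\<psi> x)"
        "\<And>x y. x \<in> F \<Longrightarrow> 0 \<le> \<psi> x y \<and> \<psi> x y \<le> \<phi> x y \<and> grad_norm (\<psi> x) y \<le> (\<Sum>z\<in>F. grad_norm (\<phi> z) y)"
        "\<And>y. (\<Sum>x\<in>F. \<psi> x y) = 1 - (\<Prod>x\<in>F. 1 - \<phi> x y)"
      by simp_all
    have spt\<psi>: "spt (\<psi> x) \<subseteq> cball x (5 * h x)" if "x \<in> F" for x
      by (rule spt\<phi>[OF that]) (use \<psi>(2)[OF that] in auto)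
    have "grad_norm (\<psi> x) y \<le> B / h x" if x: "x \<in> F" for x y
    proof (cases "y \<in> cball x (5 * h x)")
      case True
      let ?G = "{z \<in> F. dist z y \<le> 6 * h z}"
      have "grad_norm (\<psi> x) y \<le> (\<Sum>z\<in>F. grad_norm (\<phi> z) y)"
        using \<psi>(2)[OF x] by blast
      also have "\<dots> \<le> (\<Sum>z\<in>?G. grad_norm (\<phi> z) y)"
      proof (rule order_eq_refl, rule sum.mono_neutral_right)
        show "\<forall>z\<in>F - ?G. grad_norm (\<phi> z) y = 0"
        proof
          fix z assume z: "z \<in> F - ?G"
          then have "y \<notin> cball z (5 * h z)" using pos[of z] by auto
          then show "grad_norm (\<phi> z) y = 0"
            using grad\<phi>[of z y] z grad_norm_nonneg[of "\<phi> z" y] by auto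
        qed
      qed (use F in auto)
      also have "\<dots> \<le> (\<Sum>z\<in>?G. 2 * B0 / h x)"
      proof (rule sum_mono)
        fix z assume z: "z \<in> ?G"
        then have "h x \<le> 2 * h z"
          using comparable[of x z y] x True pos[OF x] by auto
        then have "B0 / h z \<le> 2 * B0 / h x"
          using pos[of x] pos[of z] x z B0(1) by (simp add: field_simps)
        then show "grad_norm (\<phi> z) y \<le> 2 * B0 / h x"
          using grad\<phi>[of z y] z pos[OF x] B0(1) by (auto split: if_splits intro: order_trans)
      qed
      also have "\<dots> = real (card ?G) * (2 * B0 / h x)" by simp
      also have "\<dots> \<le> 38 ^ DIM('a) * (2 * B0 / h x)"
      proof (rule mult_right_mono)
        show "real (card ?G) \<le> 38 ^ DIM('a)"
          using overlap[of y] by (metis of_nat_le_iff of_nat_numeral of_nat_power)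
      qed (use pos[OF x] B0(1) in auto)
      also have "\<dots> \<le> B / h x"
        using pos[OF x] by (simp add: B_def divide_right_mono mult_ac)
      finally show ?thesis .
    next
      case False
      then have "y \<notin> spt (\<psi> x)" using spt\<psi>[OF x] by auto
      then show ?thesis
        using pos[OF x] by (simp add: grad_norm_outside_spt B_def)
    qed
    then have cut: "\<forall>x\<in>F. cutoff B (h x) x (\<psi> x)"
      using \<psi> spt\<psi> \<phi>(3) unfolding cutoff_def by (meson order_trans)
    have "(\<Sum>x\<in>F. \<psi> x y) = 1" if y: "y \<in> K" for y
    proof -
      obtain x w where x: "x \<in> F" "dist x w < h x" "dist y w < h y"
        using max[OF y] by auto
      have "h y \<le> h x + dist y x / 20"
        using slowK[OF y subsetD[OF F(2) x(1)]] .
      then have "dist x y \<le> 3 * h x"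
        using x dist_triangle[of x y w] dist_commute[of w y] dist_commute[of x y] pos[OF x(1)] by linarith
      then have "(\<Prod>x\<in>F. 1 - \<phi> x y) = 0"
        using x(1) F(1) \<phi>1 by (auto intro!: prod_zero)
      then show ?thesis by (simp add: \<psi>(3))
    qed
    then show "\<exists>F \<psi>. F \<subseteq> K \<and> slow_balls F h \<and> (\<forall>x\<in>F. cutoff B (h x) x (\<psi> x)) \<and>
          (\<forall>y\<in>K. (\<Sum>x\<in>F. \<psi> x y) = 1)"
      using F(2) cut slow_balls_axioms by blast
  qed
qed

section \<open>Superlinear Young functions\<close>

text \<open>\<open>G\<close> is convex in the form that it is a supremum of affine functions; this form makes Jensen's
  inequality immediate even where \<open>G\<close> is infinite.\<close>

locale young =
  fixes G :: "real \<Rightarrow> ennreal"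
  assumes measurable [measurable]: "G \<in> borel_measurable borel"
    and mono: "0 \<le> s \<Longrightarrow> s \<le> t \<Longrightarrow> G s \<le> G t"
    and zero: "G 0 = 0" and one: "G 1 \<le> 1" and two: "1 \<le> G 2"
    and support: "0 \<le> s \<Longrightarrow> y < G s \<Longrightarrow>
      \<exists>\<alpha> \<beta>. 0 \<le> \<alpha> \<and> 0 \<le> \<beta> \<and> y \<le> ennreal (\<alpha> * s - \<beta>) \<and> (\<forall>t\<ge>0. ennreal (\<alpha> * t - \<beta>) \<le> G t)"
    and superlinear: "0 < \<tau> \<Longrightarrow> \<exists>M\<ge>1. \<forall>s\<ge>0. ennreal M * G (s / M) \<le> ennreal \<tau> * G s"
begin

lemma le_divideI:
  assumes "0 < l" "\<And>y. y < x \<Longrightarrow> ennreal l * y \<le> z"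
  shows "x \<le> z / ennreal l"
proof (rule dense_le)
  fix y assume "y < x"
  then have "ennreal l * y / ennreal l \<le> z / ennreal l"
    by (intro divide_right_mono_ennreal assms)
  then show "y \<le> z / ennreal l"
    using assms(1) by (simp add: mult.commute[of "ennreal l"] ennreal_mult_divide_eq)
qed

lemma ennreal_mult_le:
  assumes "0 < l" "x \<le> z / ennreal l"
  shows "ennreal l * x \<le> z"
proof -
  have "ennreal l * x \<le> ennreal l * (z / ennreal l)"
    using assms by (intro mult_left_mono) auto
  also have "\<dots> = z"
    using assms(1) by (simp add: ennreal_times_divide mult.commute[of "ennreal l"] ennreal_mult_divide_eq)
  finally show ?thesis .
qed

lemma scale:
  assumes "1 \<le> M" "0 \<le> s"
  shows "ennreal M * G (s / M) \<le> G s"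
proof (rule ennreal_mult_le[OF _ le_divideI])
  fix y assume y: "y < G (s / M)"
  obtain \<alpha> \<beta> where ab: "0 \<le> \<alpha>" "0 \<le> \<beta>" "y \<le> ennreal (\<alpha> * (s / M) - \<beta>)" "\<And>t. t \<ge> 0 \<Longrightarrow> ennreal (\<alpha> * t - \<beta>) \<le> G t"
    using support[OF _ y] assms by auto
  have "ennreal M * y \<le> ennreal M * ennreal (\<alpha> * (s / M) - \<beta>)"
    using ab by (intro mult_left_mono) auto
  also have "\<dots> = ennreal (M * (\<alpha> * (s / M) - \<beta>))"
    using assms by (simp add: ennreal_mult')
  also have "\<dots> \<le> ennreal (\<alpha> * s - \<beta>)"
    using assms ab mult_right_mono[of 1 M \<beta>] by (intro ennreal_leI) (simp add: algebra_simps)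
  also have "\<dots> \<le> G s" using ab assms by auto
  finally show "ennreal M * y \<le> G s" .
qed (use assms in auto)

lemma midpoint:
  assumes "0 \<le> s" "0 \<le> t"
  shows "2 * G ((s + t) / 2) \<le> G s + G t"
proof -
  have "ennreal 2 * G ((s + t) / 2) \<le> G s + G t"
  proof (rule ennreal_mult_le[OF _ le_divideI])
    fix y assume y: "y < G ((s + t) / 2)"
    obtain \<alpha> \<beta> where ab: "0 \<le> \<alpha>" "0 \<le> \<beta>" "y \<le> ennreal (\<alpha> * ((s + t) / 2) - \<beta>)" "\<And>t. t \<ge> 0 \<Longrightarrow> ennreal (\<alpha> * t - \<beta>) \<le> G t"
      using support[OF _ y] assms by auto
    have "ennreal 2 * y \<le> ennreal 2 * ennreal (\<alpha> * ((s + t) / 2) - \<beta>)"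
      using ab by (intro mult_left_mono) auto
    also have "\<dots> = ennreal ((\<alpha> * s - \<beta>) + (\<alpha> * t - \<beta>))"
      by (subst ennreal_mult'[symmetric]) (auto simp: algebra_simps add_divide_distrib)
    also have "\<dots> \<le> ennreal (\<alpha> * s - \<beta>) + ennreal (\<alpha> * t - \<beta>)"
      by (cases "0 \<le> \<alpha> * s - \<beta>"; cases "0 \<le> \<alpha> * t - \<beta>")
        (auto simp: ennreal_neg intro!: ennreal_leI simp flip: ennreal_plus)
    also have "\<dots> \<le> G s + G t" using ab assms by (intro add_mono) auto
    finally show "ennreal 2 * y \<le> G s + G t" .
  qed auto
  then show ?thesis by simp
qed

text \<open>Jensen's inequality for the average over an interval: it holds for each affine minorant.\<close>

lemma jensen:
  assumes "0 < l" "continuous_on {0..l} f" "\<And>t. 0 \<le> f t"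
    and "0 \<le> s" "l * s \<le> integral {0..l} f"
  shows "G s \<le> (\<integral>\<^sup>+t. indicator {0..l} t * G (f t) \<partial>lborel) / ennreal l"
proof (rule le_divideI[OF assms(1)])
  fix y assume y: "y < G s"
  obtain \<alpha> \<beta> where ab: "0 \<le> \<alpha>" "0 \<le> \<beta>" "y \<le> ennreal (\<alpha> * s - \<beta>)" "\<And>t. t \<ge> 0 \<Longrightarrow> ennreal (\<alpha> * t - \<beta>) \<le> G t"
    using support[OF assms(4) y] by auto
  let ?g = "\<lambda>t. max 0 (\<alpha> * f t - \<beta>)"
  have f: "f integrable_on {0..l}" using assms(2) by (rule integrable_continuous_real)
  have g: "?g integrable_on {0..l}"
    by (intro integrable_continuous_real continuous_intros assms)
  have "ennreal l * y \<le> ennreal l * ennreal (\<alpha> * s - \<beta>)"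
    using ab by (intro mult_left_mono) auto
  also have "\<dots> = ennreal (\<alpha> * (l * s) - \<beta> * l)"
    using assms(1) by (simp add: ennreal_mult'[symmetric] algebra_simps)
  also have "\<dots> \<le> ennreal (\<alpha> * integral {0..l} f - \<beta> * l)"
    using assms(5) ab by (intro ennreal_leI diff_right_mono mult_left_mono) auto
  also have "\<alpha> * integral {0..l} f - \<beta> * l = integral {0..l} (\<lambda>t. \<alpha> * f t - \<beta>)"
    using assms(1) by (subst integral_diff) (auto intro: integrable_on_mult_right f simp: mult.commute)
  also have "ennreal \<dots> \<le> ennreal (integral {0..l} ?g)"
    by (intro ennreal_leI integral_le g integrable_diff integrable_on_mult_right f) auto
  also have "\<dots> = (\<integral>\<^sup>+t. ennreal (indicator {0..l} t * ?g t) \<partial>lborel)"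
    by (rule nn_integral_has_integral_lebesgue[symmetric]) (use g in \<open>auto intro: integrable_integral\<close>)
  also have "\<dots> \<le> (\<integral>\<^sup>+t. indicator {0..l} t * G (f t) \<partial>lborel)"
  proof (rule nn_integral_mono)
    fix t :: real
    have "ennreal (?g t) \<le> G (f t)"
      using ab(4)[OF assms(3)[of t]] by (auto simp: max_def)
    then show "ennreal (indicator {0..l} t * ?g t) \<le> indicator {0..l} t * G (f t)"
      by (auto simp: indicator_def)
  qed
  finally show "ennreal l * y \<le> (\<integral>\<^sup>+t. indicator {0..l} t * G (f t) \<partial>lborel)" .
qed

text \<open>Superlinearity bounds \<open>G\<close> from below at one large point, and convexity carries the
  bound on to all larger points.\<close>

lemma dominates_linear:
  assumes "0 < \<kappa>"
  obtains S where "S > 0" "\<And>s. s \<ge> S \<Longrightarrow> ennreal s \<le> ennreal \<kappa> * G s"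
proof -
  obtain M where M: "M \<ge> 1" "\<And>s. s \<ge> 0 \<Longrightarrow> ennreal M * G (s / M) \<le> ennreal (\<kappa> / 2) * G s"
    using superlinear[of "\<kappa> / 2"] assms by auto
  show thesis
  proof (rule that[of "2 * M"])
    fix s assume s: "s \<ge> 2 * M"
    let ?c = "s / (2 * M)"
    have c: "?c \<ge> 1" using s M by simp
    have "ennreal s = ennreal (2 * ?c) * (ennreal M * 1)"
      using M s by (simp add: ennreal_mult'[symmetric])
    also have "\<dots> \<le> ennreal (2 * ?c) * (ennreal M * G 2)"
      by (intro mult_left_mono two) auto
    also have "\<dots> \<le> ennreal (2 * ?c) * (ennreal (\<kappa> / 2) * G (2 * M))"
      using M(1) M(2)[of "2 * M"] by (intro mult_left_mono) auto
    also have "\<dots> = ennreal \<kappa> * (ennreal ?c * G (s / ?c))"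
    proof -
      have "ennreal (2 * ?c) * ennreal (\<kappa> / 2) = ennreal \<kappa> * ennreal ?c"
        using M s assms by (simp add: ennreal_mult'[symmetric] mult.commute)
      moreover have "s / ?c = 2 * M" using M s by simp
      ultimately show ?thesis by (simp add: mult.assoc[symmetric])
    qed
    also have "\<dots> \<le> ennreal \<kappa> * G s"
      using c s M by (intro mult_left_mono scale) auto
    finally show "ennreal s \<le> ennreal \<kappa> * G s" .
  qed (use M in auto)
qed

text \<open>Quadratic growth near 0 and linear growth at infinity is what the deviation from the
  tangent of \<open>sqrt (1 + x\<^sup>2)\<close> looks like; it is small against \<open>1 + G\<close>.\<close>

lemma min_quadratic_linear_le:
  assumes "0 < \<kappa>"
  obtains t where "t > 0" "\<And>s. s \<ge> 0 \<Longrightarrow> ennreal (min (t * s\<^sup>2 / 2) (2 * s)) \<le> ennreal \<kappa> * (1 + G s)"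
proof -
  obtain S where S: "S > 0" "\<And>s. s \<ge> S \<Longrightarrow> ennreal s \<le> ennreal (\<kappa> / 2) * G s"
    using dominates_linear[of "\<kappa> / 2"] assms by auto
  show thesis
  proof (rule that[of "\<kappa> / S\<^sup>2"])
    fix s :: real assume s: "s \<ge> 0"
    show "ennreal (min (\<kappa> / S\<^sup>2 * s\<^sup>2 / 2) (2 * s)) \<le> ennreal \<kappa> * (1 + G s)"
    proof (cases "s \<ge> S")
      case True
      have "ennreal (2 * s) = ennreal 2 * ennreal s" using s by (simp add: ennreal_mult')
      also have "\<dots> \<le> ennreal 2 * (ennreal (\<kappa> / 2) * G s)"
        by (intro mult_left_mono S True) auto
      also have "\<dots> = ennreal \<kappa> * G s"
        unfolding mult.assoc[symmetric] by (subst ennreal_mult'[symmetric]) auto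
      also have "\<dots> \<le> ennreal \<kappa> * (1 + G s)"
        by (intro mult_left_mono) auto
      finally show ?thesis
        by (meson ennreal_leI min.cobounded2 order_trans)
    next
      case False
      then have "s\<^sup>2 \<le> S\<^sup>2" using s by (intro power_mono) auto
      then have "\<kappa> / S\<^sup>2 * s\<^sup>2 \<le> \<kappa>"
        using S(1) assms by (simp add: field_simps)
      then have "min (\<kappa> / S\<^sup>2 * s\<^sup>2 / 2) (2 * s) \<le> \<kappa>" using assms by (auto simp: min_def)
      then have "ennreal (min (\<kappa> / S\<^sup>2 * s\<^sup>2 / 2) (2 * s)) \<le> ennreal \<kappa> * 1"
        by (simp add: ennreal_leI)
      also have "\<dots> \<le> ennreal \<kappa> * (1 + G s)"
        by (intro mult_left_mono) auto
      finally show ?thesis .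
    qed
  qed (use assms S in auto)
qed

lemma le_one: "0 \<le> s \<Longrightarrow> s \<le> 1 \<Longrightarrow> G s \<le> 1"
  using mono[of s 1] one by auto

end

section \<open>The energy and the Poincare inequality\<close>

lemma borel_measurable_grad_norm: "smooth v \<Longrightarrow> grad_norm v \<in> borel_measurable borel"
  by (intro borel_measurable_continuous_onI continuous_on_grad_norm)

lemma borel_measurable_smooth: "smooth v \<Longrightarrow> v \<in> borel_measurable borel"
  by (intro borel_measurable_continuous_onI smooth_continuous_on)

context young
begin

definition energy :: "real \<Rightarrow> ('a::euclidean_space \<Rightarrow> 'b::euclidean_space) \<Rightarrow> ennreal" where
  "energy r v = (\<integral>\<^sup>+x. G (r * grad_norm v x) \<partial>lborel)"

text \<open>The functions that compete in the normalised dual seminorm on a ball of radius \<open>r\<close>: rescaled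
  to the unit ball, they have gradients of modular at most 1.\<close>

definition competitors :: "'a::euclidean_space set \<Rightarrow> 'a \<Rightarrow> real \<Rightarrow> ('a \<Rightarrow> 'b::euclidean_space) set" where
  "competitors U a r = {v \<in> test_functions U. spt v \<subseteq> ball a r \<and> energy r v \<le> ennreal (r ^ DIM('a))}"

lemma norm_le_integral_grad_norm:
  assumes v: "smooth v" "spt v \<subseteq> ball a r" and b: "b \<in> Basis" and x: "x \<in> ball a r"
  shows "norm (v x) \<le> integral {0..2 * r} (\<lambda>s. grad_norm v (x + s *\<^sub>R b))"
proof -
  have r: "0 < r" using x by (auto intro: le_less_trans[OF zero_le_dist])
  let ?d = "\<lambda>s. frechet_derivative v (at (x + s *\<^sub>R b)) b"
  have cont: "continuous_on S (\<lambda>s. x + s *\<^sub>R b)" for S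
    by (intro continuous_intros)
  have "((\<lambda>s. v (x + s *\<^sub>R b)) has_vector_derivative ?d s) (at s within {0..2 * r})" for s
  proof -
    have "((\<lambda>s. v (x + s *\<^sub>R b)) has_derivative (\<lambda>h. frechet_derivative v (at (x + s *\<^sub>R b)) (h *\<^sub>R b))) (at s)"
      by (rule has_derivative_compose[of "\<lambda>s. x + s *\<^sub>R b", OF _ smooth_has_derivative[OF v(1)]])
        (auto intro!: derivative_eq_intros)
    moreover have "linear (frechet_derivative v (at (x + s *\<^sub>R b)))"
      using has_derivative_linear[OF smooth_has_derivative[OF v(1)]] .
    ultimately show ?thesis
      unfolding has_vector_derivative_def
      by (simp add: linear_scale has_derivative_at_withinI)
  qed
  then have I: "(?d has_integral (v (x + (2 * r) *\<^sub>R b) - v (x + 0 *\<^sub>R b))) {0..2 * r}"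
    using r by (intro fundamental_theorem_of_calculus) auto
  have "v (x + (2 * r) *\<^sub>R b) = 0"
  proof -
    have "2 * r = dist x (x + (2 * r) *\<^sub>R b)"
      using r b by (simp add: dist_norm)
    also have "\<dots> \<le> dist a x + dist a (x + (2 * r) *\<^sub>R b)"
      by (metis dist_commute dist_triangle)
    finally have "x + (2 * r) *\<^sub>R b \<notin> ball a r" using x by auto
    then show ?thesis using v(2) by (auto intro: zero_outside_spt)
  qed
  then have "integral {0..2 * r} ?d = - v x"
    using integral_unique[OF I] by simp
  moreover have "norm (integral {0..2 * r} ?d) \<le> integral {0..2 * r} (\<lambda>s. grad_norm v (x + s *\<^sub>R b))"
  proof (rule integral_norm_bound_integral)
    have "continuous_on {0..2 * r} (\<lambda>s. ?d s)"
      by (rule continuous_on_compose2[OF smooth_continuous_on[OF smooth_frechet_derivative[OF v(1)], of UNIV] cont]) auto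
    then show "?d integrable_on {0..2 * r}" by (rule integrable_continuous_real)
    have "continuous_on {0..2 * r} (\<lambda>s. grad_norm v (x + s *\<^sub>R b))"
      by (rule continuous_on_compose2[OF continuous_on_grad_norm[OF v(1), of UNIV] cont]) auto
    then show "(\<lambda>s. grad_norm v (x + s *\<^sub>R b)) integrable_on {0..2 * r}" by (rule integrable_continuous_real)
    show "norm (?d s) \<le> grad_norm v (x + s *\<^sub>R b)" for s
      using norm_derivative_le_grad_norm[OF v(1), of "x + s *\<^sub>R b" b] b by simp
  qed
  ultimately show ?thesis by simp
qed

text \<open>Integrate \<open>Dv\<close> along a segment of length \<open>2 * r\<close>, which leaves the ball, apply Jensen's inequality on
  the segment, and use the translation invariance of the outer integral.\<close>

lemma poincare:
  assumes v: "smooth v" "spt v \<subseteq> ball a r" and r: "0 < r"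
  shows "(\<integral>\<^sup>+x. G (norm (v x) / 2) \<partial>lborel) \<le> energy r v"
proof -
  obtain b :: 'a where b: "b \<in> Basis" using nonempty_Basis by blast
  note [measurable] = borel_measurable_grad_norm[OF v(1)] borel_measurable_smooth[OF v(1)]
  let ?I = "\<lambda>x. \<integral>\<^sup>+s. indicator {0..2 * r} s * G (r * grad_norm v (x + s *\<^sub>R b)) \<partial>lborel"
  have "G (norm (v x) / 2) \<le> ?I x / ennreal (2 * r)" for x
  proof (cases "x \<in> ball a r")
    case False
    then have "v x = 0" using v(2) by (auto intro: zero_outside_spt)
    then show ?thesis by (simp add: zero)
  next
    case True
    show ?thesis
    proof (rule jensen)
      have "continuous_on {0..2 * r} (\<lambda>s. x + s *\<^sub>R b)" by (intro continuous_intros)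
      then have "continuous_on {0..2 * r} (\<lambda>s. grad_norm v (x + s *\<^sub>R b))"
        by (rule continuous_on_compose2[OF continuous_on_grad_norm[OF v(1), of UNIV]]) auto
      then show "continuous_on {0..2 * r} (\<lambda>s. r * grad_norm v (x + s *\<^sub>R b))"
        by (intro continuous_intros)
      show "2 * r * (norm (v x) / 2) \<le> integral {0..2 * r} (\<lambda>s. r * grad_norm v (x + s *\<^sub>R b))"
        using norm_le_integral_grad_norm[OF v b True] r by simp
    qed (use r in auto)
  qed
  then have "(\<integral>\<^sup>+x. G (norm (v x) / 2) \<partial>lborel) \<le> (\<integral>\<^sup>+x. ?I x / ennreal (2 * r) \<partial>lborel)"
    by (intro nn_integral_mono)
  also have "\<dots> = (\<integral>\<^sup>+x. ?I x \<partial>lborel) / ennreal (2 * r)"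
    by (rule nn_integral_divide) measurable
  also have "(\<integral>\<^sup>+x. ?I x \<partial>lborel) = (\<integral>\<^sup>+s. (\<integral>\<^sup>+x. indicator {0..2 * r} s * G (r * grad_norm v (x + s *\<^sub>R b)) \<partial>lborel) \<partial>lborel)"
    by (rule lborel_pair.Fubini'[symmetric]) measurable
  also have "\<dots> = (\<integral>\<^sup>+s. indicator {0..2 * r} s * energy r v \<partial>lborel)"
  proof (rule nn_integral_cong)
    fix s :: real
    have "(\<integral>\<^sup>+x. G (r * grad_norm v (x + s *\<^sub>R b)) \<partial>lborel) = (\<integral>\<^sup>+x. G (r * grad_norm v (s *\<^sub>R b + x)) \<partial>lborel)"
      by (simp add: add.commute)
    also have "\<dots> = (\<integral>\<^sup>+x. G (r * grad_norm v x) \<partial>(distr lborel borel ((+) (s *\<^sub>R b))))"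
      by (subst nn_integral_distr) auto
    also have "\<dots> = energy r v"
      by (simp add: lborel_distr_plus energy_def)
    finally show "(\<integral>\<^sup>+x. indicator {0..2 * r} s * G (r * grad_norm v (x + s *\<^sub>R b)) \<partial>lborel) =
        indicator {0..2 * r} s * energy r v"
      by (subst nn_integral_cmult) auto
  qed
  also have "\<dots> = ennreal (2 * r) * energy r v"
    using r by (subst nn_integral_multc) auto
  also have "\<dots> / ennreal (2 * r) = energy r v"
    using r by (simp add: mult.commute[of "ennreal _"] ennreal_mult_divide_eq)
  finally show ?thesis .
qed

end

section \<open>Functionals controlled near a closed set\<close>

lemma integrable_compact_support:
  fixes g :: "'a::euclidean_space \<Rightarrow> real"
  assumes "continuous_on UNIV g" "compact K" "\<And>x. x \<notin> K \<Longrightarrow> g x = 0"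
  shows "integrable lborel g"
proof -
  have "integrable lborel (\<lambda>x. indicator K x *\<^sub>R g x)"
    by (rule borel_integrable_compact) (use assms continuous_on_subset[OF assms(1), of K] in auto)
  moreover have "(\<lambda>x. indicator K x *\<^sub>R g x) = g"
    using assms(3) by (auto simp: indicator_def fun_eq_iff)
  ultimately show ?thesis by simp
qed

lemma integrable_test:
  fixes v :: "'a::euclidean_space \<Rightarrow> 'b::euclidean_space" and f :: "'b \<Rightarrow> real"
  assumes "v \<in> test_functions U" "continuous_on UNIV f" "f 0 = 0"
  shows "integrable lborel (\<lambda>x. f (v x))"
proof (rule integrable_compact_support)
  show "continuous_on UNIV (\<lambda>x. f (v x))"
    by (rule continuous_on_compose2[OF assms(2) smooth_continuous_on[OF test_functionsD(1)[OF assms(1)]]]) auto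
  show "compact (spt v)" by (rule test_functionsD(2)[OF assms(1)])
  show "f (v x) = 0" if "x \<notin> spt v" for x
    using zero_outside_spt[OF that] assms(3) by simp
qed

lemma integrable_norm_test: "v \<in> test_functions U \<Longrightarrow> integrable lborel (\<lambda>x. norm (v x))"
  by (rule integrable_test[where f = norm]) (auto intro: continuous_intros)

lemma integrable_inner_test:
  assumes "v \<in> test_functions U" "continuous_on UNIV w"
  shows "integrable lborel (\<lambda>x. w x \<bullet> v x)"
proof (rule integrable_compact_support)
  show "continuous_on UNIV (\<lambda>x. w x \<bullet> v x)"
    by (intro continuous_intros assms smooth_continuous_on test_functionsD(1)[OF assms(1)])
  show "compact (spt v)" by (rule test_functionsD(2)[OF assms(1)])
  show "w x \<bullet> v x = 0" if "x \<notin> spt v" for x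
    using zero_outside_spt[OF that] by simp
qed

context young
begin

lemma energy_cmult:
  "smooth v \<Longrightarrow> energy r (\<lambda>x. c *\<^sub>R v x) = (\<integral>\<^sup>+x. G (\<bar>c\<bar> * (r * grad_norm v x)) \<partial>lborel)"
  by (simp add: energy_def grad_norm_cmult mult.left_commute)

lemma energy_divide_le:
  assumes "smooth v" "0 \<le> r" "0 \<le> \<tau>" "M \<ge> 1"
    and "\<And>s. 0 \<le> s \<Longrightarrow> ennreal M * G (s / M) \<le> ennreal \<tau> * G s"
  shows "ennreal M * energy r (\<lambda>x. (1 / M) *\<^sub>R v x) \<le> ennreal \<tau> * energy r v"
proof -
  note [measurable] = borel_measurable_grad_norm[OF assms(1)]
  have "ennreal M * energy r (\<lambda>x. (1 / M) *\<^sub>R v x) = (\<integral>\<^sup>+x. ennreal M * G (r * grad_norm v x / M) \<partial>lborel)"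
    using assms by (simp add: energy_cmult nn_integral_cmult)
  also have "\<dots> \<le> (\<integral>\<^sup>+x. ennreal \<tau> * G (r * grad_norm v x) \<partial>lborel)"
    using assms(2) by (intro nn_integral_mono assms(5)) simp
  also have "\<dots> = ennreal \<tau> * energy r v"
    by (simp add: energy_def nn_integral_cmult)
  finally show ?thesis .
qed

lemma competitors_uminus:
  assumes "v \<in> competitors U a r"
  shows "(\<lambda>x. - v x) \<in> competitors U a r"
proof -
  have "v \<in> test_functions U" using assms by (simp add: competitors_def)
  then show ?thesis
    using assms test_functions_cmult[of v U "-1"] spt_cmult[of "-1" v] energy_cmult[of v r "-1"]
    by (auto simp: competitors_def test_functionsD energy_def)
qed

end

locale linear_on_test_functions =
  fixes U :: "'a::euclidean_space set" and T :: "('a \<Rightarrow> 'b::euclidean_space) \<Rightarrow> real"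
  assumes T_add: "u \<in> test_functions U \<Longrightarrow> v \<in> test_functions U \<Longrightarrow> T (\<lambda>x. u x + v x) = T u + T v"
    and T_scale: "v \<in> test_functions U \<Longrightarrow> T (\<lambda>x. c *\<^sub>R v x) = c * T v"
begin

lemma T_zero: "T (\<lambda>x. 0) = 0"
  using T_scale[OF test_functions_zero, of 0] by simp

lemma T_uminus: "v \<in> test_functions U \<Longrightarrow> T (\<lambda>x. - v x) = - T v"
  using T_scale[of v "-1"] by simp

lemma T_sum:
  assumes "finite I" "\<And>i. i \<in> I \<Longrightarrow> v i \<in> test_functions U"
  shows "T (\<lambda>x. \<Sum>i\<in>I. v i x) = (\<Sum>i\<in>I. T (v i))"
  using assms by (induction I) (auto simp: T_zero T_add test_functions_sum)

end

text \<open>The constant \<open>B\<close> is one for which slowly varying partitions of unity exist.  The open set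
  \<open>V\<close> is a bounded neighbourhood of a piece of \<open>C\<close>, thin enough for the bounds at points of
  \<open>C\<close> to reach every point of \<open>V\<close>.\<close>

locale controlled = young G + linear_on_test_functions U T
  for G :: "real \<Rightarrow> ennreal" and U :: "'a::euclidean_space set"
    and T :: "('a \<Rightarrow> 'b::euclidean_space) \<Rightarrow> real" +
  fixes C V :: "'a set" and k \<rho> B :: real
  assumes C: "closed C" "C \<noteq> {}" and k: "k > 0" and \<rho>: "\<rho> > 0"
    and ball_U: "a \<in> C \<Longrightarrow> ball a \<rho> \<subseteq> U"
    and T_bound: "a \<in> C \<Longrightarrow> 0 < r \<Longrightarrow> r < \<rho> \<Longrightarrow> v \<in> competitors U a r \<Longrightarrow> T v \<le> k * r ^ DIM('a)"
    and V: "open V" "bounded V" "x \<in> V \<Longrightarrow> infdist x C < \<rho> / 10"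
    and B: "B \<ge> 1"
    and partition: "\<And>(K :: 'a set) h h0. \<lbrakk>compact K; 0 < h0; \<And>x. x \<in> K \<Longrightarrow> h0 \<le> h x;
       \<And>x y. x \<in> K \<Longrightarrow> y \<in> K \<Longrightarrow> h x \<le> h y + dist x y / 20\<rbrakk>
     \<Longrightarrow> \<exists>F \<psi>. F \<subseteq> K \<and> slow_balls F h \<and> (\<forall>x\<in>F. cutoff B (h x) x (\<psi> x)) \<and>
          (\<forall>y\<in>K. (\<Sum>x\<in>F. \<psi> x y) = 1)"
begin

lemma nearest: obtains a where "a \<in> C" "infdist x C = dist x a"
  using infdist_attains_inf[OF C] by blast

lemma V_subset: "V \<subseteq> U"
proof
  fix x assume x: "x \<in> V"
  obtain a where a: "a \<in> C" "infdist x C = dist x a" by (rule nearest)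
  then have "x \<in> ball a \<rho>" using V(3)[OF x] \<rho> by (simp add: dist_commute)
  then show "x \<in> U" using ball_U a by blast
qed

lemma test_V: "v \<in> test_functions V \<Longrightarrow> v \<in> test_functions U"
  using test_functions_mono[OF V_subset] by blast

text \<open>A function with larger energy than allowed is brought down to size by convexity of \<open>G\<close>.\<close>

lemma T_le_energy:
  assumes "a \<in> C" "0 < r" "r < \<rho>" and v: "v \<in> test_functions U" "spt v \<subseteq> ball a r"
  shows "ennreal \<bar>T v\<bar> \<le> ennreal k * (ennreal (r ^ DIM('a)) + energy r v)"
proof -
  have comp: "\<bar>T u\<bar> \<le> k * r ^ DIM('a)" if u: "u \<in> competitors U a r" for u
    using T_bound[OF assms(1-3) u] T_bound[OF assms(1-3) competitors_uminus[OF u]] T_uminus[of u] u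
    by (simp add: competitors_def)
  have smooth: "smooth v" using v by (simp add: test_functions_def)
  consider "energy r v \<le> ennreal (r ^ DIM('a))" | "energy r v = \<infinity>" | e where "energy r v = ennreal e" "e > r ^ DIM('a)"
  proof (cases "energy r v")
    case (real e)
    then show thesis
      using that(1) that(3)[of e] ennreal_leI[of e "r ^ DIM('a)"] by (cases "e \<le> r ^ DIM('a)") auto
  qed (use that in auto)
  then show ?thesis
  proof cases
    case 1
    then have "\<bar>T v\<bar> \<le> k * r ^ DIM('a)" using v by (intro comp) (simp add: competitors_def)
    then have "ennreal \<bar>T v\<bar> \<le> ennreal k * ennreal (r ^ DIM('a))"
      using k assms by (simp add: ennreal_leI flip: ennreal_mult')
    also have "\<dots> \<le> ennreal k * (ennreal (r ^ DIM('a)) + energy r v)"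
      by (intro mult_left_mono) auto
    finally show ?thesis .
  next
    case 2
    then show ?thesis using k by (simp add: ennreal_mult_top)
  next
    case 3
    have e: "e > 0" using 3(2) assms(2) by (meson less_trans zero_less_power)
    define M where "M = e / r ^ DIM('a)"
    have M: "M \<ge> 1" using 3(2) assms(2) by (simp add: M_def)
    have "ennreal M * energy r (\<lambda>x. (1 / M) *\<^sub>R v x) \<le> ennreal 1 * energy r v"
      by (rule energy_divide_le) (use scale M smooth assms in auto)
    also have "\<dots> = ennreal M * ennreal (r ^ DIM('a))"
      using 3(1) e assms(2) by (simp add: M_def flip: ennreal_mult')
    finally have "energy r (\<lambda>x. (1 / M) *\<^sub>R v x) \<le> ennreal (r ^ DIM('a))"
      using M by (subst (asm) ennreal_mult_le_mult_iff) auto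
    then have "\<bar>T (\<lambda>x. (1 / M) *\<^sub>R v x)\<bar> \<le> k * r ^ DIM('a)"
      using v spt_cmult[of "1 / M" v] test_functions_cmult[of v U]
      by (intro comp) (auto simp: competitors_def)
    then have "\<bar>T v\<bar> / M \<le> k * r ^ DIM('a)"
      using M T_scale[OF v(1), of "1 / M"] by (simp add: abs_mult)
    then have "\<bar>T v\<bar> \<le> k * e"
      using M assms(2) e by (simp add: M_def field_simps)
    then have "ennreal \<bar>T v\<bar> \<le> ennreal k * energy r v"
      using k e by (simp add: 3(1) ennreal_leI flip: ennreal_mult')
    also have "\<dots> \<le> ennreal k * (ennreal (r ^ DIM('a)) + energy r v)"
      by (intro mult_left_mono) auto
    finally show ?thesis .
  qed
qed

text \<open>By superlinearity, dividing the test function by a large \<open>M\<close> decreases its energy by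
  much more than the factor \<open>M\<close> that is lost by linearity.\<close>

lemma T_le_small_energy:
  assumes "\<tau> > 0"
  obtains K where "K > 0"
    "\<And>a r v. \<lbrakk>a \<in> C; 0 < r; r < \<rho>; v \<in> test_functions U; spt v \<subseteq> ball a r\<rbrakk>
      \<Longrightarrow> ennreal \<bar>T v\<bar> \<le> ennreal (K * r ^ DIM('a)) + ennreal \<tau> * energy r v"
proof -
  obtain M where M: "M \<ge> 1" "\<And>s. s \<ge> 0 \<Longrightarrow> ennreal M * G (s / M) \<le> ennreal (\<tau> / k) * G s"
    using superlinear[of "\<tau> / k"] assms k by auto
  show thesis
  proof (rule that[of "M * k"])
    fix a r and v :: "'a \<Rightarrow> 'b"
    assume *: "a \<in> C" "0 < r" "r < \<rho>" and v: "v \<in> test_functions U" "spt v \<subseteq> ball a r"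
    let ?u = "\<lambda>x. (1 / M) *\<^sub>R v x"
    have smooth: "smooth v" using v by (simp add: test_functions_def)
    have "ennreal \<bar>T v\<bar> = ennreal M * ennreal \<bar>T ?u\<bar>"
      using M(1) T_scale[OF v(1), of "1 / M"] by (simp add: abs_mult flip: ennreal_mult')
    also have "\<dots> \<le> ennreal M * (ennreal k * (ennreal (r ^ DIM('a)) + energy r ?u))"
      using v spt_cmult[of "1 / M" v] test_functions_cmult[of v U]
      by (intro mult_left_mono T_le_energy[OF *]) auto
    also have "\<dots> = ennreal (M * k * r ^ DIM('a)) + ennreal k * (ennreal M * energy r ?u)"
      using M k *(2) by (simp add: ennreal_mult' distrib_left mult_ac)
    also have "\<dots> \<le> ennreal (M * k * r ^ DIM('a)) + ennreal k * (ennreal (\<tau> / k) * energy r v)"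
      using M assms k * smooth by (intro add_left_mono mult_left_mono energy_divide_le) auto
    also have "ennreal k * (ennreal (\<tau> / k) * energy r v) = ennreal \<tau> * energy r v"
      using k assms by (simp add: mult.assoc[symmetric] flip: ennreal_mult')
    finally show "ennreal \<bar>T v\<bar> \<le> ennreal (M * k * r ^ DIM('a)) + ennreal \<tau> * energy r v" .
  qed (use M k in auto)
qed

lemma T_le_gradient:
  assumes "a \<in> C" "0 < r" "r < \<rho>" and v: "v \<in> test_functions U" "spt v \<subseteq> ball a r"
    and \<sigma>: "0 < \<sigma>" "\<And>x. r * grad_norm v x \<le> \<sigma>"
  shows "\<bar>T v\<bar> \<le> k * (1 + unit_ball_vol (real DIM('a))) * \<sigma> * r ^ DIM('a)"
proof -
  let ?u = "\<lambda>x. (1 / \<sigma>) *\<^sub>R v x"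
  have smooth: "smooth v" using v by (simp add: test_functions_def)
  have "energy r ?u = (\<integral>\<^sup>+x. G (r * grad_norm v x / \<sigma>) \<partial>lborel)"
    using smooth \<sigma>(1) by (simp add: energy_cmult)
  also have "\<dots> \<le> (\<integral>\<^sup>+x. indicator (ball a r) x \<partial>lborel)"
  proof (rule nn_integral_mono)
    fix x
    show "G (r * grad_norm v x / \<sigma>) \<le> indicator (ball a r) x"
    proof (cases "x \<in> ball a r")
      case True
      then show ?thesis using \<sigma> assms(2) le_one[of "r * grad_norm v x / \<sigma>"] by simp
    next
      case False
      then have "x \<notin> spt v" using v(2) by blast
      then show ?thesis using False by (simp add: grad_norm_outside_spt zero)
    qed
  qed
  also have "\<dots> = ennreal (unit_ball_vol (real DIM('a)) * r ^ DIM('a))"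
    using assms(2) by (simp add: emeasure_ball)
  finally have e: "energy r ?u \<le> ennreal (unit_ball_vol (real DIM('a)) * r ^ DIM('a))" .
  have "ennreal (\<bar>T v\<bar> / \<sigma>) = ennreal \<bar>T ?u\<bar>"
    using \<sigma>(1) T_scale[OF v(1), of "1 / \<sigma>"] by (simp add: abs_mult)
  also have "\<dots> \<le> ennreal k * (ennreal (r ^ DIM('a)) + energy r ?u)"
    using v spt_cmult[of "1 / \<sigma>" v] test_functions_cmult[of v U]
    by (intro T_le_energy[OF assms(1-3)]) auto
  also have "\<dots> \<le> ennreal k * (ennreal (r ^ DIM('a)) + ennreal (unit_ball_vol (real DIM('a)) * r ^ DIM('a)))"
    by (intro mult_left_mono add_left_mono e) auto
  also have "\<dots> = ennreal (k * (1 + unit_ball_vol (real DIM('a))) * r ^ DIM('a))"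
    using k assms(2) by (simp add: algebra_simps flip: ennreal_mult' ennreal_plus)
  finally have "\<bar>T v\<bar> / \<sigma> \<le> k * (1 + unit_ball_vol (real DIM('a))) * r ^ DIM('a)"
    using k assms(2) by (subst (asm) ennreal_le_iff) auto
  then show ?thesis using \<sigma>(1) by (simp add: field_simps)
qed

text \<open>A cut-off at scale \<open>h\<close> around a point at distance at most \<open>20 * h\<close> from \<open>C\<close> is supported in a ball of
  radius \<open>26 * h > 20 * h + 5 * h\<close> around a point of \<open>C\<close>.\<close>

lemma localized_cutoff:
  assumes "0 < h" "26 * h < \<rho>" "infdist x C \<le> 20 * h" "cutoff B h x \<psi>" "v \<in> test_functions V"
  obtains a where "a \<in> C" "(\<lambda>y. \<psi> y *\<^sub>R v y) \<in> test_functions U"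
    "spt (\<lambda>y. \<psi> y *\<^sub>R v y) \<subseteq> ball a (26 * h)"
    "\<And>y. 26 * h * grad_norm (\<lambda>y. \<psi> y *\<^sub>R v y) y \<le>
        indicator (cball x (5 * h)) y * (26 * h * grad_norm v y + 26 * B * norm (v y))"
proof -
  obtain a where a: "a \<in> C" "infdist x C = dist x a" by (rule nearest)
  note \<psi> = cutoffD[OF assms(4)]
  have v: "smooth v" using assms(5) by (simp add: test_functions_def)
  have spt: "spt (\<lambda>y. \<psi> y *\<^sub>R v y) \<subseteq> cball x (5 * h)"
    using spt_scaleR[of \<psi> v] \<psi>(5) by blast
  show thesis
  proof (rule that[OF a(1)])
    show "(\<lambda>y. \<psi> y *\<^sub>R v y) \<in> test_functions U"
      by (intro test_functions_scaleR \<psi> test_V assms)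
    show "spt (\<lambda>y. \<psi> y *\<^sub>R v y) \<subseteq> ball a (26 * h)"
    proof
      fix y assume "y \<in> spt (\<lambda>y. \<psi> y *\<^sub>R v y)"
      then have "dist x y \<le> 5 * h" using spt by auto
      then show "y \<in> ball a (26 * h)"
        using assms(1,3) a(2) dist_triangle[of a y x] by (simp add: dist_commute)
    qed
    fix y
    show "26 * h * grad_norm (\<lambda>y. \<psi> y *\<^sub>R v y) y \<le>
        indicator (cball x (5 * h)) y * (26 * h * grad_norm v y + 26 * B * norm (v y))"
    proof (cases "y \<in> cball x (5 * h)")
      case True
      have "grad_norm (\<lambda>y. \<psi> y *\<^sub>R v y) y \<le> \<bar>\<psi> y\<bar> * grad_norm v y + norm (v y) * grad_norm \<psi> y"
        by (rule grad_norm_scaleR[OF \<psi>(1) v])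
      also have "\<dots> \<le> 1 * grad_norm v y + norm (v y) * (B / h)"
        using \<psi> by (intro add_mono mult_right_mono mult_left_mono) auto
      finally have "26 * h * grad_norm (\<lambda>y. \<psi> y *\<^sub>R v y) y \<le> 26 * h * (grad_norm v y + norm (v y) * (B / h))"
        using assms(1) by (intro mult_left_mono) auto
      then show ?thesis using True assms(1) by (simp add: algebra_simps)
    next
      case False
      then have "y \<notin> spt (\<lambda>y. \<psi> y *\<^sub>R v y)" using spt by blast
      then show ?thesis using False by (simp add: grad_norm_outside_spt)
    qed
  qed
qed

lemma V_radii_bound:
  obtains W where "W > 0"
    "\<And>F h. \<lbrakk>slow_balls F h; F \<subseteq> V; \<And>x. x \<in> F \<Longrightarrow> h x \<le> \<rho>\<rbrakk> \<Longrightarrow> (\<Sum>x\<in>F. h x ^ DIM('a)) \<le> W"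
proof -
  obtain R where R: "R > 0" "V \<subseteq> ball 0 R" by (metis V(2) bounded_subset_ballD)
  have pos_vol: "unit_ball_vol (real DIM('a)) > 0" by simp
  show thesis
  proof (rule that[of "(R + \<rho>) ^ DIM('a)"])
    fix F h assume F: "slow_balls F h" "F \<subseteq> V" "\<And>x. x \<in> F \<Longrightarrow> h x \<le> \<rho>"
    interpret slow_balls F h by fact
    have "(\<Sum>x\<in>F. h x ^ DIM('a)) * unit_ball_vol (real DIM('a)) \<le> measure lebesgue (ball (0::'a) (R + \<rho>))"
    proof (rule sum_ball_volumes_le[OF finite _ _ _ disjoint])
      show "0 \<le> h x" if "x \<in> F" for x using pos[OF that] by simp
      show "ball x (h x) \<subseteq> ball 0 (R + \<rho>)" if x: "x \<in> F" for x
      proof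
        fix y assume "y \<in> ball x (h x)"
        moreover have "norm x < R" using x F(2) R by auto
        ultimately show "y \<in> ball 0 (R + \<rho>)"
          using F(3)[OF x] dist_triangle[of 0 y x] by simp
      qed
    qed simp
    also have "\<dots> = (R + \<rho>) ^ DIM('a) * unit_ball_vol (real DIM('a))"
      using R \<rho> by (simp add: content_ball)
    finally show "(\<Sum>x\<in>F. h x ^ DIM('a)) \<le> (R + \<rho>) ^ DIM('a)"
      using pos_vol by (simp only: mult_le_cancel_right_pos)
  qed (use R \<rho> in auto)
qed

subsection \<open>The seminorm carried by the complement of the closed set\<close>

text \<open>A far family consists of pieces of partitions of unity with the scale \<open>infdist x C / 20\<close>.  The far
  seminorm is the supremum over all far families, which makes it a seminorm at once
  since \<open>T\<close> is linear.\<close>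

definition far_family :: "'a set \<Rightarrow> ('a \<Rightarrow> 'a \<Rightarrow> real) \<Rightarrow> bool" where
  "far_family F \<psi> \<longleftrightarrow> F \<subseteq> V \<and> slow_balls F (\<lambda>x. infdist x C / 20) \<and>
     (\<forall>x\<in>F. cutoff B (infdist x C / 20) x (\<psi> x))"

definition far_seminorm :: "('a \<Rightarrow> 'b) \<Rightarrow> real" where
  "far_seminorm v = (SUP (F, \<psi>) \<in> {(F, \<psi>). far_family F \<psi>}. \<bar>\<Sum>x\<in>F. T (\<lambda>y. \<psi> x y *\<^sub>R v y)\<bar>)"

lemma far_family_radius:
  assumes "far_family F \<psi>" "x \<in> F"
  shows "0 < infdist x C / 20" "26 * (infdist x C / 20) < \<rho>" "cutoff B (infdist x C / 20) x (\<psi> x)"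
proof -
  interpret slow_balls F "\<lambda>x. infdist x C / 20" using assms(1) by (simp add: far_family_def)
  show "0 < infdist x C / 20" using pos[OF assms(2)] by simp
  have "infdist x C < \<rho> / 10" using assms V(3) by (auto simp: far_family_def)
  then show "26 * (infdist x C / 20) < \<rho>" using \<rho> by simp
  show "cutoff B (infdist x C / 20) x (\<psi> x)" using assms by (auto simp: far_family_def)
qed

lemma far_family_empty: "far_family {} \<psi>"
  by (simp add: far_family_def slow_balls_def disjoint_family_on_def)

lemma far_test:
  assumes "far_family F \<psi>" "x \<in> F" "v \<in> test_functions V"
  shows "(\<lambda>y. \<psi> x y *\<^sub>R v y) \<in> test_functions U"
  using far_family_radius(3)[OF assms(1,2)] by (intro test_functions_scaleR test_V assms) (rule cutoffD(1))

lemma far_seminorm_bdd: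
  assumes v: "v \<in> test_functions V"
  shows "bdd_above ((\<lambda>(F, \<psi>). \<bar>\<Sum>x\<in>F. T (\<lambda>y. \<psi> x y *\<^sub>R v y)\<bar>) ` {(F, \<psi>). far_family F \<psi>})"
proof -
  obtain \<Lambda> where \<Lambda>: "\<Lambda> > 0" "\<And>x. grad_norm v x \<le> \<Lambda>"
    using grad_norm_bounded v by (metis test_functionsD(1,2))
  obtain \<beta> where \<beta>: "\<And>x. norm (v x) \<le> \<beta>"
  proof -
    have "compact (v ` spt v)"
      using v by (intro compact_continuous_image smooth_continuous_on test_functionsD)
    then obtain \<beta> where "\<beta> > 0" "\<forall>y\<in>v ` spt v. norm y \<le> \<beta>"
      using compact_imp_bounded bounded_pos by blast
    then have "norm (v x) \<le> \<beta>" for x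
      using zero_outside_spt[of x v] by (cases "x \<in> spt v") auto
    then show thesis by (rule that)
  qed
  obtain W where W: "W > 0"
    "\<And>F h. \<lbrakk>slow_balls F h; F \<subseteq> V; \<And>x. x \<in> F \<Longrightarrow> h x \<le> \<rho>\<rbrakk> \<Longrightarrow> (\<Sum>x\<in>F. h x ^ DIM('a)) \<le> W"
    using V_radii_bound by blast
  define \<sigma> where "\<sigma> = 26 * \<rho> * \<Lambda> + 26 * B * \<beta>"
  have \<beta>0: "0 \<le> \<beta>" using \<beta>[of 0] norm_ge_zero order_trans by blast
  have \<sigma>: "\<sigma> > 0" using \<rho> \<Lambda>(1) B \<beta>0 by (simp add: \<sigma>_def add_pos_nonneg)
  let ?Q = "k * (1 + unit_ball_vol (real DIM('a))) * \<sigma> * 26 ^ DIM('a)"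
  have Q: "?Q \<ge> 0" using k \<sigma> by simp
  show ?thesis
  proof (rule bdd_aboveI2[where M = "?Q * W"], clarify)
    fix F \<psi> assume far: "far_family F \<psi>"
    let ?h = "\<lambda>x. infdist x C / 20"
    have "\<bar>T (\<lambda>y. \<psi> x y *\<^sub>R v y)\<bar> \<le> ?Q * ?h x ^ DIM('a)" if x: "x \<in> F" for x
    proof -
      note h = far_family_radius[OF far x]
      obtain a where a: "a \<in> C" "(\<lambda>y. \<psi> x y *\<^sub>R v y) \<in> test_functions U"
        "spt (\<lambda>y. \<psi> x y *\<^sub>R v y) \<subseteq> ball a (26 * ?h x)"
        "\<And>y. 26 * ?h x * grad_norm (\<lambda>y. \<psi> x y *\<^sub>R v y) y \<le>
          indicator (cball x (5 * ?h x)) y * (26 * ?h x * grad_norm v y + 26 * B * norm (v y))"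
        by (rule localized_cutoff[OF h(1,2) _ h(3) v]) (auto intro: that)
      have "\<bar>T (\<lambda>y. \<psi> x y *\<^sub>R v y)\<bar> \<le> k * (1 + unit_ball_vol (real DIM('a))) * \<sigma> * (26 * ?h x) ^ DIM('a)"
      proof (rule T_le_gradient[OF a(1) _ h(2) a(2,3) \<sigma>])
        fix y
        have "26 * ?h x * grad_norm v y + 26 * B * norm (v y) \<le> \<sigma>"
          unfolding \<sigma>_def using h \<Lambda> \<beta> B by (intro add_mono mult_mono) auto
        then have "indicator (cball x (5 * ?h x)) y * (26 * ?h x * grad_norm v y + 26 * B * norm (v y)) \<le> \<sigma>"
          using \<sigma> by (auto simp: indicator_def)
        then show "26 * ?h x * grad_norm (\<lambda>y. \<psi> x y *\<^sub>R v y) y \<le> \<sigma>"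
          by (rule order_trans[OF a(4)])
      qed (use h in auto)
      then show ?thesis by (simp only: power_mult_distrib mult.assoc)
    qed
    then have "\<bar>\<Sum>x\<in>F. T (\<lambda>y. \<psi> x y *\<^sub>R v y)\<bar> \<le> (\<Sum>x\<in>F. ?Q * ?h x ^ DIM('a))"
      by (intro order_trans[OF sum_abs] sum_mono)
    also have "\<dots> = ?Q * (\<Sum>x\<in>F. ?h x ^ DIM('a))" by (simp add: sum_distrib_left)
    also have "\<dots> \<le> ?Q * W"
    proof (intro mult_left_mono[OF _ Q] W(2))
      show "slow_balls F ?h" "F \<subseteq> V" using far by (auto simp: far_family_def)
      show "?h x \<le> \<rho>" if "x \<in> F" for x using far_family_radius(2)[OF far that] \<rho> by simp
    qed
    finally show "\<bar>\<Sum>x\<in>F. T (\<lambda>y. \<psi> x y *\<^sub>R v y)\<bar> \<le> ?Q * W" .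
  qed
qed

lemma far_seminorm_upper:
  assumes "v \<in> test_functions V" "far_family F \<psi>"
  shows "\<bar>\<Sum>x\<in>F. T (\<lambda>y. \<psi> x y *\<^sub>R v y)\<bar> \<le> far_seminorm v"
  unfolding far_seminorm_def
  by (rule cSUP_upper2[OF far_seminorm_bdd[OF assms(1)], of "(F, \<psi>)"]) (use assms in auto)

lemma far_seminorm_least:
  assumes "\<And>F \<psi>. far_family F \<psi> \<Longrightarrow> \<bar>\<Sum>x\<in>F. T (\<lambda>y. \<psi> x y *\<^sub>R v y)\<bar> \<le> c"
  shows "far_seminorm v \<le> c"
  unfolding far_seminorm_def
  by (rule cSUP_least) (use assms in \<open>auto intro!: exI[of _ "{}"] far_family_empty\<close>)

lemma far_seminorm_add_cmult:
  assumes u: "u \<in> test_functions V" and v: "v \<in> test_functions V" and "0 \<le> t"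
  shows "far_seminorm (\<lambda>x. u x + t *\<^sub>R v x) \<le> far_seminorm u + t * far_seminorm v"
proof (rule far_seminorm_least)
  fix F \<psi> assume far: "far_family F \<psi>"
  have eq: "T (\<lambda>y. \<psi> x y *\<^sub>R (u y + t *\<^sub>R v y)) = T (\<lambda>y. \<psi> x y *\<^sub>R u y) + t * T (\<lambda>y. \<psi> x y *\<^sub>R v y)"
    if x: "x \<in> F" for x
  proof -
    have "(\<lambda>y. \<psi> x y *\<^sub>R (u y + t *\<^sub>R v y)) = (\<lambda>y. \<psi> x y *\<^sub>R u y + t *\<^sub>R (\<psi> x y *\<^sub>R v y))"
      by (simp add: scaleR_add_right mult.commute)
    moreover note u' = far_test[OF far x u] and v' = far_test[OF far x v]
    ultimately show ?thesis
      by (simp only: T_add[OF u' test_functions_cmult[OF v']] T_scale[OF v'])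
  qed
  let ?u = "\<Sum>x\<in>F. T (\<lambda>y. \<psi> x y *\<^sub>R u y)" and ?v = "\<Sum>x\<in>F. T (\<lambda>y. \<psi> x y *\<^sub>R v y)"
  have "(\<Sum>x\<in>F. T (\<lambda>y. \<psi> x y *\<^sub>R (u y + t *\<^sub>R v y))) = ?u + t * ?v"
    unfolding sum_distrib_left sum.distrib[symmetric] by (rule sum.cong[OF refl eq])
  then have "\<bar>\<Sum>x\<in>F. T (\<lambda>y. \<psi> x y *\<^sub>R (u y + t *\<^sub>R v y))\<bar> = \<bar>?u + t * ?v\<bar>"
    by (rule arg_cong)
  also have "\<dots> \<le> \<bar>?u\<bar> + t * \<bar>?v\<bar>"
    using abs_triangle_ineq[of ?u "t * ?v"] unfolding abs_mult abs_of_nonneg[OF assms(3)] .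
  also have "\<dots> \<le> far_seminorm u + t * far_seminorm v"
    using assms(3) by (intro add_mono mult_left_mono far_seminorm_upper far u v)
  finally show "\<bar>\<Sum>x\<in>F. T (\<lambda>y. \<psi> x y *\<^sub>R (u y + t *\<^sub>R v y))\<bar> \<le> far_seminorm u + t * far_seminorm v" .
qed

end

context controlled
begin

subsection \<open>Absolute continuity up to the far seminorm\<close>

text \<open>On a piece of scale \<open>h\<close> the function differs from its value at any point \<open>y\<close> of \<open>ball x h\<close> by a
  multiple of \<open>\<Lambda> * h\<close>.  This gives a bound by \<open>norm (v y) + \<Lambda> * h\<close>, which is then averaged over \<open>y\<close>.\<close>

lemma near_cutoff:
  assumes h: "0 < h" "26 * h < \<rho>" "infdist x C \<le> 20 * h" and \<psi>: "cutoff B h x \<psi>"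
    and v: "v \<in> test_functions V" and \<Lambda>: "0 < \<Lambda>" "\<And>y. grad_norm v y \<le> \<Lambda>"
  shows "\<bar>T (\<lambda>y. \<psi> y *\<^sub>R v y)\<bar> \<le> k * (1 + unit_ball_vol (real DIM('a))) * 26 ^ DIM('a) * (208 * B) *
    ((\<integral>y. indicator (ball x h) y * norm (v y) \<partial>lborel) / unit_ball_vol (real DIM('a)) + \<Lambda> * h * h ^ DIM('a))"
proof -
  let ?\<omega> = "unit_ball_vol (real DIM('a))"
  let ?K = "k * (1 + ?\<omega>) * 26 ^ DIM('a) * (208 * B)"
  let ?t = "\<bar>T (\<lambda>y. \<psi> y *\<^sub>R v y)\<bar>"
  have \<omega>: "?\<omega> > 0" by simp
  have smooth: "smooth v" using v by (rule test_functionsD)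
  obtain a where a: "a \<in> C" "(\<lambda>y. \<psi> y *\<^sub>R v y) \<in> test_functions U"
    "spt (\<lambda>y. \<psi> y *\<^sub>R v y) \<subseteq> ball a (26 * h)"
    "\<And>y. 26 * h * grad_norm (\<lambda>y. \<psi> y *\<^sub>R v y) y \<le>
      indicator (cball x (5 * h)) y * (26 * h * grad_norm v y + 26 * B * norm (v y))"
    by (rule localized_cutoff[OF h \<psi> v]) (auto intro: that)
  have pt: "?t \<le> ?K * h ^ DIM('a) * (norm (v y) + h * \<Lambda>)" if y: "y \<in> ball x h" for y
  proof -
    define \<sigma> where "\<sigma> = 26 * h * \<Lambda> + 26 * B * (norm (v y) + 6 * h * \<Lambda>)"
    have \<sigma>: "\<sigma> > 0" using h \<Lambda> B by (simp add: \<sigma>_def add_pos_nonneg)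
    have "?t \<le> k * (1 + ?\<omega>) * \<sigma> * (26 * h) ^ DIM('a)"
    proof (rule T_le_gradient[OF a(1) _ h(2) a(2,3) \<sigma>])
      fix z
      have "26 * h * grad_norm v z + 26 * B * norm (v z) \<le> \<sigma>" if z: "z \<in> cball x (5 * h)"
      proof -
        have "dist z y \<le> 6 * h" using y z dist_triangle[of z y x] by (simp add: dist_commute)
        then have "\<Lambda> * norm (z - y) \<le> \<Lambda> * (6 * h)"
          using \<Lambda>(1) by (intro mult_left_mono) (auto simp: dist_norm)
        then have "norm (v z) \<le> norm (v y) + 6 * h * \<Lambda>"
          using norm_diff_le_grad_norm[OF smooth \<Lambda>(2), of z y] norm_triangle_ineq2[of "v z" "v y"]
          by (simp add: mult_ac)
        then show ?thesis
          unfolding \<sigma>_def using h \<Lambda> B by (intro add_mono mult_left_mono) auto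
      qed
      then have "indicator (cball x (5 * h)) z * (26 * h * grad_norm v z + 26 * B * norm (v z)) \<le> \<sigma>"
        using \<sigma> by (auto simp: indicator_def)
      then show "26 * h * grad_norm (\<lambda>y. \<psi> y *\<^sub>R v y) z \<le> \<sigma>"
        by (rule order_trans[OF a(4)])
    qed (use h in auto)
    also have "\<sigma> \<le> (208 * B) * (norm (v y) + h * \<Lambda>)"
    proof -
      have "26 * (h * \<Lambda>) \<le> 52 * (B * (h * \<Lambda>))"
        using mult_right_mono[OF B, of "h * \<Lambda>"] h \<Lambda> by simp
      moreover have "0 \<le> B * norm (v y)" using B by simp
      moreover have "\<sigma> = 26 * (h * \<Lambda>) + 26 * (B * norm (v y)) + 156 * (B * (h * \<Lambda>))"
        unfolding \<sigma>_def by (simp add: algebra_simps)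
      ultimately show ?thesis unfolding distrib_left mult.assoc by linarith
    qed
    finally have "?t \<le> k * (1 + ?\<omega>) * ((208 * B) * (norm (v y) + h * \<Lambda>)) * (26 * h) ^ DIM('a)"
      using k h by (simp add: mult_left_mono mult_right_mono)
    then show ?thesis by (simp only: power_mult_distrib mult_ac)
  qed
  have int: "integrable lborel (\<lambda>y. indicator (ball x h) y * norm (v y))"
    using integrable_mult_indicator[OF _ integrable_norm_test[OF v], of "ball x h"] by simp
  have int1: "integrable lborel (indicator (ball x h) :: 'a \<Rightarrow> real)"
    by (rule integrable_real_indicator) (use emeasure_lborel_ball_finite[of x h] in auto)
  have vol: "(\<integral>y. indicator (ball x h) y \<partial>lborel) = ?\<omega> * h ^ DIM('a)"
    using h by (simp add: content_ball)
  have "?t * (?\<omega> * h ^ DIM('a)) = (\<integral>y. ?t * indicator (ball x h) y \<partial>lborel)"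
    by (simp only: integral_mult_right_zero vol)
  also have "\<dots> \<le> (\<integral>y. ?K * h ^ DIM('a) * (indicator (ball x h) y * norm (v y) + h * \<Lambda> * indicator (ball x h) y) \<partial>lborel)"
  proof (rule integral_mono)
    fix y
    show "?t * indicator (ball x h) y \<le> ?K * h ^ DIM('a) * (indicator (ball x h) y * norm (v y) + h * \<Lambda> * indicator (ball x h) y)"
      using pt[of y] by (cases "y \<in> ball x h") auto
  qed (intro integrable_mult_right Bochner_Integration.integrable_add int int1)+
  also have "\<dots> = ?K * h ^ DIM('a) * ((\<integral>y. indicator (ball x h) y * norm (v y) \<partial>lborel) + h * \<Lambda> * (?\<omega> * h ^ DIM('a)))"
    using int int1 by (simp only: integral_mult_right_zero Bochner_Integration.integral_add integrable_mult_right vol)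
  also have "\<dots> = ?K * ((\<integral>y. indicator (ball x h) y * norm (v y) \<partial>lborel) / ?\<omega> + \<Lambda> * h * h ^ DIM('a)) * (?\<omega> * h ^ DIM('a))"
    by (simp add: field_simps less_imp_neq[OF \<omega>, symmetric])
  finally show ?thesis
    using h by (simp only: mult_le_cancel_right_pos mult_pos_pos \<omega> zero_less_power)
qed

lemma sum_indicator_disjoint_le:
  assumes "finite F" "disjoint_family_on A F"
  shows "(\<Sum>x\<in>F. indicator (A x) y :: real) \<le> 1"
proof -
  have "(\<Sum>x\<in>F. indicator (A x) y :: real) = indicator (\<Union>x\<in>F. A x) y"
    by (rule indicator_UN_disjoint[OF assms, symmetric])
  then show ?thesis by (simp add: indicator_def)
qed

text \<open>Cut a test function along a partition of unity of scale \<open>max \<epsilon> (infdist x C) / 20\<close>.  The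
  pieces at distance more than \<open>\<epsilon>\<close> from \<open>C\<close> are seen by the far seminorm; each remaining piece
  is nearly constant, and the bound at a point of \<open>C\<close> turns into the \<open>L\<^sup>1\<close> norm as \<open>\<epsilon>\<close> tends to 0.\<close>

lemma T_le_L1_far:
  obtains K where "K > 0"
    "\<And>v. v \<in> test_functions V \<Longrightarrow> T v \<le> K * (\<integral>y. norm (v y) \<partial>lborel) + far_seminorm v"
proof -
  let ?\<omega> = "unit_ball_vol (real DIM('a))"
  let ?K = "k * (1 + ?\<omega>) * 26 ^ DIM('a) * (208 * B)"
  have \<omega>: "?\<omega> > 0" by simp
  have K: "?K > 0" using k B \<omega> by (simp add: add_pos_pos)
  obtain W where W: "W > 0"
    "\<And>F h. \<lbrakk>slow_balls F h; F \<subseteq> V; \<And>x. x \<in> F \<Longrightarrow> h x \<le> \<rho>\<rbrakk> \<Longrightarrow> (\<Sum>x\<in>F. h x ^ DIM('a)) \<le> W"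
    using V_radii_bound by blast
  show thesis
  proof (rule that[of "?K / ?\<omega>"])
    show "0 < ?K / ?\<omega>" using K \<omega> by simp
    fix v :: "'a \<Rightarrow> 'b" assume v: "v \<in> test_functions V"
    note smooth = test_functionsD(1)[OF v]
    obtain \<Lambda> where \<Lambda>: "\<Lambda> > 0" "\<And>x. grad_norm v x \<le> \<Lambda>"
      using grad_norm_bounded v by (metis test_functionsD(1,2))
    let ?N = "\<integral>y. norm (v y) \<partial>lborel"
    have main: "T v \<le> ?K / ?\<omega> * ?N + far_seminorm v + \<epsilon> * (?K * \<Lambda> * W)" if \<epsilon>: "0 < \<epsilon>" "\<epsilon> < \<rho> / 10" for \<epsilon>
    proof -
      define h where "h x = max \<epsilon> (infdist x C) / 20" for x
      have "\<exists>F \<psi>. F \<subseteq> spt v \<and> slow_balls F h \<and> (\<forall>x\<in>F. cutoff B (h x) x (\<psi> x)) \<and>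
          (\<forall>y\<in>spt v. (\<Sum>x\<in>F. \<psi> x y) = 1)"
      proof (rule partition[where ?h0.0 = "\<epsilon> / 20"])
        show "compact (spt v)" by (rule test_functionsD(2)[OF v])
        show "h x \<le> h y + dist x y / 20" for x y
        proof -
          have "max \<epsilon> (infdist x C) \<le> max \<epsilon> (infdist y C) + dist x y"
            by (rule max.boundedI)
              (use infdist_triangle[of x C y] zero_le_dist[of x y] max.cobounded1[of \<epsilon> "infdist y C"]
                max.cobounded2[of "infdist y C" \<epsilon>] in linarith)+
          then show ?thesis by (simp add: h_def)
        qed
      qed (use \<epsilon> in \<open>auto simp: h_def\<close>)
      then obtain F \<psi> where F: "F \<subseteq> spt v" "slow_balls F h" "\<And>x. x \<in> F \<Longrightarrow> cutoff B (h x) x (\<psi> x)"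
        "\<And>y. y \<in> spt v \<Longrightarrow> (\<Sum>x\<in>F. \<psi> x y) = 1"
        by blast
      interpret slow_balls F h by fact
      have FV: "F \<subseteq> V" using F(1) test_functionsD(3)[OF v] by blast
      let ?p = "\<lambda>x y. \<psi> x y *\<^sub>R v y"
      define F1 where "F1 = {x \<in> F. infdist x C > \<epsilon>}"
      define F2 where "F2 = {x \<in> F. infdist x C \<le> \<epsilon>}"
      have split: "F = F1 \<union> F2" "F1 \<inter> F2 = {}" "finite F1" "finite F2"
        using finite by (auto simp: F1_def F2_def)
      have h1: "h x = infdist x C / 20" if "x \<in> F1" for x
        using that by (simp add: h_def F1_def)
      have h2: "h x = \<epsilon> / 20" if "x \<in> F2" for x
        using that by (simp add: h_def F2_def)
      have p: "?p x \<in> test_functions U" if "x \<in> F" for x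
        using cutoffD(1)[OF F(3)[OF that]] test_V[OF v] by (rule test_functions_scaleR)
      have "v = (\<lambda>y. \<Sum>x\<in>F. ?p x y)"
      proof
        fix y show "v y = (\<Sum>x\<in>F. ?p x y)"
          using F(4)[of y] zero_outside_spt[of y v]
          by (cases "y \<in> spt v") (auto simp flip: scaleR_left.sum)
      qed
      then have "T v = T (\<lambda>y. \<Sum>x\<in>F. ?p x y)" by (rule arg_cong)
      also have "\<dots> = (\<Sum>x\<in>F. T (?p x))" by (rule T_sum[OF finite p])
      also have "\<dots> = (\<Sum>x\<in>F1. T (?p x)) + (\<Sum>x\<in>F2. T (?p x))"
        unfolding split(1) by (rule sum.union_disjoint) (use split in auto)
      also have "(\<Sum>x\<in>F1. T (?p x)) \<le> far_seminorm v"
      proof -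
        have "far_family F1 \<psi>"
          unfolding far_family_def
        proof (intro conjI ballI)
          show "F1 \<subseteq> V" using FV by (auto simp: F1_def)
          show "slow_balls F1 (\<lambda>x. infdist x C / 20)"
          proof
            show "disjoint_family_on (\<lambda>x. ball x (infdist x C / 20)) F1"
              unfolding disjoint_family_on_def
            proof (intro ballI impI)
              fix x y assume "x \<in> F1" "y \<in> F1" "x \<noteq> y"
              then have "ball x (h x) \<inter> ball y (h y) = {}"
                using disjoint split(1) by (simp add: disjoint_family_on_def)
              then show "ball x (infdist x C / 20) \<inter> ball y (infdist y C / 20) = {}"
                using h1 \<open>x \<in> F1\<close> \<open>y \<in> F1\<close> by simp
            qed
            show "0 < infdist x C / 20" if "x \<in> F1" for x
              using pos[of x] h1[OF that] split(1) that by simp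
            show "infdist x C / 20 \<le> infdist y C / 20 + dist x y / 20" for x y
              using infdist_triangle[of x C y] by simp
          qed (rule split)
          show "cutoff B (infdist x C / 20) x (\<psi> x)" if "x \<in> F1" for x
            using F(3)[of x] h1[OF that] split(1) that by simp
        qed
        from far_seminorm_upper[OF v this] show ?thesis by simp
      qed
      also have "(\<Sum>x\<in>F2. T (?p x)) \<le> ?K / ?\<omega> * ?N + \<epsilon> * (?K * \<Lambda> * W)"
      proof -
        have "(\<Sum>x\<in>F2. T (?p x)) \<le> (\<Sum>x\<in>F2. ?K * ((\<integral>y. indicator (ball x (h x)) y * norm (v y) \<partial>lborel) / ?\<omega> + \<Lambda> * h x * h x ^ DIM('a)))"
        proof (rule sum_mono)
          fix x assume x: "x \<in> F2"
          have "\<bar>T (?p x)\<bar> \<le> ?K * ((\<integral>y. indicator (ball x (h x)) y * norm (v y) \<partial>lborel) / ?\<omega> + \<Lambda> * h x * h x ^ DIM('a))"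
          proof (rule near_cutoff[OF _ _ _ F(3) v \<Lambda>])
            show "x \<in> F" using x by (simp add: F2_def)
            show "0 < h x" "26 * h x < \<rho>" unfolding h2[OF x] using \<epsilon> \<rho> by simp_all
            show "infdist x C \<le> 20 * h x" unfolding h2[OF x] using x by (simp add: F2_def)
          qed
          then show "T (?p x) \<le> ?K * ((\<integral>y. indicator (ball x (h x)) y * norm (v y) \<partial>lborel) / ?\<omega> + \<Lambda> * h x * h x ^ DIM('a))"
            by (rule order_trans[OF abs_ge_self])
        qed
        also have "\<dots> = (\<Sum>x\<in>F2. ?K * ((\<integral>y. indicator (ball x (h x)) y * norm (v y) \<partial>lborel) / ?\<omega> + \<Lambda> * (\<epsilon> / 20) * h x ^ DIM('a)))"
          by (rule sum.cong[OF refl]) (simp only: h2)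
        also have "\<dots> = ?K * ((\<Sum>x\<in>F2. \<integral>y. indicator (ball x (h x)) y * norm (v y) \<partial>lborel) / ?\<omega> + \<Lambda> * (\<epsilon> / 20) * (\<Sum>x\<in>F2. h x ^ DIM('a)))"
          by (simp only: sum_distrib_left sum.distrib sum_divide_distrib distrib_left mult.assoc)
        also have "\<dots> \<le> ?K * (?N / ?\<omega> + \<Lambda> * (\<epsilon> / 20) * W)"
        proof (intro mult_left_mono add_mono divide_right_mono)
          have int: "integrable lborel (\<lambda>y. indicator (ball x (h x)) y * norm (v y))" for x
            using integrable_mult_indicator[OF _ integrable_norm_test[OF v], of "ball x (h x)"] by simp
          have "(\<Sum>x\<in>F2. \<integral>y. indicator (ball x (h x)) y * norm (v y) \<partial>lborel) =
              (\<integral>y. (\<Sum>x\<in>F2. indicator (ball x (h x)) y * norm (v y)) \<partial>lborel)"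
            by (rule Bochner_Integration.integral_sum[symmetric]) (rule int)
          also have "\<dots> \<le> ?N"
          proof (rule integral_mono)
            fix y
            have "disjoint_family_on (\<lambda>x. ball x (h x)) F2"
              using disjoint split(1) by (auto simp: disjoint_family_on_def)
            then have "(\<Sum>x\<in>F2. indicator (ball x (h x)) y) * norm (v y) \<le> 1 * norm (v y)"
              by (intro mult_right_mono sum_indicator_disjoint_le split) auto
            then show "(\<Sum>x\<in>F2. indicator (ball x (h x)) y * norm (v y)) \<le> norm (v y)"
              by (simp add: sum_distrib_right)
          qed (intro Bochner_Integration.integrable_sum int integrable_norm_test[OF v])+
          finally show "(\<Sum>x\<in>F2. \<integral>y. indicator (ball x (h x)) y * norm (v y) \<partial>lborel) \<le> ?N" .
          have "(\<Sum>x\<in>F2. h x ^ DIM('a)) \<le> (\<Sum>x\<in>F. h x ^ DIM('a))"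
            by (rule sum_mono2) (use finite split(1) pos in \<open>auto intro: less_imp_le\<close>)
          also have "\<dots> \<le> W"
          proof (rule W(2)[OF F(2) FV])
            fix x assume "x \<in> F"
            then have "infdist x C < \<rho> / 10" using V(3) FV by blast
            then show "h x \<le> \<rho>" using \<epsilon> \<rho> by (simp add: h_def)
          qed
          finally show "(\<Sum>x\<in>F2. h x ^ DIM('a)) \<le> W" .
        qed (use K \<Lambda> \<epsilon> in \<open>auto intro: less_imp_le\<close>)
        also have "\<dots> = ?K / ?\<omega> * ?N + \<epsilon> * (?K * \<Lambda> * W) / 20"
        proof -
          have "K * (N / w + L * (e / 20) * W) = K / w * N + e * (K * L * W) / 20" for K N w L e W :: real
            by (simp add: algebra_simps)
          then show ?thesis .
        qed
        also have "\<dots> \<le> ?K / ?\<omega> * ?N + \<epsilon> * (?K * \<Lambda> * W)"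
        proof -
          have "0 \<le> \<epsilon> * (?K * \<Lambda> * W)"
            by (intro mult_nonneg_nonneg less_imp_le K \<Lambda> \<epsilon> W)
          then show ?thesis by linarith
        qed
        finally show ?thesis .
      qed
      finally show ?thesis by simp
    qed
    have "((\<lambda>\<epsilon>. ?K / ?\<omega> * ?N + far_seminorm v + \<epsilon> * (?K * \<Lambda> * W)) \<longlongrightarrow>
        ?K / ?\<omega> * ?N + far_seminorm v + 0 * (?K * \<Lambda> * W)) (at_right 0)"
      by (intro tendsto_intros)
    moreover have "eventually (\<lambda>\<epsilon>. T v \<le> ?K / ?\<omega> * ?N + far_seminorm v + \<epsilon> * (?K * \<Lambda> * W)) (at_right 0)"
      using main \<rho> by (intro eventually_at_rightI[of 0 "\<rho> / 10"]) auto
    ultimately have "T v \<le> ?K / ?\<omega> * ?N + far_seminorm v + 0 * (?K * \<Lambda> * W)"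
      by (rule tendsto_lowerbound) simp
    then show "T v \<le> ?K / ?\<omega> * ?N + far_seminorm v" by simp
  qed
qed

end

subsection \<open>Approximation by continuous functions\<close>

text \<open>The second order error of the function \<open>sqrt (1 + \<bar>a\<bar>\<^sup>2)\<close> is bounded quadratically since its second
  derivative is at most \<open>1\<close>, and linearly since it has Lipschitz constant \<open>1\<close>.\<close>

lemma sqrt_one_plus_norm_expansion:
  fixes a b :: "'b::real_inner"
  shows "sqrt (1 + (norm (a + b))\<^sup>2) \<le>
    sqrt (1 + (norm a)\<^sup>2) + (a \<bullet> b) / sqrt (1 + (norm a)\<^sup>2) + min ((norm b)\<^sup>2 / 2) (2 * norm b)"
proof -
  define A where "A = sqrt (1 + (norm a)\<^sup>2)"
  have A: "A \<ge> 1" "A\<^sup>2 = 1 + (norm a)\<^sup>2" "norm a \<le> A"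
    by (auto simp: A_def intro: real_le_rsqrt)
  define x where "x = 2 * (a \<bullet> b) + (norm b)\<^sup>2"
  have sq: "1 + (norm (a + b))\<^sup>2 = A\<^sup>2 + x"
    unfolding A(2) x_def power2_norm_eq_inner by (simp add: inner_simps inner_commute)
  have nn: "0 \<le> A\<^sup>2 + x" unfolding sq[symmetric] by simp
  have "sqrt (A\<^sup>2 + x) \<le> A + x / (2 * A)"
  proof (rule real_le_lsqrt)
    have "0 \<le> (2 * A\<^sup>2 + x) / (2 * A)"
      using nn A(1) zero_le_power2[of A] by (intro divide_nonneg_pos) linarith+
    then show "0 \<le> A + x / (2 * A)" using A(1) by (simp add: field_simps power2_eq_square)
    have "(A + x / (2 * A))\<^sup>2 = A\<^sup>2 + x + (x / (2 * A))\<^sup>2"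
      using A(1) by (simp add: power2_sum field_simps power2_eq_square[of A])
    then show "A\<^sup>2 + x \<le> (A + x / (2 * A))\<^sup>2" by simp
  qed
  moreover have "x / (2 * A) \<le> (a \<bullet> b) / A + (norm b)\<^sup>2 / 2"
  proof -
    have "(norm b)\<^sup>2 / (2 * A) \<le> (norm b)\<^sup>2 / 2" using A(1) by (intro divide_left_mono) auto
    then show ?thesis using A(1) by (simp add: x_def add_divide_distrib)
  qed
  moreover have "sqrt (A\<^sup>2 + x) \<le> A + (a \<bullet> b) / A + 2 * norm b"
  proof -
    have ab: "\<bar>a \<bullet> b\<bar> \<le> A * norm b"
      using Cauchy_Schwarz_ineq2[of a b] mult_right_mono[OF A(3) norm_ge_zero, of b] by linarith
    have "sqrt (A\<^sup>2 + x) \<le> A + norm b"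
      by (rule real_le_lsqrt) (use A ab nn in \<open>auto simp: x_def power2_sum\<close>)
    moreover have "- norm b \<le> (a \<bullet> b) / A"
      using ab A(1) by (simp add: field_simps abs_le_iff)
    ultimately show ?thesis by linarith
  qed
  ultimately show ?thesis
    unfolding sq A_def[symmetric] by (simp add: min_def)
qed

context controlled
begin

text \<open>A near-minimiser \<open>u\<close> of the convex functional
  \<open>K * \<integral>(sqrt (1 + \<bar>u\<bar>\<^sup>2) - 1) + far_seminorm u - T u\<close>, which is bounded below because of the
  hypothesis on \<open>K\<close>, satisfies an approximate Euler-Lagrange inequality.  It says that \<open>T\<close> is close to the density
  \<open>w = K u / sqrt (1 + \<bar>u\<bar>\<^sup>2)\<close>, uniformly over all test functions \<open>v\<close> and all step sizes \<open>t\<close>.\<close>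

lemma approximate_density:
  assumes K: "K > 0" "\<And>v. v \<in> test_functions V \<Longrightarrow> T v \<le> K * (\<integral>y. norm (v y) \<partial>lborel) + far_seminorm v"
    and \<delta>: "\<delta> > 0"
  obtains w :: "'a \<Rightarrow> 'b" where "continuous_on UNIV w"
    "\<And>v t. \<lbrakk>v \<in> test_functions V; t > 0\<rbrakk> \<Longrightarrow>
      T v - (\<integral>y. w y \<bullet> v y \<partial>lborel) \<le> far_seminorm v + \<delta> / t +
        K * (\<integral>y. min (t * (norm (v y))\<^sup>2 / 2) (2 * norm (v y)) \<partial>lborel)"
proof -
  let ?\<phi> = "\<lambda>a::'b. sqrt (1 + (norm a)\<^sup>2) - 1"
  define J where "J u = K * (\<integral>y. ?\<phi> (u y) \<partial>lborel) + far_seminorm u - T u" for u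
  have int\<phi>: "integrable lborel (\<lambda>y. ?\<phi> (u y))" if "u \<in> test_functions V" for u :: "'a \<Rightarrow> 'b"
    by (rule integrable_test[OF that]) (auto intro!: continuous_intros)
  have fin: "integrable lborel (indicator V :: 'a \<Rightarrow> real)"
    by (rule integrable_real_indicator) (use V emeasure_bounded_finite[of V] in auto)
  have low: "- (K * measure lborel V) \<le> J u" if u: "u \<in> test_functions V" for u
  proof -
    have "(\<integral>y. norm (u y) \<partial>lborel) - measure lborel V = (\<integral>y. norm (u y) - indicator V y \<partial>lborel)"
      using integrable_norm_test[OF u] fin by (simp add: V)
    also have "\<dots> \<le> (\<integral>y. ?\<phi> (u y) \<partial>lborel)"
    proof (rule integral_mono)
      fix y
      have "norm (u y) \<le> sqrt (1 + (norm (u y))\<^sup>2)" by (rule real_le_rsqrt) simp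
      moreover have "u y = 0" if "y \<notin> V"
        using that test_functionsD(3)[OF u] zero_outside_spt[of y u] by blast
      ultimately show "norm (u y) - indicator V y \<le> ?\<phi> (u y)"
        by (cases "y \<in> V") auto
    qed (intro Bochner_Integration.integrable_diff integrable_norm_test[OF u] fin int\<phi> u)+
    finally have "K * (\<integral>y. norm (u y) \<partial>lborel) - K * measure lborel V \<le> K * (\<integral>y. ?\<phi> (u y) \<partial>lborel)"
      using K(1) by (simp flip: right_diff_distrib)
    then show ?thesis using K(2)[OF u] by (simp add: J_def)
  qed
  have bdd: "bdd_below (J ` test_functions V)"
    by (rule bdd_belowI2) (rule low)
  have ne: "J ` test_functions V \<noteq> {}" using test_functions_zero by blast
  have "Inf (J ` test_functions V) < Inf (J ` test_functions V) + \<delta>" using \<delta> by simp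
  then obtain u where u: "u \<in> test_functions V" "J u < Inf (J ` test_functions V) + \<delta>"
    using cInf_lessD[OF ne] by blast
  have min: "J u \<le> J u' + \<delta>" if "u' \<in> test_functions V" for u'
    using cInf_lower[OF imageI[OF that] bdd] u(2) by linarith
  define w where "w y = (K / sqrt (1 + (norm (u y))\<^sup>2)) *\<^sub>R u y" for y
  have pos: "sqrt (1 + (norm (u y))\<^sup>2) \<noteq> 0" for y
    by (metis add_pos_nonneg less_irrefl real_sqrt_gt_zero zero_le_power2 zero_less_one)
  have w: "continuous_on UNIV w"
    unfolding w_def using pos
    by (intro continuous_intros smooth_continuous_on test_functionsD(1)[OF u(1)]) auto
  show thesis
  proof (rule that[OF w])
    fix v :: "'a \<Rightarrow> 'b" and t :: real assume v: "v \<in> test_functions V" and t: "t > 0"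
    let ?u = "\<lambda>x. u x + t *\<^sub>R v x"
    let ?q = "\<lambda>y. min (t * (norm (v y))\<^sup>2 / 2) (2 * norm (v y))"
    have u': "?u \<in> test_functions V" by (intro test_functions_add test_functions_cmult u v)
    have intq: "integrable lborel ?q"
      by (rule integrable_test[OF v, where f = "\<lambda>a. min (t * (norm a)\<^sup>2 / 2) (2 * norm a)"])
        (auto intro!: continuous_intros)
    have intw: "integrable lborel (\<lambda>y. w y \<bullet> v y)" by (rule integrable_inner_test[OF v w])
    have "K * (\<integral>y. ?\<phi> (?u y) \<partial>lborel) = (\<integral>y. K * ?\<phi> (?u y) \<partial>lborel)" by simp
    also have "\<dots> \<le> (\<integral>y. K * ?\<phi> (u y) + t * (w y \<bullet> v y) + K * t * ?q y \<partial>lborel)"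
    proof (rule integral_mono)
      fix y
      have "min ((norm (t *\<^sub>R v y))\<^sup>2 / 2) (2 * norm (t *\<^sub>R v y)) = t * ?q y"
        using t by (simp add: min_mult_distrib_left power_mult_distrib power2_eq_square[of t] mult_ac)
      then have "?\<phi> (?u y) \<le> ?\<phi> (u y) + (u y \<bullet> (t *\<^sub>R v y)) / sqrt (1 + (norm (u y))\<^sup>2) + t * ?q y"
        using sqrt_one_plus_norm_expansion[of "u y" "t *\<^sub>R v y"] by linarith
      from mult_left_mono[OF this, of K] K(1)
      show "K * ?\<phi> (?u y) \<le> K * ?\<phi> (u y) + t * (w y \<bullet> v y) + K * t * ?q y"
        by (simp add: w_def distrib_left mult_ac)
    qed (intro integrable_mult_right Bochner_Integration.integrable_add int\<phi> u u' intw intq)+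
    also have "\<dots> = K * (\<integral>y. ?\<phi> (u y) \<partial>lborel) + t * (\<integral>y. w y \<bullet> v y \<partial>lborel) + K * t * (\<integral>y. ?q y \<partial>lborel)"
      using int\<phi>[OF u(1)] intw intq
      by (simp only: Bochner_Integration.integral_add integral_mult_right_zero integrable_mult_right
          Bochner_Integration.integrable_add)
    finally have 1: "K * (\<integral>y. ?\<phi> (?u y) \<partial>lborel) \<le>
        K * (\<integral>y. ?\<phi> (u y) \<partial>lborel) + t * (\<integral>y. w y \<bullet> v y \<partial>lborel) + K * t * (\<integral>y. ?q y \<partial>lborel)" .
    have 2: "far_seminorm ?u \<le> far_seminorm u + t * far_seminorm v"
      using t by (intro far_seminorm_add_cmult u v) auto
    have 3: "T ?u = T u + t * T v"
      using test_V[OF u(1)] test_V[OF v] by (simp add: T_add T_scale test_functions_cmult)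
    have "t * (T v - (\<integral>y. w y \<bullet> v y \<partial>lborel)) \<le> t * (far_seminorm v + \<delta> / t + K * (\<integral>y. ?q y \<partial>lborel))"
      using min[OF u'] 1 2 3 t by (simp add: J_def algebra_simps)
    then show "T v - (\<integral>y. w y \<bullet> v y \<partial>lborel) \<le> far_seminorm v + \<delta> / t + K * (\<integral>y. ?q y \<partial>lborel)"
      using t by (simp only: mult_le_cancel_left_pos)
  qed
qed

end

section \<open>Packing argument\<close>

text \<open>Competitors on disjoint balls centred in \<open>C\<close> are added up and tested at once.  The constant
  \<open>M\<close> absorbs the constants of the cut-offs, so that convexity of \<open>G\<close> bounds the
  energies of all pieces by those of the competitors.\<close>

locale packing = controlled G U T C V k \<rho> B
  for G :: "real \<Rightarrow> ennreal" and U :: "'a::euclidean_space set"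
    and T :: "('a \<Rightarrow> 'b::euclidean_space) \<Rightarrow> real" and C V :: "'a set" and k \<rho> B :: real +
  fixes I :: "'i set" and a :: "'i \<Rightarrow> 'a" and r :: "'i \<Rightarrow> real" and v :: "'i \<Rightarrow> 'a \<Rightarrow> 'b"
    and \<Omega> :: "'a set"
  assumes fin: "finite I"
    and center: "i \<in> I \<Longrightarrow> a i \<in> C" and radius: "i \<in> I \<Longrightarrow> 0 < r i"
    and competitor: "i \<in> I \<Longrightarrow> v i \<in> competitors U (a i) (r i)"
    and room: "i \<in> I \<Longrightarrow> ball (a i) (2 * r i) \<subseteq> \<Omega>" and \<Omega>: "\<Omega> \<subseteq> V"
    and disj: "disjoint_family_on (\<lambda>i. ball (a i) (r i)) I"
begin

definition M :: real where "M = 4 + 104 * B"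

definition u :: "'a \<Rightarrow> 'b" where "u x = (1 / M) *\<^sub>R (\<Sum>i\<in>I. v i x)"

definition X :: real where "X = (\<Sum>i\<in>I. r i ^ DIM('a))"

lemma M_ge: "M \<ge> 4" "M \<ge> 104 * B" "M > 0"
  using B by (auto simp: M_def)

lemma v_props:
  assumes "i \<in> I"
  shows "v i \<in> test_functions U" "spt (v i) \<subseteq> ball (a i) (r i)"
    "energy (r i) (v i) \<le> ennreal (r i ^ DIM('a))" "smooth (v i)"
  using competitor[OF assms] by (auto simp: competitors_def test_functions_def)

lemma v_V: "i \<in> I \<Longrightarrow> v i \<in> test_functions V"
  using v_props(1,2)[of i] room[of i] \<Omega> radius[of i] subset_ball[of "r i" "2 * r i" "a i"]
  by (auto simp: test_functions_def)

lemma u_V: "u \<in> test_functions V"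
  unfolding u_def[abs_def] by (intro test_functions_cmult test_functions_sum fin v_V)

lemma sum_on_ball:
  assumes "i \<in> I" "y \<in> ball (a i) (r i)"
  shows "u y = (1 / M) *\<^sub>R v i y"
proof -
  have "v j y = 0" if "j \<in> I" "j \<noteq> i" for j
  proof -
    have "ball (a i) (r i) \<inter> ball (a j) (r j) = {}"
      using disj assms(1) that by (simp add: disjoint_family_on_def)
    then have "y \<notin> ball (a j) (r j)" using assms(2) by blast
    then show ?thesis using v_props(2)[OF that(1)] by (auto intro: zero_outside_spt)
  qed
  then have "(\<Sum>j\<in>I. v j y) = (\<Sum>j\<in>{i}. v j y)"
    using assms(1) fin by (intro sum.mono_neutral_right) auto
  then show ?thesis by (simp add: u_def)
qed

text \<open>The balls are open, so the supports of the other summands keep away from a neighbourhood of \<open>y\<close>.\<close>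

lemma grad_sum_on_ball:
  assumes "i \<in> I" "y \<in> ball (a i) (r i)"
  shows "grad_norm u y = grad_norm (v i) y / M"
proof -
  have "eventually (\<lambda>z. u z = (1 / M) *\<^sub>R v i z) (nhds y)"
    unfolding eventually_nhds using assms sum_on_ball
    by (intro exI[of _ "ball (a i) (r i)"]) auto
  then have "grad_norm u y = grad_norm (\<lambda>z. (1 / M) *\<^sub>R v i z) y"
    by (rule grad_norm_cong_ev) (intro smooth_scaleR smooth_const v_props assms)
  then show ?thesis
    using M_ge(3) by (simp add: grad_norm_cmult v_props(4)[OF assms(1)])
qed

lemma spt_u: "spt u \<subseteq> (\<Union>i\<in>I. ball (a i) (r i))"
proof -
  have "spt u \<subseteq> (\<Union>i\<in>I. spt (v i))"
  proof (rule spt_subset_closed)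
    show "closed (\<Union>i\<in>I. spt (v i))" using fin by (intro closed_UN) auto
    fix x assume "x \<notin> (\<Union>i\<in>I. spt (v i))"
    then have "v i x = 0" if "i \<in> I" for i using that by (auto intro: zero_outside_spt[of x "v i"])
    then show "u x = 0" by (simp add: u_def)
  qed
  also have "\<dots> \<subseteq> (\<Union>i\<in>I. ball (a i) (r i))" using v_props(2) by blast
  finally show ?thesis .
qed

lemma poincare_v: "i \<in> I \<Longrightarrow> (\<integral>\<^sup>+y. G (norm (v i y) / 2) \<partial>lborel) \<le> ennreal (r i ^ DIM('a))"
  using order_trans[OF poincare[OF v_props(4,2) radius] v_props(3)] .

lemma measurable_v: "i \<in> I \<Longrightarrow> v i \<in> borel_measurable borel"
  "i \<in> I \<Longrightarrow> grad_norm (v i) \<in> borel_measurable borel"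
  using v_props(4) by (auto intro: borel_measurable_smooth borel_measurable_grad_norm)

lemma X_nonneg: "0 \<le> X"
  unfolding X_def using radius by (intro sum_nonneg) (auto intro: less_imp_le)

lemma quadratic_linear_part:
  assumes t: "t > 0" and \<kappa>: "\<kappa> > 0"
    and le: "\<And>s. s \<ge> 0 \<Longrightarrow> ennreal (min (t * s\<^sup>2 / 2) (2 * s)) \<le> ennreal \<kappa> * (1 + G s)"
  shows "(\<integral>y. min (t * (norm (u y))\<^sup>2 / 2) (2 * norm (u y)) \<partial>lborel) \<le> \<kappa> * (1 + unit_ball_vol (real DIM('a))) * X"
proof -
  let ?q = "\<lambda>s. min (t * s\<^sup>2 / 2) (2 * s)"
  have int: "integrable lborel (\<lambda>y. ?q (norm (u y)))"
    by (rule integrable_test[OF u_V, where f = "\<lambda>a. ?q (norm a)"]) (auto intro!: continuous_intros)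
  have "ennreal (\<integral>y. ?q (norm (u y)) \<partial>lborel) = (\<integral>\<^sup>+y. ennreal (?q (norm (u y))) \<partial>lborel)"
    using t by (intro nn_integral_eq_integral[symmetric] int) auto
  also have "\<dots> \<le> (\<integral>\<^sup>+y. (\<Sum>i\<in>I. ennreal \<kappa> * (indicator (ball (a i) (r i)) y + G (norm (v i y) / 2))) \<partial>lborel)"
  proof (rule nn_integral_mono)
    fix y
    show "ennreal (?q (norm (u y))) \<le> (\<Sum>i\<in>I. ennreal \<kappa> * (indicator (ball (a i) (r i)) y + G (norm (v i y) / 2)))"
    proof (cases "\<exists>i\<in>I. y \<in> ball (a i) (r i)")
      case True
      then obtain i where i: "i \<in> I" "y \<in> ball (a i) (r i)" by blast
      have "ennreal (?q (norm (u y))) \<le> ennreal \<kappa> * (1 + G (norm (u y)))"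
        by (rule le) simp
      also have "\<dots> \<le> ennreal \<kappa> * (indicator (ball (a i) (r i)) y + G (norm (v i y) / 2))"
      proof (intro mult_left_mono add_mono mono)
        have "norm (v i y) / M \<le> norm (v i y) / 2"
          using M_ge by (intro divide_left_mono) auto
        then show "norm (u y) \<le> norm (v i y) / 2"
          using M_ge sum_on_ball[OF i] by simp
      qed (use i in auto)
      also have "\<dots> \<le> (\<Sum>i\<in>I. ennreal \<kappa> * (indicator (ball (a i) (r i)) y + G (norm (v i y) / 2)))"
        using fin i(1) by (intro member_le_sum) auto
      finally show ?thesis .
    next
      case False
      then have "u y = 0" using spt_u by (auto intro: zero_outside_spt)
      then show ?thesis by simp
    qed
  qed
  also have "\<dots> = (\<Sum>i\<in>I. ennreal \<kappa> * (emeasure lborel (ball (a i) (r i)) + (\<integral>\<^sup>+y. G (norm (v i y) / 2) \<partial>lborel)))"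
  proof -
    have "(\<integral>\<^sup>+y. (\<Sum>i\<in>I. ennreal \<kappa> * (indicator (ball (a i) (r i)) y + G (norm (v i y) / 2))) \<partial>lborel) =
        (\<Sum>i\<in>I. (\<integral>\<^sup>+y. ennreal \<kappa> * (indicator (ball (a i) (r i)) y + G (norm (v i y) / 2)) \<partial>lborel))"
    proof (rule nn_integral_sum)
      fix i assume i: "i \<in> I"
      note [measurable] = measurable_v(1)[OF i]
      have [measurable]: "ball (a i) (r i) \<in> sets borel" by simp
      have "(\<lambda>y. ennreal \<kappa> * (indicator (ball (a i) (r i)) y + G (norm (v i y) / 2))) \<in> borel_measurable borel"
        by measurable
      then show "(\<lambda>y. ennreal \<kappa> * (indicator (ball (a i) (r i)) y + G (norm (v i y) / 2))) \<in> borel_measurable lborel"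
        by simp
    qed
    also have "\<dots> = (\<Sum>i\<in>I. ennreal \<kappa> * (emeasure lborel (ball (a i) (r i)) + (\<integral>\<^sup>+y. G (norm (v i y) / 2) \<partial>lborel)))"
    proof (rule sum.cong[OF refl])
      fix i assume i: "i \<in> I"
      note [measurable] = measurable_v(1)[OF i]
      have [measurable]: "ball (a i) (r i) \<in> sets borel" by simp
      have mi: "(\<lambda>y. G (norm (v i y) / 2)) \<in> borel_measurable borel" by measurable
      have ms: "(\<lambda>y. indicator (ball (a i) (r i)) y + G (norm (v i y) / 2)) \<in> borel_measurable borel"
        by measurable
      show "(\<integral>\<^sup>+y. ennreal \<kappa> * (indicator (ball (a i) (r i)) y + G (norm (v i y) / 2)) \<partial>lborel) =
          ennreal \<kappa> * (emeasure lborel (ball (a i) (r i)) + (\<integral>\<^sup>+y. G (norm (v i y) / 2) \<partial>lborel))"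
        using mi ms by (subst nn_integral_cmult) (simp_all add: nn_integral_add)
    qed
    finally show ?thesis .
  qed
  also have "\<dots> \<le> (\<Sum>i\<in>I. ennreal \<kappa> * (ennreal (unit_ball_vol (real DIM('a)) * r i ^ DIM('a)) + ennreal (r i ^ DIM('a))))"
  proof (intro sum_mono mult_left_mono add_mono)
    fix i assume i: "i \<in> I"
    show "emeasure lborel (ball (a i) (r i)) \<le> ennreal (unit_ball_vol (real DIM('a)) * r i ^ DIM('a))"
      using radius[OF i] by (simp add: emeasure_ball)
  qed (auto intro: poincare_v)
  also have "\<dots> = (\<Sum>i\<in>I. ennreal (\<kappa> * (1 + unit_ball_vol (real DIM('a))) * r i ^ DIM('a)))"
  proof (rule sum.cong[OF refl])
    fix i assume "i \<in> I"
    then have "0 \<le> r i ^ DIM('a)" using radius by (simp add: less_imp_le)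
    then show "ennreal \<kappa> * (ennreal (unit_ball_vol (real DIM('a)) * r i ^ DIM('a)) + ennreal (r i ^ DIM('a))) =
        ennreal (\<kappa> * (1 + unit_ball_vol (real DIM('a))) * r i ^ DIM('a))"
      using \<kappa> by (simp add: algebra_simps flip: ennreal_plus ennreal_mult')
  qed
  also have "\<dots> = ennreal (\<kappa> * (1 + unit_ball_vol (real DIM('a))) * X)"
    unfolding X_def sum_distrib_left using \<kappa> radius
    by (intro sum_ennreal mult_nonneg_nonneg zero_le_power) (auto intro: less_imp_le)
  finally show ?thesis
    using \<kappa> X_nonneg by (subst (asm) ennreal_le_iff) (auto intro!: mult_nonneg_nonneg)
qed

text \<open>Only Whitney balls that come close to one of the balls matter.  They lie in \<open>\<Omega> - C\<close>, so their
  total volume is at most that of \<open>\<Omega> - C\<close>; this is where density of \<open>C\<close> enters.\<close>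

lemma far_part:
  assumes \<Omega>C: "\<Omega> - C \<in> lmeasurable" "measure lebesgue (\<Omega> - C) \<le> \<eta>"
    and \<tau>: "\<tau> > 0" and L: "L > 0"
      "\<And>a r v. \<lbrakk>a \<in> C; 0 < r; r < \<rho>; v \<in> test_functions U; spt v \<subseteq> ball a r\<rbrakk>
        \<Longrightarrow> ennreal \<bar>T v\<bar> \<le> ennreal (L * r ^ DIM('a)) + ennreal \<tau> * energy r v"
  shows "far_seminorm u \<le> L * 26 ^ DIM('a) * (\<eta> / unit_ball_vol (real DIM('a))) + \<tau> * 38 ^ DIM('a) * (2 * X)"
proof (rule far_seminorm_least)
  fix F \<psi> assume far: "far_family F \<psi>"
  let ?h = "\<lambda>x. infdist x C / 20"
  let ?\<omega> = "unit_ball_vol (real DIM('a))"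
  have \<omega>: "?\<omega> > 0" by simp
  interpret slow_balls F ?h using far by (simp add: far_family_def)
  define F' where "F' = {x \<in> F. \<exists>i\<in>I. cball x (5 * ?h x) \<inter> ball (a i) (r i) \<noteq> {}}"
  have F': "F' \<subseteq> F" "finite F'" using finite by (auto simp: F'_def)
  let ?p = "\<lambda>x y. \<psi> x y *\<^sub>R u y"
  let ?g = "\<lambda>y. \<Sum>i\<in>I. G (r i * grad_norm (v i) y) + G (norm (v i y) / 2)"
  have meas_i: "(\<lambda>y. G (r i * grad_norm (v i) y) + G (norm (v i y) / 2)) \<in> borel_measurable borel" if "i \<in> I" for i
  proof -
    note [measurable] = measurable_v[OF that]
    show ?thesis by measurable
  qed
  have meas_g [measurable]: "?g \<in> borel_measurable borel"
    by (intro borel_measurable_sum meas_i)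
  have int_g: "(\<integral>\<^sup>+y. ?g y \<partial>lborel) \<le> ennreal (2 * X)"
  proof -
    have "(\<integral>\<^sup>+y. ?g y \<partial>lborel) = (\<Sum>i\<in>I. energy (r i) (v i) + (\<integral>\<^sup>+y. G (norm (v i y) / 2) \<partial>lborel))"
    proof -
      have "(\<integral>\<^sup>+y. ?g y \<partial>lborel) = (\<Sum>i\<in>I. (\<integral>\<^sup>+y. G (r i * grad_norm (v i) y) + G (norm (v i y) / 2) \<partial>lborel))"
        by (rule nn_integral_sum) (simp add: meas_i)
      also have "\<dots> = (\<Sum>i\<in>I. energy (r i) (v i) + (\<integral>\<^sup>+y. G (norm (v i y) / 2) \<partial>lborel))"
      proof (rule sum.cong[OF refl])
        fix i assume i: "i \<in> I"
        note [measurable] = measurable_v[OF i]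
        show "(\<integral>\<^sup>+y. G (r i * grad_norm (v i) y) + G (norm (v i y) / 2) \<partial>lborel) =
            energy (r i) (v i) + (\<integral>\<^sup>+y. G (norm (v i y) / 2) \<partial>lborel)"
          unfolding energy_def by (rule nn_integral_add) measurable
      qed
      finally show ?thesis .
    qed
    also have "\<dots> \<le> (\<Sum>i\<in>I. ennreal (r i ^ DIM('a)) + ennreal (r i ^ DIM('a)))"
      by (intro sum_mono add_mono v_props poincare_v)
    also have "\<dots> = (\<Sum>i\<in>I. ennreal (2 * r i ^ DIM('a)))"
      using radius by (intro sum.cong) (auto simp: less_imp_le simp flip: ennreal_plus)
    also have "\<dots> = ennreal (2 * X)"
      unfolding X_def sum_distrib_left using radius by (intro sum_ennreal) (auto intro: less_imp_le)
    finally show ?thesis .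
  qed
  have irrelevant: "T (?p x) = 0" if "x \<in> F - F'" for x
  proof -
    have "\<psi> x y *\<^sub>R u y = 0" for y
    proof (cases "y \<in> cball x (5 * ?h x)")
      case True
      then have "y \<notin> (\<Union>i\<in>I. ball (a i) (r i))" using that unfolding F'_def by blast
      then have "u y = 0" using spt_u by (auto intro: zero_outside_spt)
      then show ?thesis by simp
    next
      case False
      then have "\<psi> x y = 0"
        using far_family_radius(3)[OF far, of x] that cutoffD(5)[of B "?h x" x "\<psi> x"]
        by (intro zero_outside_spt) auto
      then show ?thesis by simp
    qed
    then have "?p x = (\<lambda>y. 0)" by (rule ext)
    then show ?thesis using T_zero by simp
  qed
  have relevant: "26 * ?h x \<le> 2 * r i" "ball x (?h x) \<subseteq> \<Omega> - C"
    if x: "x \<in> F" and i: "i \<in> I" and y: "y \<in> cball x (5 * ?h x)" "y \<in> ball (a i) (r i)" for x i y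
  proof -
    have hx: "0 < ?h x" using far_family_radius(1)[OF far x] .
    have dist: "dist x (a i) \<le> 5 * ?h x + r i"
      using y dist_triangle[of x "a i" y] by (auto simp: dist_commute)
    (* 20 * ?h x = infdist x C \<le> 5 * ?h x + r i *)
    moreover have "infdist x C \<le> dist x (a i)" using center[OF i] by (rule infdist_le)
    ultimately have h: "15 * ?h x \<le> r i" by simp
    then show "26 * ?h x \<le> 2 * r i" using hx by simp
    show "ball x (?h x) \<subseteq> \<Omega> - C"
    proof
      fix z assume z: "z \<in> ball x (?h x)"
      have "dist (a i) z < 2 * r i"
        using dist h hx z dist_triangle[of "a i" z x] by (simp add: dist_commute)
      moreover have "z \<notin> C"
        using infdist_le[of z C x] z hx by auto
      ultimately show "z \<in> \<Omega> - C" using room[OF i] by auto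
    qed
  qed
  have piece: "ennreal \<bar>T (?p x)\<bar> \<le> ennreal (L * 26 ^ DIM('a) * ?h x ^ DIM('a)) +
      ennreal \<tau> * (\<integral>\<^sup>+y. indicator (cball x (5 * ?h x)) y * ?g y \<partial>lborel)" if x: "x \<in> F" for x
  proof -
    note h = far_family_radius[OF far x]
    obtain c where c: "c \<in> C" "?p x \<in> test_functions U" "spt (?p x) \<subseteq> ball c (26 * ?h x)"
      "\<And>y. 26 * ?h x * grad_norm (?p x) y \<le>
        indicator (cball x (5 * ?h x)) y * (26 * ?h x * grad_norm u y + 26 * B * norm (u y))"
      by (rule localized_cutoff[OF h(1,2) _ h(3) u_V]) (auto intro: that)
    have "energy (26 * ?h x) (?p x) \<le> (\<integral>\<^sup>+y. indicator (cball x (5 * ?h x)) y * ?g y \<partial>lborel)"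
      unfolding energy_def
    proof (rule nn_integral_mono)
      fix y
      let ?s = "26 * ?h x * grad_norm (?p x) y"
      have s0: "0 \<le> ?s" using h by simp
      show "G ?s \<le> indicator (cball x (5 * ?h x)) y * ?g y"
      proof (cases "y \<in> cball x (5 * ?h x) \<and> (\<exists>i\<in>I. y \<in> ball (a i) (r i))")
        case True
        then obtain i where i: "i \<in> I" "y \<in> ball (a i) (r i)" and y: "y \<in> cball x (5 * ?h x)" by blast
        have "?s \<le> 26 * ?h x * grad_norm u y + 26 * B * norm (u y)"
          using c(4)[of y] y by simp
        also have "\<dots> = (26 * ?h x) * (grad_norm (v i) y / M) + 26 * B * (norm (v i y) / M)"
          using M_ge(3) by (simp add: sum_on_ball[OF i] grad_sum_on_ball[OF i])
        (* The piece is no larger than the ball that it meets, and M absorbs the constants, so that the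
           argument is at most the midpoint of two numbers with controlled modulars. *)
        also have "\<dots> \<le> (2 * r i) * (grad_norm (v i) y / M) + 26 * B * (norm (v i y) / M)"
          using M_ge(3) by (intro add_right_mono mult_right_mono relevant(1)[OF x i(1) y i(2)]) auto
        also have "\<dots> = (r i * grad_norm (v i) y) * (2 / M) + norm (v i y) * (26 * B / M)"
          by (simp add: mult_ac)
        also have "\<dots> \<le> (r i * grad_norm (v i) y) * (1 / 2) + norm (v i y) * (1 / 4)"
          using M_ge radius[OF i(1)] by (intro add_mono mult_left_mono) (auto simp: field_simps)
        also have "\<dots> = (r i * grad_norm (v i) y + norm (v i y) / 2) / 2" by simp
        finally have "G ?s \<le> G ((r i * grad_norm (v i) y + norm (v i y) / 2) / 2)"
          by (rule mono[OF s0])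
        also have "\<dots> \<le> 2 * G ((r i * grad_norm (v i) y + norm (v i y) / 2) / 2)"
          using mult_right_mono[of 1 2 "G ((r i * grad_norm (v i) y + norm (v i y) / 2) / 2)"] by simp
        also have "\<dots> \<le> G (r i * grad_norm (v i) y) + G (norm (v i y) / 2)"
          using radius[OF i(1)] by (intro midpoint) auto
        also have "\<dots> \<le> ?g y"
          using fin i(1) by (intro member_le_sum[where f = "\<lambda>i. G (r i * grad_norm (v i) y) + G (norm (v i y) / 2)"]) auto
        finally show ?thesis using y by simp
      next
        case False
        have "y \<notin> spt (?p x)"
        proof (cases "y \<in> cball x (5 * ?h x)")
          case True
          then have "y \<notin> spt u" using False spt_u by blast
          then show ?thesis using spt_scaleR[of "\<psi> x" u] by blast
        next
          case False
          then show ?thesis using spt_scaleR[of "\<psi> x" u] cutoffD(5)[OF h(3)] by blast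
        qed
        then have "G ?s = 0" by (simp add: grad_norm_outside_spt zero)
        then show ?thesis by simp
      qed
    qed
    then have le: "ennreal (L * (26 * ?h x) ^ DIM('a)) + ennreal \<tau> * energy (26 * ?h x) (?p x) \<le>
        ennreal (L * (26 * ?h x) ^ DIM('a)) + ennreal \<tau> * (\<integral>\<^sup>+y. indicator (cball x (5 * ?h x)) y * ?g y \<partial>lborel)"
      by (intro add_left_mono mult_left_mono) auto
    have eq: "L * 26 ^ DIM('a) * ?h x ^ DIM('a) = L * (26 * ?h x) ^ DIM('a)"
      by (simp only: power_mult_distrib mult.assoc)
    have "0 < 26 * ?h x" using h(1) by simp
    from order_trans[OF L(2)[OF c(1) this h(2) c(2,3)] le] show ?thesis
      unfolding eq .
  qed
  have "\<bar>\<Sum>x\<in>F. T (?p x)\<bar> = \<bar>\<Sum>x\<in>F'. T (?p x)\<bar>"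
    using sum.mono_neutral_right[OF finite F'(1), of "\<lambda>x. T (?p x)"] irrelevant by simp
  also have "ennreal \<dots> \<le> ennreal (\<Sum>x\<in>F'. \<bar>T (?p x)\<bar>)"
    by (intro ennreal_leI sum_abs)
  also have "\<dots> = (\<Sum>x\<in>F'. ennreal \<bar>T (?p x)\<bar>)"
    by (rule sum_ennreal[symmetric]) simp
  also have "\<dots> \<le> (\<Sum>x\<in>F'. ennreal (L * 26 ^ DIM('a) * ?h x ^ DIM('a)) +
      ennreal \<tau> * (\<integral>\<^sup>+y. indicator (cball x (5 * ?h x)) y * ?g y \<partial>lborel))"
    using piece F' by (intro sum_mono) auto
  also have "\<dots> = (\<Sum>x\<in>F'. ennreal (L * 26 ^ DIM('a) * ?h x ^ DIM('a))) +
      ennreal \<tau> * (\<Sum>x\<in>F'. \<integral>\<^sup>+y. indicator (cball x (5 * ?h x)) y * ?g y \<partial>lborel)"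
    by (simp add: sum.distrib sum_distrib_left)
  also have "\<dots> \<le> ennreal (L * 26 ^ DIM('a) * (\<eta> / ?\<omega>)) + ennreal \<tau> * (38 ^ DIM('a) * ennreal (2 * X))"
  proof (intro add_mono mult_left_mono)
    have "(\<Sum>x\<in>F'. ?h x ^ DIM('a)) * ?\<omega> \<le> measure lebesgue (\<Omega> - C)"
    proof (rule sum_ball_volumes_le[OF F'(2) _ \<Omega>C(1)])
      show "disjoint_family_on (\<lambda>x. ball x (?h x)) F'"
        by (rule disjoint_family_on_mono[OF F'(1) disjoint])
      show "ball x (?h x) \<subseteq> \<Omega> - C" if "x \<in> F'" for x
        using that relevant(2) unfolding F'_def by blast
    qed (simp add: infdist_nonneg)
    then have "(\<Sum>x\<in>F'. ?h x ^ DIM('a)) \<le> \<eta> / ?\<omega>"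
      using \<Omega>C(2) \<omega> by (simp only: pos_le_divide_eq)
    then have "L * 26 ^ DIM('a) * (\<Sum>x\<in>F'. ?h x ^ DIM('a)) \<le> L * 26 ^ DIM('a) * (\<eta> / ?\<omega>)"
      using L(1) by (intro mult_left_mono) auto
    moreover have "(\<Sum>x\<in>F'. ennreal (L * 26 ^ DIM('a) * ?h x ^ DIM('a))) = ennreal (L * 26 ^ DIM('a) * (\<Sum>x\<in>F'. ?h x ^ DIM('a)))"
      unfolding sum_distrib_left using L(1) by (intro sum_ennreal) (simp add: infdist_nonneg)
    ultimately show "(\<Sum>x\<in>F'. ennreal (L * 26 ^ DIM('a) * ?h x ^ DIM('a))) \<le> ennreal (L * 26 ^ DIM('a) * (\<eta> / ?\<omega>))"
      by (simp only: ennreal_leI)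
    have "(\<Sum>x\<in>F'. \<integral>\<^sup>+y. indicator (cball x (5 * ?h x)) y * ?g y \<partial>lborel) =
        (\<integral>\<^sup>+y. (\<Sum>x\<in>F'. indicator (cball x (5 * ?h x)) y * ?g y) \<partial>lborel)"
    proof (rule nn_integral_sum[symmetric])
      fix x
      have [measurable]: "cball x (5 * ?h x) \<in> sets borel" by simp
      have "(\<lambda>y. indicator (cball x (5 * ?h x)) y * ?g y) \<in> borel_measurable borel" by measurable
      then show "(\<lambda>y. indicator (cball x (5 * ?h x)) y * ?g y) \<in> borel_measurable lborel" by simp
    qed
    also have "\<dots> \<le> (\<integral>\<^sup>+y. 38 ^ DIM('a) * ?g y \<partial>lborel)"
    proof (rule nn_integral_mono)
      fix y
      have "(\<Sum>x\<in>F'. indicator (cball x (5 * ?h x)) y :: ennreal) = of_nat (card {x \<in> F'. y \<in> cball x (5 * ?h x)})"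
        using F'(2) by (simp add: indicator_def sum.If_cases Int_def)
      also have "card {x \<in> F'. y \<in> cball x (5 * ?h x)} \<le> card {x \<in> F. dist x y \<le> 6 * ?h x}"
        using finite F'(1) pos by (intro card_mono) force+
      also have "\<dots> \<le> 38 ^ DIM('a)" by (rule overlap)
      finally have "(\<Sum>x\<in>F'. indicator (cball x (5 * ?h x)) y :: ennreal) \<le> of_nat (38 ^ DIM('a))"
        by (simp add: of_nat_mono)
      then have "(\<Sum>x\<in>F'. indicator (cball x (5 * ?h x)) y) * ?g y \<le> 38 ^ DIM('a) * ?g y"
        by (intro mult_right_mono) auto
      then show "(\<Sum>x\<in>F'. indicator (cball x (5 * ?h x)) y * ?g y) \<le> 38 ^ DIM('a) * ?g y"
        by (simp add: sum_distrib_right)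
    qed
    also have "\<dots> = 38 ^ DIM('a) * (\<integral>\<^sup>+y. ?g y \<partial>lborel)"
      by (rule nn_integral_cmult) measurable
    also have "\<dots> \<le> 38 ^ DIM('a) * ennreal (2 * X)"
      by (intro mult_left_mono int_g) auto
    finally show "(\<Sum>x\<in>F'. \<integral>\<^sup>+y. indicator (cball x (5 * ?h x)) y * ?g y \<partial>lborel) \<le> 38 ^ DIM('a) * ennreal (2 * X)" .
  qed auto
  also have "\<dots> = ennreal (L * 26 ^ DIM('a) * (\<eta> / ?\<omega>) + \<tau> * 38 ^ DIM('a) * (2 * X))"
  proof -
    have "0 \<le> \<eta>" using \<Omega>C(2) measure_nonneg order_trans by blast
    then have 1: "0 \<le> L * 26 ^ DIM('a) * (\<eta> / ?\<omega>)" using L(1) by simp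
    have 2: "0 \<le> \<tau> * 38 ^ DIM('a) * (2 * X)" using \<tau> X_nonneg by simp
    have "ennreal \<tau> * (38 ^ DIM('a) * ennreal (2 * X)) = ennreal \<tau> * (ennreal (38 ^ DIM('a)) * ennreal (2 * X))"
      by (simp flip: ennreal_numeral ennreal_power)
    also have "\<dots> = ennreal (\<tau> * 38 ^ DIM('a) * (2 * X))"
      using \<tau> X_nonneg by (simp add: mult.assoc flip: ennreal_mult')
    finally show ?thesis using ennreal_plus[OF 1 2] by simp
  qed
  finally have "ennreal \<bar>\<Sum>x\<in>F. T (?p x)\<bar> \<le> ennreal (L * 26 ^ DIM('a) * (\<eta> / ?\<omega>) + \<tau> * 38 ^ DIM('a) * (2 * X))" .
  moreover have "0 \<le> L * 26 ^ DIM('a) * (\<eta> / ?\<omega>) + \<tau> * 38 ^ DIM('a) * (2 * X)"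
    using order_trans[OF measure_nonneg \<Omega>C(2)] L(1) \<tau> X_nonneg
    by (intro add_nonneg_nonneg mult_nonneg_nonneg divide_nonneg_nonneg) auto
  ultimately show "\<bar>\<Sum>x\<in>F. T (?p x)\<bar> \<le> L * 26 ^ DIM('a) * (\<eta> / ?\<omega>) + \<tau> * 38 ^ DIM('a) * (2 * X)"
    by (simp only: ennreal_le_iff)
qed

end

context young
begin

text \<open>The Poincare inequality bounds the integral of \<open>G (\<bar>v\<bar> / 2)\<close>, and \<open>G\<close> dominates linear functions.\<close>

lemma competitors_L1:
  obtains D where "D > 0"
    "\<And>U a r (v :: 'a::euclidean_space \<Rightarrow> 'b::euclidean_space). \<lbrakk>0 < r; v \<in> competitors U a r\<rbrakk>
      \<Longrightarrow> (\<integral>y. norm (v y) \<partial>lborel) \<le> D * r ^ DIM('a)"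
proof -
  let ?\<omega> = "unit_ball_vol (real DIM('a))"
  obtain S where S: "S > 0" "\<And>s. s \<ge> S \<Longrightarrow> ennreal s \<le> ennreal 1 * G s"
    using dominates_linear[of 1] by auto
  show thesis
  proof (rule that[of "2 * (S * ?\<omega> + 1)"])
    show "0 < 2 * (S * ?\<omega> + 1)" using S by (simp add: add_pos_pos)
    fix U a r and v :: "'a \<Rightarrow> 'b" assume r: "0 < r" and "v \<in> competitors U a r"
    then have v: "v \<in> test_functions U" "spt v \<subseteq> ball a r" "energy r v \<le> ennreal (r ^ DIM('a))" "smooth v"
      by (auto simp: competitors_def test_functions_def)
    note [measurable] = borel_measurable_smooth[OF v(4)]
    have [measurable]: "ball a r \<in> sets borel" by simp
    have mG: "(\<lambda>y. G (norm (v y) / 2)) \<in> borel_measurable borel" by measurable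
    have "ennreal (\<integral>y. norm (v y) / 2 \<partial>lborel) = (\<integral>\<^sup>+y. ennreal (norm (v y) / 2) \<partial>lborel)"
      using integrable_norm_test[OF v(1)] by (intro nn_integral_eq_integral[symmetric]) auto
    also have "\<dots> \<le> (\<integral>\<^sup>+y. ennreal S * indicator (ball a r) y + G (norm (v y) / 2) \<partial>lborel)"
    proof (rule nn_integral_mono)
      fix y
      consider "y \<notin> ball a r" | "y \<in> ball a r" "norm (v y) / 2 < S" | "norm (v y) / 2 \<ge> S" by linarith
      then show "ennreal (norm (v y) / 2) \<le> ennreal S * indicator (ball a r) y + G (norm (v y) / 2)"
      proof cases
        case 1
        then have "y \<notin> spt v" using v(2) by blast
        then have "v y = 0" by (rule zero_outside_spt)
        then show ?thesis by simp
      next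
        case 2
        then have "ennreal (norm (v y) / 2) \<le> ennreal S * indicator (ball a r) y" by (simp add: ennreal_leI)
        then show ?thesis by (rule order_trans) simp
      next
        case 3
        from S(2)[OF this] have "ennreal (norm (v y) / 2) \<le> G (norm (v y) / 2)" by simp
        then show ?thesis by (rule order_trans) simp
      qed
    qed
    also have "\<dots> = ennreal S * emeasure lborel (ball a r) + (\<integral>\<^sup>+y. G (norm (v y) / 2) \<partial>lborel)"
      using mG by (subst nn_integral_add) (simp_all add: nn_integral_cmult)
    also have "\<dots> \<le> ennreal S * ennreal (?\<omega> * r ^ DIM('a)) + ennreal (r ^ DIM('a))"
      using order_trans[OF poincare[OF v(4,2) r] v(3)] r
      by (intro add_mono mult_left_mono) (auto simp: emeasure_ball)
    also have "\<dots> = ennreal ((S * ?\<omega> + 1) * r ^ DIM('a))"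
      using S(1) r by (simp add: algebra_simps flip: ennreal_mult' ennreal_plus)
    finally have "(\<integral>y. norm (v y) / 2 \<partial>lborel) \<le> (S * ?\<omega> + 1) * r ^ DIM('a)"
      using S(1) r by (subst (asm) ennreal_le_iff) (auto intro!: mult_nonneg_nonneg add_nonneg_nonneg)
    then show "(\<integral>y. norm (v y) \<partial>lborel) \<le> 2 * (S * ?\<omega> + 1) * r ^ DIM('a)"
      by (simp add: algebra_simps)
  qed
qed

end

section \<open>Points that are not approximated by a constant\<close>

context packing
begin

lemma total_defect:
  assumes w: "continuous_on UNIV w"
    and bad: "\<And>i. i \<in> I \<Longrightarrow> c * r i ^ DIM('a) \<le> T (v i) - (\<integral>y. w y \<bullet> v i y \<partial>lborel)"
  shows "c / M * X \<le> T u - (\<integral>y. w y \<bullet> u y \<partial>lborel)"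
proof -
  have "T u = (1 / M) * T (\<lambda>x. \<Sum>i\<in>I. v i x)"
    unfolding u_def[abs_def] by (intro T_scale test_functions_sum fin v_props)
  also have "T (\<lambda>x. \<Sum>i\<in>I. v i x) = (\<Sum>i\<in>I. T (v i))"
    by (intro T_sum fin v_props)
  finally have Tu: "T u = (\<Sum>i\<in>I. T (v i)) / M" by simp
  have "(\<integral>y. w y \<bullet> u y \<partial>lborel) = (\<integral>y. (\<Sum>i\<in>I. w y \<bullet> v i y) / M \<partial>lborel)"
    by (simp add: u_def inner_sum_right)
  also have "\<dots> = (\<Sum>i\<in>I. \<integral>y. w y \<bullet> v i y \<partial>lborel) / M"
    using integrable_inner_test[OF v_props(1) w] by (simp add: Bochner_Integration.integral_sum)
  finally have "T u - (\<integral>y. w y \<bullet> u y \<partial>lborel) = (\<Sum>i\<in>I. T (v i) - (\<integral>y. w y \<bullet> v i y \<partial>lborel)) / M"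
    unfolding Tu by (simp add: sum_subtractf diff_divide_distrib)
  moreover have "c * X \<le> (\<Sum>i\<in>I. T (v i) - (\<integral>y. w y \<bullet> v i y \<partial>lborel))"
    unfolding X_def sum_distrib_left by (intro sum_mono bad)
  ultimately show ?thesis
    using M_ge(3) by (simp add: divide_right_mono)
qed

end

context controlled
begin

text \<open>The points of \<open>C\<close> at which no constant approximates \<open>T\<close> up to \<open>\<epsilon>\<close>.  At such a point the value
  of any continuous density \<open>w\<close> fails, which gives bad competitors on arbitrarily small balls; a
  Vitali family of such balls has small total volume by the packing estimates.\<close>

lemma negligible_bad_points:
  assumes \<epsilon>: "\<epsilon> > 0"
  shows "negligible {a \<in> C \<inter> V. \<not> (\<exists>c r0. 0 < r0 \<and> (\<forall>r v. 0 < r \<and> r < r0 \<and> v \<in> competitors U a r \<longrightarrow>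
      \<bar>T v - (\<integral>y. c \<bullet> v y \<partial>lborel)\<bar> \<le> \<epsilon> * r ^ DIM('a)))}" (is "negligible ?S")
  unfolding negligible_outer_le
proof (intro allI impI)
  fix \<gamma> :: real assume \<gamma>: "\<gamma> > 0"
  let ?\<omega> = "unit_ball_vol (real DIM('a))"
  have \<omega>: "?\<omega> > 0" by simp
  then have [simp]: "?\<omega> \<noteq> 0" by (rule less_imp_neq[symmetric])
  define M where "M = 4 + 104 * B"
  have M: "M > 0" using B by (simp add: M_def)
  obtain D where D: "D > 0" "\<And>U a r (v :: 'a \<Rightarrow> 'b). \<lbrakk>0 < r; v \<in> competitors U a r\<rbrakk>
      \<Longrightarrow> (\<integral>y. norm (v y) \<partial>lborel) \<le> D * r ^ DIM('a)"
    using competitors_L1[where ?'a = 'a and ?'b = 'b] by blast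
  obtain K where K: "K > 0"
    "\<And>v. v \<in> test_functions V \<Longrightarrow> T v \<le> K * (\<integral>y. norm (v y) \<partial>lborel) + far_seminorm v"
    using T_le_L1_far by blast
  (* The choices of \<tau> and \<kappa> make the two terms proportional to the total volume X in the packing
     estimate equal to \<epsilon> / (8 * M) * X each, which leaves half of the defect \<epsilon> / (2 * M) * X. *)
  define \<tau> where "\<tau> = \<epsilon> / (16 * M * 38 ^ DIM('a))"
  have \<tau>: "\<tau> > 0" using \<epsilon> M by (simp add: \<tau>_def)
  define \<kappa> where "\<kappa> = \<epsilon> / (8 * M * K * (1 + ?\<omega>))"
  have \<kappa>: "\<kappa> > 0" using \<epsilon> M K(1) \<omega> by (simp add: \<kappa>_def add_pos_pos)
  obtain L where L: "L > 0"
      "\<And>a r v. \<lbrakk>a \<in> C; 0 < r; r < \<rho>; v \<in> test_functions U; spt v \<subseteq> ball a r\<rbrakk>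
        \<Longrightarrow> ennreal \<bar>T v\<bar> \<le> ennreal (L * r ^ DIM('a)) + ennreal \<tau> * energy r v"
    using T_le_small_energy[OF \<tau>] by blast
  obtain t where t: "t > 0" "\<And>s. s \<ge> 0 \<Longrightarrow> ennreal (min (t * s\<^sup>2 / 2) (2 * s)) \<le> ennreal \<kappa> * (1 + G s)"
    using min_quadratic_linear_le[OF \<kappa>] by blast
  (* What remains is \<epsilon> / (4 * M) * X \<le> \<xi>; the factor 5 is the dilation in the Vitali covering. *)
  define \<gamma>' where "\<gamma>' = \<gamma> / (5 ^ DIM('a) * ?\<omega>)"
  define \<xi> where "\<xi> = \<epsilon> * \<gamma>' / (4 * M)"
  have \<xi>: "\<xi> > 0" using \<epsilon> \<gamma> M \<omega> by (simp add: \<xi>_def \<gamma>'_def)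
  define \<eta> where "\<eta> = \<xi> * ?\<omega> / (2 * L * 26 ^ DIM('a))"
  have \<eta>: "\<eta> > 0" using \<xi> L(1) \<omega> by (simp add: \<eta>_def)
  have L\<eta>: "L * 26 ^ DIM('a) * (\<eta> / ?\<omega>) = \<xi> / 2" using L(1) \<omega> by (simp add: \<eta>_def)
  have CV: "C \<inter> V \<in> sets lebesgue" using C V by simp
  obtain O' where O': "open O'" "C \<inter> V \<subseteq> O'" "O' - (C \<inter> V) \<in> lmeasurable"
      "emeasure lebesgue (O' - (C \<inter> V)) < ennreal \<eta>"
    using sets_lebesgue_outer_open[OF CV \<eta>] by blast
  define \<Omega> where "\<Omega> = O' \<inter> V"
  have \<Omega>: "open \<Omega>" "\<Omega> \<subseteq> V" "C \<inter> V \<subseteq> \<Omega>" using O' V by (auto simp: \<Omega>_def)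
  have \<Omega>C: "\<Omega> - C \<in> lmeasurable" "measure lebesgue (\<Omega> - C) \<le> \<eta>"
  proof -
    have meas: "\<Omega> - C \<in> sets lebesgue" using \<Omega>(1) C by simp
    have sub: "\<Omega> - C \<subseteq> O' - (C \<inter> V)" by (auto simp: \<Omega>_def)
    show "\<Omega> - C \<in> lmeasurable" by (rule fmeasurableI2[OF O'(3) sub meas])
    have "measure lebesgue (\<Omega> - C) \<le> measure lebesgue (O' - (C \<inter> V))"
      by (rule measure_mono_fmeasurable[OF sub meas O'(3)])
    also have "\<dots> \<le> \<eta>"
      using O'(3,4) \<eta> by (simp add: emeasure_eq_measure2 ennreal_less_iff less_imp_le)
    finally show "measure lebesgue (\<Omega> - C) \<le> \<eta>" .
  qed
  obtain w :: "'a \<Rightarrow> 'b" where w: "continuous_on UNIV w"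
    "\<And>v s. \<lbrakk>v \<in> test_functions V; s > 0\<rbrakk> \<Longrightarrow>
      T v - (\<integral>y. w y \<bullet> v y \<partial>lborel) \<le> far_seminorm v + (t * \<xi> / 2) / s +
        K * (\<integral>y. min (s * (norm (v y))\<^sup>2 / 2) (2 * norm (v y)) \<partial>lborel)"
    using approximate_density[OF K, of "t * \<xi> / 2"] t \<xi> by auto
  define \<F> where "\<F> = {(a, r, v). a \<in> C \<and> 0 < r \<and> r \<le> 1 \<and> v \<in> competitors U a r \<and> ball a (2 * r) \<subseteq> \<Omega> \<and>
      \<epsilon> / 2 * r ^ DIM('a) \<le> T v - (\<integral>y. w y \<bullet> v y \<partial>lborel)}"
  let ?a = "\<lambda>i :: 'a \<times> real \<times> ('a \<Rightarrow> 'b). fst i" and ?r = "\<lambda>i :: 'a \<times> real \<times> ('a \<Rightarrow> 'b). fst (snd i)"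
  have cover: "?S \<subseteq> (\<Union>i\<in>\<F>. cball (?a i) (?r i))"
  proof
    fix a assume "a \<in> ?S"
    then have a: "a \<in> C" "a \<in> \<Omega>" and none: "\<And>c r0. 0 < r0 \<Longrightarrow> \<exists>r v. 0 < r \<and> r < r0 \<and> v \<in> competitors U a r \<and>
        \<epsilon> * r ^ DIM('a) < \<bar>T v - (\<integral>y. c \<bullet> v y \<partial>lborel)\<bar>"
      using \<Omega>(3) by (auto simp: not_le)
    have "isCont w a" using w(1) by (simp add: continuous_on_eq_continuous_at)
    moreover have "0 < \<epsilon> / (2 * D)" using \<epsilon> D(1) by simp
    ultimately obtain r1 where r1: "r1 > 0" "\<And>y. dist y a < r1 \<Longrightarrow> dist (w y) (w a) < \<epsilon> / (2 * D)"
      unfolding continuous_at_eps_delta by blast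
    obtain r2 where r2: "r2 > 0" "ball a r2 \<subseteq> \<Omega>" using \<Omega>(1) a(2) openE by blast
    have "0 < min 1 (min r1 (r2 / 2))" using r1 r2 by simp
    from none[OF this, of "w a"] obtain r v where r: "0 < r" "r < min 1 (min r1 (r2 / 2))"
      and v: "v \<in> competitors U a r" "\<epsilon> * r ^ DIM('a) < \<bar>T v - (\<integral>y. w a \<bullet> v y \<partial>lborel)\<bar>" by blast
    have vt: "v \<in> test_functions U" "spt v \<subseteq> ball a r" using v(1) by (auto simp: competitors_def)
    have iw: "integrable lborel (\<lambda>y. w y \<bullet> v y)" "integrable lborel (\<lambda>y. w a \<bullet> v y)"
      using integrable_inner_test[OF vt(1)] w(1) by auto
    have "\<bar>(\<integral>y. w y \<bullet> v y \<partial>lborel) - (\<integral>y. w a \<bullet> v y \<partial>lborel)\<bar> = \<bar>\<integral>y. (w y - w a) \<bullet> v y \<partial>lborel\<bar>"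
      using iw by (simp add: inner_diff_left)
    also have "\<dots> \<le> (\<integral>y. \<epsilon> / (2 * D) * norm (v y) \<partial>lborel)"
    proof (rule integral_abs_bound_integral)
      show "integrable lborel (\<lambda>y. (w y - w a) \<bullet> v y)" using iw by (simp add: inner_diff_left)
      show "integrable lborel (\<lambda>y. \<epsilon> / (2 * D) * norm (v y))"
        using integrable_norm_test[OF vt(1)] by simp
      fix y
      show "\<bar>(w y - w a) \<bullet> v y\<bar> \<le> \<epsilon> / (2 * D) * norm (v y)"
      proof (cases "y \<in> ball a r")
        case True
        then have "norm (w y - w a) \<le> \<epsilon> / (2 * D)"
          using r1(2)[of y] r by (simp add: dist_commute dist_norm norm_minus_commute)
        then show ?thesis
          using Cauchy_Schwarz_ineq2[of "w y - w a" "v y"]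
            mult_right_mono[of "norm (w y - w a)" "\<epsilon> / (2 * D)" "norm (v y)"] by simp
      next
        case False
        then have "y \<notin> spt v" using vt(2) by blast
        then have "v y = 0" by (rule zero_outside_spt)
        then show ?thesis by simp
      qed
    qed
    also have "\<dots> = \<epsilon> / (2 * D) * (\<integral>y. norm (v y) \<partial>lborel)" by simp
    also have "\<dots> \<le> \<epsilon> / (2 * D) * (D * r ^ DIM('a))"
      using \<epsilon> D r v by (intro mult_left_mono) auto
    also have "\<dots> = \<epsilon> / 2 * r ^ DIM('a)" using D(1) by simp
    finally have "\<epsilon> / 2 * r ^ DIM('a) \<le> \<bar>T v - (\<integral>y. w y \<bullet> v y \<partial>lborel)\<bar>"
      using v(2) by linarith
    then obtain v' where "v' \<in> competitors U a r" "\<epsilon> / 2 * r ^ DIM('a) \<le> T v' - (\<integral>y. w y \<bullet> v' y \<partial>lborel)"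
      using v(1) competitors_uminus[OF v(1)] T_uminus[OF vt(1)]
      by (cases "0 \<le> T v - (\<integral>y. w y \<bullet> v y \<partial>lborel)") (auto simp: abs_if split: if_splits)
    then have "(a, r, v') \<in> \<F>"
      using a(1) r r2(2) subset_ball[of "2 * r" r2 a] by (auto simp: \<F>_def)
    moreover have "a \<in> cball (?a (a, r, v')) (?r (a, r, v'))" using r by simp
    ultimately show "a \<in> (\<Union>i\<in>\<F>. cball (?a i) (?r i))" by blast
  qed
  have radii: "0 < ?r i \<and> ?r i \<le> 1" if "i \<in> \<F>" for i
    using that by (auto simp: \<F>_def)
  obtain \<C> where \<C>: "countable \<C>" "\<C> \<subseteq> \<F>"
    "pairwise (\<lambda>i j. disjnt (cball (?a i) (?r i)) (cball (?a j) (?r j))) \<C>"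
    "?S \<subseteq> (\<Union>i\<in>\<C>. cball (?a i) (5 * ?r i))"
    by (rule Vitali_covering_lemma_cballs[OF cover radii], assumption, rule that)
  have bound: "(\<Sum>i\<in>I. ?r i ^ DIM('a)) \<le> \<gamma>'" if I: "finite I" "I \<subseteq> \<C>" for I
  proof -
    have mem: "?a i \<in> C" "0 < ?r i" "snd (snd i) \<in> competitors U (?a i) (?r i)" "ball (?a i) (2 * ?r i) \<subseteq> \<Omega>"
      "\<epsilon> / 2 * ?r i ^ DIM('a) \<le> T (snd (snd i)) - (\<integral>y. w y \<bullet> snd (snd i) y \<partial>lborel)" if "i \<in> I" for i
    proof -
      have "i \<in> \<F>" using that I(2) \<C>(2) by blast
      then show "?a i \<in> C" "0 < ?r i" "snd (snd i) \<in> competitors U (?a i) (?r i)" "ball (?a i) (2 * ?r i) \<subseteq> \<Omega>"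
        "\<epsilon> / 2 * ?r i ^ DIM('a) \<le> T (snd (snd i)) - (\<integral>y. w y \<bullet> snd (snd i) y \<partial>lborel)"
        unfolding \<F>_def by (simp_all add: case_prod_unfold)
    qed
    interpret P: packing G U T C V k \<rho> B I ?a ?r "\<lambda>i. snd (snd i)" \<Omega>
    proof
      show "disjoint_family_on (\<lambda>i. ball (?a i) (?r i)) I"
        unfolding disjoint_family_on_def
      proof (intro ballI impI)
        fix i j assume "i \<in> I" "j \<in> I" "i \<noteq> j"
        then have "disjnt (cball (?a i) (?r i)) (cball (?a j) (?r j))"
          using \<C>(3) I(2) by (auto simp: pairwise_def)
        then show "ball (?a i) (?r i) \<inter> ball (?a j) (?r j) = {}"
          using ball_subset_cball unfolding disjnt_def by blast
      qed
    qed (fact I(1) \<Omega>(2) mem)+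
    have PM: "P.M = M" by (simp add: P.M_def M_def)
    have "\<epsilon> / 2 / M * P.X \<le> T P.u - (\<integral>y. w y \<bullet> P.u y \<partial>lborel)"
      unfolding PM[symmetric] by (rule P.total_defect[OF w(1) mem(5)])
    also have "\<dots> \<le> far_seminorm P.u + (t * \<xi> / 2) / t +
        K * (\<integral>y. min (t * (norm (P.u y))\<^sup>2 / 2) (2 * norm (P.u y)) \<partial>lborel)"
      by (rule w(2)[OF P.u_V t(1)])
    also have "\<dots> \<le> (\<xi> / 2 + \<tau> * 38 ^ DIM('a) * (2 * P.X)) + (t * \<xi> / 2) / t + K * (\<kappa> * (1 + ?\<omega>) * P.X)"
      using P.far_part[OF \<Omega>C \<tau> L] P.quadratic_linear_part[OF t(1) \<kappa> t(2)] K(1) unfolding L\<eta>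
      by (intro add_mono mult_left_mono) auto
    also have "\<dots> = \<xi> + \<epsilon> / (4 * M) * P.X"
    proof -
      have "\<tau> * 38 ^ DIM('a) * (2 * P.X) = \<epsilon> / (8 * M) * P.X"
        using M by (simp add: \<tau>_def)
      moreover have "K * (\<kappa> * (1 + ?\<omega>) * P.X) = \<epsilon> / (8 * M) * P.X"
      proof -
        have "1 + ?\<omega> \<noteq> 0" using \<omega> by linarith
        then show ?thesis using M K(1) by (simp add: \<kappa>_def)
      qed
      moreover have "(t * \<xi> / 2) / t = \<xi> / 2" using t(1) by simp
      ultimately show ?thesis by (simp add: field_simps)
    qed
    finally have "\<epsilon> / (4 * M) * P.X \<le> \<epsilon> / (4 * M) * \<gamma>'"
      using M by (simp add: \<xi>_def field_simps)
    then have "P.X \<le> \<gamma>'"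
      by (rule mult_left_le_imp_le) (use \<epsilon> M in simp)
    then show ?thesis by (simp add: P.X_def)
  qed
  have ballm: "cball (?a i) (5 * ?r i) \<in> lmeasurable" for i by simp
  have small: "measure lebesgue (\<Union>i\<in>I. cball (?a i) (5 * ?r i)) \<le> \<gamma>" if I: "I \<subseteq> \<C>" "finite I" for I
  proof -
    have "measure lebesgue (\<Union>i\<in>I. cball (?a i) (5 * ?r i)) \<le> (\<Sum>i\<in>I. measure lebesgue (cball (?a i) (5 * ?r i)))"
      by (rule measure_UNION_le[OF I(2)]) simp
    also have "\<dots> = (\<Sum>i\<in>I. 5 ^ DIM('a) * ?\<omega> * ?r i ^ DIM('a))"
    proof (rule sum.cong[OF refl])
      fix i assume "i \<in> I"
      then have "0 < ?r i" using I \<C>(2) by (auto simp: \<F>_def)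
      then show "measure lebesgue (cball (?a i) (5 * ?r i)) = 5 ^ DIM('a) * ?\<omega> * ?r i ^ DIM('a)"
        by (simp add: content_cball power_mult_distrib)
    qed
    also have "\<dots> = 5 ^ DIM('a) * ?\<omega> * (\<Sum>i\<in>I. ?r i ^ DIM('a))" by (simp add: sum_distrib_left)
    also have "\<dots> \<le> 5 ^ DIM('a) * ?\<omega> * \<gamma>'"
      using \<omega> bound[OF I(2,1)] by (intro mult_left_mono) auto
    also have "\<dots> = \<gamma>" using \<omega> by (simp add: \<gamma>'_def)
    finally show ?thesis .
  qed
  show "\<exists>N. ?S \<subseteq> N \<and> N \<in> lmeasurable \<and> measure lebesgue N \<le> \<gamma>"
    using fmeasurable_UN_bound[OF \<C>(1) ballm small] measure_UN_bound[OF \<C>(1) ballm small] \<C>(4) by blast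
qed

end

section \<open>Approximation by constants almost everywhere\<close>

context young
begin

definition approximable ::
  "'a::euclidean_space set \<Rightarrow> (('a \<Rightarrow> 'b::euclidean_space) \<Rightarrow> real) \<Rightarrow> real \<Rightarrow> 'a \<Rightarrow> 'b \<Rightarrow> bool" where
  "approximable U T \<epsilon> a c \<longleftrightarrow> (\<exists>r0. 0 < r0 \<and> (\<forall>r v. 0 < r \<and> r < r0 \<and> v \<in> competitors U a r \<longrightarrow>
     \<bar>T v - (\<integral>y. c \<bullet> v y \<partial>lborel)\<bar> \<le> \<epsilon> * r ^ DIM('a)))"

text \<open>A rescaled bump times the direction of \<open>c\<close>, made small enough to be a competitor.  By scaling,
  its integral is of the order \<open>r ^ m\<close>.\<close>

lemma bump_competitor:
  obtains \<kappa> where "\<kappa> > 0"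
    "\<And>U (a :: 'a::euclidean_space) r (c :: 'b::euclidean_space). \<lbrakk>0 < r; ball a r \<subseteq> U\<rbrakk> \<Longrightarrow>
      \<exists>v\<in>competitors U a r. \<kappa> * norm c * r ^ DIM('a) \<le> (\<integral>y. c \<bullet> v y \<partial>lborel)"
proof -
  let ?\<omega> = "unit_ball_vol (real DIM('a))"
  have \<omega>: "?\<omega> > 0" by simp
  obtain \<beta> :: "'a \<Rightarrow> real" where \<beta>: "smooth \<beta>" "\<And>x. 0 \<le> \<beta> x" "\<And>x. \<beta> x \<le> 1"
    "\<And>x. norm x \<le> 3 \<Longrightarrow> \<beta> x = 1" "\<And>x. norm x \<ge> 5 \<Longrightarrow> \<beta> x = 0"
    using smooth_bump_ex by blast
  have "spt \<beta> \<subseteq> cball 0 5"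
    by (rule spt_subset_closed) (auto intro: \<beta>(5))
  then have "compact (spt \<beta>)"
    using compact_Int_closed[OF compact_cball closed_spt, of 0 5 \<beta>] by (simp add: inf.absorb2)
  then obtain B0 where B0: "B0 > 0" "\<And>x. grad_norm \<beta> x \<le> B0"
    using grad_norm_bounded[OF \<beta>(1)] by blast
  define \<mu> where "\<mu> = max 1 ?\<omega>"
  have \<mu>: "\<mu> \<ge> 1" "\<mu> \<ge> ?\<omega>" by (auto simp: \<mu>_def)
  define s where "s = 1 / (6 * B0 * \<mu>)"
  have s: "s > 0" using B0 \<mu> by (simp add: s_def)
  show thesis
  proof (rule that[of "s * ?\<omega> / 2 ^ DIM('a)"])
    show "s * ?\<omega> / 2 ^ DIM('a) > 0" using s \<omega> by simp
    fix U and a :: 'a and r and c :: 'b assume r: "0 < r" and U: "ball a r \<subseteq> U"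
    define e where "e = sgn c"
    have e: "norm e \<le> 1" by (simp add: e_def norm_sgn)
    have ce: "c \<bullet> e = norm c"
      by (cases "c = 0")
        (simp_all add: e_def sgn_div_norm power2_norm_eq_inner[symmetric] power2_eq_square[of "norm c"])
    define \<phi> where "\<phi> y = \<beta> ((6 / r) *\<^sub>R y + (- (6 / r)) *\<^sub>R a)" for y
    define v where "v y = \<phi> y *\<^sub>R (s *\<^sub>R e)" for y
    have arg: "norm ((6 / r) *\<^sub>R y + (- (6 / r)) *\<^sub>R a) = 6 / r * dist a y" for y
    proof -
      have "(6 / r) *\<^sub>R y + (- (6 / r)) *\<^sub>R a = (6 / r) *\<^sub>R (y - a)" by (simp add: scaleR_diff_right)
      then show ?thesis using r by (simp add: dist_norm norm_minus_commute)
    qed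
    have \<phi>: "smooth \<phi>" unfolding \<phi>_def by (rule smooth_compose_affine[OF \<beta>(1)])
    have \<phi>1: "\<phi> y = 1" if "y \<in> ball a (r / 2)" for y
      unfolding \<phi>_def by (rule \<beta>(4), unfold arg) (use that r in \<open>simp add: field_simps\<close>)
    have \<phi>0: "\<phi> y = 0" if "y \<notin> cball a (5 * r / 6)" for y
      unfolding \<phi>_def by (rule \<beta>(5), unfold arg) (use that r in \<open>simp add: field_simps\<close>)
    have \<phi>nn: "0 \<le> \<phi> y" for y unfolding \<phi>_def by (rule \<beta>(2))
    have smooth: "smooth v" unfolding v_def by (intro smooth_scaleR \<phi> smooth_const)
    have sub: "cball a (5 * r / 6) \<subseteq> ball a r" using r by auto
    have spt: "spt v \<subseteq> cball a (5 * r / 6)"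
      by (rule spt_subset_closed) (use \<phi>0 in \<open>auto simp: v_def\<close>)
    have test: "v \<in> test_functions U"
      by (rule test_functionsI_closed[OF smooth, of "cball a (5 * r / 6)" "cball a (5 * r / 6)"])
        (use sub U \<phi>0 in \<open>auto simp: v_def\<close>)
    have grad: "r * grad_norm v y \<le> 1 / \<mu>" for y
    proof -
      have "grad_norm v y \<le> \<bar>\<phi> y\<bar> * grad_norm (\<lambda>y. s *\<^sub>R e) y + norm (s *\<^sub>R e) * grad_norm \<phi> y"
        unfolding v_def by (rule grad_norm_scaleR[OF \<phi> smooth_const])
      also have "\<dots> = s * norm e * grad_norm \<phi> y" using s by simp
      also have "\<dots> \<le> s * 1 * (6 / r * B0)"
        unfolding \<phi>_def grad_norm_compose_affine[OF \<beta>(1)] using s r e B0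
        by (intro mult_mono) auto
      finally have "r * grad_norm v y \<le> r * (s * 1 * (6 / r * B0))"
        using r by (intro mult_left_mono) auto
      also have "\<dots> = 1 / \<mu>" using r B0 by (simp add: s_def)
      finally show ?thesis .
    qed
    have "energy r v \<le> (\<integral>\<^sup>+y. ennreal (1 / \<mu>) * indicator (ball a r) y \<partial>lborel)"
      unfolding energy_def
    proof (rule nn_integral_mono)
      fix y
      show "G (r * grad_norm v y) \<le> ennreal (1 / \<mu>) * indicator (ball a r) y"
      proof (cases "y \<in> ball a r")
        case True
        have "G (r * grad_norm v y) \<le> G (1 / \<mu>)" using grad r by (intro mono) auto
        also have "\<dots> \<le> ennreal (1 / \<mu>)"
        proof -
          have "ennreal \<mu> * G (1 / \<mu>) \<le> 1"
            using order_trans[OF scale[OF \<mu>(1), of 1] one] by simp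
          then have "ennreal (1 / \<mu>) * (ennreal \<mu> * G (1 / \<mu>)) \<le> ennreal (1 / \<mu>) * 1"
            by (intro mult_left_mono) auto
          then show ?thesis using \<mu>(1) by (simp add: mult.assoc[symmetric] flip: ennreal_mult')
        qed
        finally show ?thesis using True by simp
      next
        case False
        then have "y \<notin> spt v" using spt sub by blast
        then show ?thesis by (simp add: grad_norm_outside_spt zero)
      qed
    qed
    also have "\<dots> = ennreal (1 / \<mu> * (?\<omega> * r ^ DIM('a)))"
      using r \<mu>(1) by (subst nn_integral_cmult_indicator) (simp_all add: emeasure_ball flip: ennreal_mult')
    also have "\<dots> \<le> ennreal (r ^ DIM('a))"
      using r \<mu> by (intro ennreal_leI) (simp add: field_simps mult_right_mono)
    finally have comp: "v \<in> competitors U a r"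
      using test spt sub by (auto simp: competitors_def)
    have inner: "c \<bullet> v y = norm c * s * \<phi> y" for y
      by (simp add: v_def ce)
    have "norm c * s * (?\<omega> * (r / 2) ^ DIM('a)) = (\<integral>y. norm c * s * indicator (ball a (r / 2)) y \<partial>lborel)"
      using r by (simp add: content_ball)
    also have "\<dots> \<le> (\<integral>y. c \<bullet> v y \<partial>lborel)"
    proof (rule integral_mono)
      show "integrable lborel (\<lambda>y. c \<bullet> v y)" by (rule integrable_inner_test[OF test]) simp
      show "integrable lborel (\<lambda>y. norm c * s * indicator (ball a (r / 2)) y)"
        by (intro integrable_mult_right integrable_real_indicator) (use emeasure_lborel_ball_finite[of a "r / 2"] in auto)
      fix y show "norm c * s * indicator (ball a (r / 2)) y \<le> c \<bullet> v y"
        unfolding inner using \<phi>1[of y] \<phi>nn[of y] s by (intro mult_left_mono) (auto simp: indicator_def)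
    qed
    finally show "\<exists>v\<in>competitors U a r. s * ?\<omega> / 2 ^ DIM('a) * norm c * r ^ DIM('a) \<le> (\<integral>y. c \<bullet> v y \<partial>lborel)"
      using comp by (intro bexI[of _ v]) (simp_all add: power_divide mult_ac)
  qed
qed

lemma approximable_constants_close:
  obtains \<kappa> where "\<kappa> > 0"
    "\<And>U (a :: 'a::euclidean_space) T (c :: 'b::euclidean_space) c' \<epsilon> \<epsilon>'. \<lbrakk>open U; a \<in> U; approximable U T \<epsilon> a c; approximable U T \<epsilon>' a c'\<rbrakk>
      \<Longrightarrow> \<kappa> * norm (c - c') \<le> \<epsilon> + \<epsilon>'"
proof -
  obtain \<kappa> where \<kappa>: "\<kappa> > 0"
    "\<And>U (a :: 'a) r (c :: 'b). \<lbrakk>0 < r; ball a r \<subseteq> U\<rbrakk> \<Longrightarrow>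
      \<exists>v\<in>competitors U a r. \<kappa> * norm c * r ^ DIM('a) \<le> (\<integral>y. c \<bullet> v y \<partial>lborel)"
    using bump_competitor[where ?'a = 'a and ?'b = 'b] by blast
  show thesis
  proof (rule that[OF \<kappa>(1)])
    fix U and a :: 'a and T and c c' :: 'b and \<epsilon> \<epsilon>'
    assume U: "open U" "a \<in> U" and app: "approximable U T \<epsilon> a c" "approximable U T \<epsilon>' a c'"
    obtain r1 where r1: "r1 > 0" "\<And>r v. \<lbrakk>0 < r; r < r1; v \<in> competitors U a r\<rbrakk> \<Longrightarrow>
        \<bar>T v - (\<integral>y. c \<bullet> v y \<partial>lborel)\<bar> \<le> \<epsilon> * r ^ DIM('a)"
      using app(1) unfolding approximable_def by blast
    obtain r2 where r2: "r2 > 0" "\<And>r v. \<lbrakk>0 < r; r < r2; v \<in> competitors U a r\<rbrakk> \<Longrightarrow>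
        \<bar>T v - (\<integral>y. c' \<bullet> v y \<partial>lborel)\<bar> \<le> \<epsilon>' * r ^ DIM('a)"
      using app(2) unfolding approximable_def by blast
    obtain r3 where r3: "r3 > 0" "ball a r3 \<subseteq> U" using U openE by blast
    define r where "r = min r3 (min r1 r2) / 2"
    have r: "0 < r" "r < r1" "r < r2" "ball a r \<subseteq> U"
      using r1(1) r2(1) r3 subset_ball[of r r3 a] by (auto simp: r_def)
    obtain v where v: "v \<in> competitors U a r" "\<kappa> * norm (c - c') * r ^ DIM('a) \<le> (\<integral>y. (c - c') \<bullet> v y \<partial>lborel)"
      using \<kappa>(2)[OF r(1,4)] by blast
    have "v \<in> test_functions U" using v(1) by (simp add: competitors_def)
    then have "(\<integral>y. (c - c') \<bullet> v y \<partial>lborel) = (\<integral>y. c \<bullet> v y \<partial>lborel) - (\<integral>y. c' \<bullet> v y \<partial>lborel)"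
      using integrable_inner_test[of v U "\<lambda>y. c"] integrable_inner_test[of v U "\<lambda>y. c'"]
      by (simp add: inner_diff_left)
    also have "\<dots> \<le> \<epsilon> * r ^ DIM('a) + \<epsilon>' * r ^ DIM('a)"
      using r1(2)[OF r(1,2) v(1)] r2(2)[OF r(1,3) v(1)] by linarith
    finally have "\<kappa> * norm (c - c') * r ^ DIM('a) \<le> (\<epsilon> + \<epsilon>') * r ^ DIM('a)"
      using v(2) by (simp add: distrib_right)
    then show "\<kappa> * norm (c - c') \<le> \<epsilon> + \<epsilon>'"
      by (rule mult_right_le_imp_le) (use r(1) in simp)
  qed
qed

text \<open>Constants that approximate up to \<open>1 / n\<close> form a Cauchy sequence, and their limit approximates
  up to every positive error.\<close>

lemma approximable_limit:
  fixes a :: "'a::euclidean_space" and T :: "('a \<Rightarrow> 'b::euclidean_space) \<Rightarrow> real"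
  assumes U: "open U" "a \<in> U" and app: "\<And>n. \<exists>c. approximable U T (1 / real (Suc n)) a c"
  shows "\<exists>c. \<forall>\<epsilon>>0. approximable U T \<epsilon> a c"
proof -
  obtain \<kappa> where \<kappa>: "\<kappa> > 0"
    "\<And>U (a :: 'a) T (c :: 'b) c' \<epsilon> \<epsilon>'. \<lbrakk>open U; a \<in> U; approximable U T \<epsilon> a c; approximable U T \<epsilon>' a c'\<rbrakk>
      \<Longrightarrow> \<kappa> * norm (c - c') \<le> \<epsilon> + \<epsilon>'"
    using approximable_constants_close[where ?'a = 'a and ?'b = 'b] by blast
  obtain D where D: "D > 0" "\<And>U a r (v :: 'a \<Rightarrow> 'b). \<lbrakk>0 < r; v \<in> competitors U a r\<rbrakk>
      \<Longrightarrow> (\<integral>y. norm (v y) \<partial>lborel) \<le> D * r ^ DIM('a)"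
    using competitors_L1[where ?'a = 'a and ?'b = 'b] by blast
  obtain c where c: "\<And>n. approximable U T (1 / real (Suc n)) a (c n)" using app by metis
  have dist: "dist (c j) (c n) \<le> (1 / real (Suc j) + 1 / real (Suc n)) / \<kappa>" for j n
    using \<kappa>(2)[OF U c c, of j n] \<kappa>(1) by (simp add: dist_norm pos_le_divide_eq mult.commute)
  have lim0: "(\<lambda>j. 1 / real (Suc j)) \<longlonglongrightarrow> 0"
    using LIMSEQ_inverse_real_of_nat by (simp add: inverse_eq_divide)
  have "Cauchy c"
  proof (rule metric_CauchyI)
    fix e :: real assume e: "e > 0"
    then have "e * \<kappa> / 2 > 0" using \<kappa>(1) by simp
    then obtain N where N: "1 / real (Suc N) < e * \<kappa> / 2"
      using reals_Archimedean by (metis inverse_eq_divide)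
    show "\<exists>N. \<forall>j\<ge>N. \<forall>n\<ge>N. dist (c j) (c n) < e"
    proof (intro exI[of _ N] allI impI)
      fix j n assume jn: "j \<ge> N" "n \<ge> N"
      have "1 / real (Suc j) \<le> 1 / real (Suc N)" "1 / real (Suc n) \<le> 1 / real (Suc N)"
        using jn by (auto intro!: divide_left_mono)
      then have "1 / real (Suc j) + 1 / real (Suc n) < e * \<kappa>" using N by linarith
      then show "dist (c j) (c n) < e"
        using dist[of j n] \<kappa>(1) by (simp add: pos_divide_less_eq order.strict_trans1)
    qed
  qed
  then obtain c0 where c0: "c \<longlonglongrightarrow> c0" using Cauchy_convergent_iff convergent_def by blast
  have close: "dist c0 (c n) \<le> 1 / real (Suc n) / \<kappa>" for n
  proof (rule LIMSEQ_le)
    show "(\<lambda>j. dist (c j) (c n)) \<longlonglongrightarrow> dist c0 (c n)" by (intro tendsto_intros c0)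
    have "(\<lambda>j. (1 / real (Suc j) + 1 / real (Suc n)) / \<kappa>) \<longlonglongrightarrow> (0 + 1 / real (Suc n)) / \<kappa>"
      by (intro tendsto_intros lim0) (use \<kappa>(1) in simp)
    then show "(\<lambda>j. (1 / real (Suc j) + 1 / real (Suc n)) / \<kappa>) \<longlonglongrightarrow> 1 / real (Suc n) / \<kappa>" by simp
    show "\<exists>N. \<forall>j\<ge>N. dist (c j) (c n) \<le> (1 / real (Suc j) + 1 / real (Suc n)) / \<kappa>" using dist by blast
  qed
  have "approximable U T \<epsilon> a c0" if \<epsilon>: "\<epsilon> > 0" for \<epsilon>
  proof -
    have "\<epsilon> / (1 + D / \<kappa>) > 0" using \<epsilon> D(1) \<kappa>(1) by (simp add: add_pos_pos)
    then obtain n where n: "1 / real (Suc n) < \<epsilon> / (1 + D / \<kappa>)"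
      using reals_Archimedean by (metis inverse_eq_divide)
    obtain r0 where r0: "r0 > 0" "\<And>r v. \<lbrakk>0 < r; r < r0; v \<in> competitors U a r\<rbrakk> \<Longrightarrow>
        \<bar>T v - (\<integral>y. c n \<bullet> v y \<partial>lborel)\<bar> \<le> 1 / real (Suc n) * r ^ DIM('a)"
      using c[of n] unfolding approximable_def by blast
    show ?thesis
      unfolding approximable_def
    proof (intro exI[of _ r0] conjI allI impI)
      fix r and v :: "'a \<Rightarrow> 'b" assume *: "0 < r \<and> r < r0 \<and> v \<in> competitors U a r"
      then have v: "v \<in> test_functions U" by (simp add: competitors_def)
      have int: "integrable lborel (\<lambda>y. c0 \<bullet> v y)" "integrable lborel (\<lambda>y. c n \<bullet> v y)"
        using integrable_inner_test[OF v] by auto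
      have "\<bar>(\<integral>y. c n \<bullet> v y \<partial>lborel) - (\<integral>y. c0 \<bullet> v y \<partial>lborel)\<bar> = \<bar>\<integral>y. (c n - c0) \<bullet> v y \<partial>lborel\<bar>"
        using int by (simp add: inner_diff_left)
      also have "\<dots> \<le> (\<integral>y. dist c0 (c n) * norm (v y) \<partial>lborel)"
      proof (rule integral_abs_bound_integral)
        show "integrable lborel (\<lambda>y. (c n - c0) \<bullet> v y)" using int by (simp add: inner_diff_left)
        show "integrable lborel (\<lambda>y. dist c0 (c n) * norm (v y))"
          using integrable_norm_test[OF v] by simp
        show "\<bar>(c n - c0) \<bullet> v y\<bar> \<le> dist c0 (c n) * norm (v y)" for y
          using Cauchy_Schwarz_ineq2[of "c n - c0" "v y"] by (simp add: dist_norm norm_minus_commute)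
      qed
      also have "\<dots> = dist c0 (c n) * (\<integral>y. norm (v y) \<partial>lborel)" by simp
      also have "\<dots> \<le> (1 / real (Suc n) / \<kappa>) * (D * r ^ DIM('a))"
        using close[of n] D * \<kappa>(1) by (intro mult_mono) auto
      finally have "\<bar>T v - (\<integral>y. c0 \<bullet> v y \<partial>lborel)\<bar> \<le>
          1 / real (Suc n) * r ^ DIM('a) + (1 / real (Suc n) / \<kappa>) * (D * r ^ DIM('a))"
        using r0(2)[of r v] * by linarith
      also have "\<dots> = 1 / real (Suc n) * (1 + D / \<kappa>) * r ^ DIM('a)"
      proof -
        have "q * R + q / \<kappa> * (D * R) = q * (1 + D / \<kappa>) * R" for q R :: real
          by (simp add: algebra_simps)
        then show ?thesis .
      qed
      also have "\<dots> \<le> \<epsilon> * r ^ DIM('a)"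
      proof (rule mult_right_mono)
        have "0 < 1 + D / \<kappa>" using D(1) \<kappa>(1) by (simp add: add_pos_pos)
        then show "1 / real (Suc n) * (1 + D / \<kappa>) \<le> \<epsilon>" using n by (simp only: pos_less_divide_eq less_imp_le)
      qed (use * in simp)
      finally show "\<bar>T v - (\<integral>y. c0 \<bullet> v y \<partial>lborel)\<bar> \<le> \<epsilon> * r ^ DIM('a)" .
    qed (rule r0(1))
  qed
  then show ?thesis by blast
qed

text \<open>A competitor has compact support in an open ball, so it is also a competitor for all centres
  close to the given one.\<close>

lemma closed_bounded_points:
  fixes T :: "('a::euclidean_space \<Rightarrow> 'b::euclidean_space) \<Rightarrow> real"
  shows "closed {a. ball a \<rho> \<subseteq> U \<and> (\<forall>r v. 0 < r \<and> r < \<rho> \<and> v \<in> competitors U a r \<longrightarrow> T v \<le> k * r ^ DIM('a))}"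
    (is "closed ?C")
  unfolding closed_sequential_limits
proof (intro allI impI)
  fix x l assume "(\<forall>n. x n \<in> ?C) \<and> x \<longlonglongrightarrow> l"
  then have x: "\<And>n. x n \<in> ?C" and lim: "x \<longlonglongrightarrow> l" by auto
  have near: "\<exists>n. S \<subseteq> ball (x n) r" if S: "compact S" "S \<subseteq> ball l r" for S r
  proof (cases "S = {}")
    case False
    obtain z where z: "z \<in> S" "\<And>y. y \<in> S \<Longrightarrow> dist l y \<le> dist l z"
      using distance_attains_sup[OF S(1) False, of l] by blast
    then have "0 < r - dist l z" using S(2) by auto
    then obtain n where n: "dist (x n) l < r - dist l z"
      using lim unfolding lim_sequentially by blast
    have "S \<subseteq> ball (x n) r"
    proof
      fix y assume "y \<in> S"
      from z(2)[OF this] show "y \<in> ball (x n) r"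
        using n dist_triangle[of "x n" y l] by simp
    qed
    then show ?thesis by blast
  qed simp
  show "l \<in> ?C"
  proof (intro CollectI conjI allI impI subsetI)
    fix y assume "y \<in> ball l \<rho>"
    then obtain n where "{y} \<subseteq> ball (x n) \<rho>" using near[of "{y}" \<rho>] by auto
    then show "y \<in> U" using x[of n] by auto
  next
    fix r and v :: "'a \<Rightarrow> 'b" assume *: "0 < r \<and> r < \<rho> \<and> v \<in> competitors U l r"
    then obtain n where "spt v \<subseteq> ball (x n) r"
      using near[of "spt v" r] by (auto simp: competitors_def test_functions_def)
    then have "v \<in> competitors U (x n) r" using * by (auto simp: competitors_def)
    then show "T v \<le> k * r ^ DIM('a)" using x[of n] * by auto
  qed
qed

text \<open>The set of points with a bound is a countable union of pieces \<open>C i \<inter> V i j\<close> to which the packing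
  argument applies.\<close>

theorem almost_everywhere_approximable:
  fixes T :: "('a::euclidean_space \<Rightarrow> 'b::euclidean_space) \<Rightarrow> real"
  assumes U: "open U" and T: "linear_on_test_functions U T"
  shows "negligible {a \<in> U.
    (\<exists>k \<rho>. 0 < \<rho> \<and> (\<forall>r v. 0 < r \<and> r < \<rho> \<and> v \<in> competitors U a r \<longrightarrow> T v \<le> k * r ^ DIM('a))) \<and>
    \<not> (\<exists>c. \<forall>\<epsilon>>0. approximable U T \<epsilon> a c)}" (is "negligible ?Z")
proof (rule slowly_varying_partition[where ?'a = 'a])
  interpret T: linear_on_test_functions U T by (rule T)
  fix B :: real
  assume B: "B \<ge> 1"
    "\<And>(K :: 'a set) h h0. \<lbrakk>compact K; 0 < h0; \<And>x. x \<in> K \<Longrightarrow> h0 \<le> h x;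
       \<And>x y. x \<in> K \<Longrightarrow> y \<in> K \<Longrightarrow> h x \<le> h y + dist x y / 20\<rbrakk>
     \<Longrightarrow> \<exists>F \<psi>. F \<subseteq> K \<and> slow_balls F h \<and> (\<forall>x\<in>F. cutoff B (h x) x (\<psi> x)) \<and>
          (\<forall>y\<in>K. (\<Sum>x\<in>F. \<psi> x y) = 1)"
  define \<rho> where "\<rho> i = 1 / real (Suc i)" for i
  define C where "C i = {a. ball a (\<rho> i) \<subseteq> U \<and>
    (\<forall>r v. 0 < r \<and> r < \<rho> i \<and> v \<in> competitors U a r \<longrightarrow> T v \<le> real (Suc i) * r ^ DIM('a))}" for i
  define V where "V i j = {x \<in> ball 0 (real j). infdist x (C i) < \<rho> i / 10}" for i j
  define Bad where "Bad i j n = {a \<in> C i \<inter> V i j. \<not> (\<exists>c. approximable U T (1 / real (Suc n)) a c)}" for i j n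
  have \<rho>: "\<rho> i > 0" for i by (simp add: \<rho>_def)
  have "negligible (Bad i j n)" for i j n
  proof (cases "C i = {}")
    case True
    then show ?thesis by (simp add: Bad_def)
  next
    case False
    interpret controlled G U T "C i" "V i j" "real (Suc i)" "\<rho> i" B
    proof
      show "closed (C i)" unfolding C_def by (rule closed_bounded_points)
      have "V i j = ball 0 (real j) \<inter> {x. infdist x (C i) < \<rho> i / 10}" by (auto simp: V_def)
      moreover have "open {x. infdist x (C i) < \<rho> i / 10}"
        by (intro open_Collect_less continuous_intros)
      ultimately show "open (V i j)" by auto
      show "bounded (V i j)" by (rule bounded_subset[OF bounded_ball, of _ 0 "real j"]) (auto simp: V_def)
    qed (use False \<rho> B in \<open>auto simp: C_def V_def\<close>)
    show ?thesis
      unfolding Bad_def approximable_def by (rule negligible_bad_points) simp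
  qed
  then have "negligible (\<Union>n. Bad i j n)" for i j
    by (intro negligible_countable_Union) auto
  then have "negligible (\<Union>j. \<Union>n. Bad i j n)" for i
    by (intro negligible_countable_Union) auto
  then have "negligible (\<Union>i. \<Union>j. \<Union>n. Bad i j n)"
    by (intro negligible_countable_Union) auto
  moreover have "?Z \<subseteq> (\<Union>i. \<Union>j. \<Union>n. Bad i j n)"
  proof
    fix a assume "a \<in> ?Z"
    then obtain k \<rho>0 where a: "a \<in> U" "0 < \<rho>0"
      and k: "\<And>r v. \<lbrakk>0 < r; r < \<rho>0; v \<in> competitors U a r\<rbrakk> \<Longrightarrow> T v \<le> k * r ^ DIM('a)"
      and none: "\<not> (\<exists>c. \<forall>\<epsilon>>0. approximable U T \<epsilon> a c)" by blast
    obtain n where n: "\<not> (\<exists>c. approximable U T (1 / real (Suc n)) a c)"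
      using approximable_limit[OF U a(1), of T] none by blast
    obtain e where e: "e > 0" "ball a e \<subseteq> U" using U a(1) openE by blast
    obtain i1 where i1: "\<rho> i1 < min e \<rho>0"
      using reals_Archimedean[of "min e \<rho>0"] e a(2) by (auto simp: \<rho>_def inverse_eq_divide)
    obtain i2 where i2: "k < real i2" using reals_Archimedean2 by blast
    define i where "i = max i1 i2"
    have i: "\<rho> i \<le> \<rho> i1" "k \<le> real (Suc i)"
      using i2 by (auto simp: i_def \<rho>_def intro!: divide_left_mono)
    have aC: "a \<in> C i"
    proof -
      have "ball a (\<rho> i) \<subseteq> U" using e(2) i(1) i1 subset_ball[of "\<rho> i" e a] by auto
      moreover have "T v \<le> real (Suc i) * r ^ DIM('a)" if "0 < r \<and> r < \<rho> i \<and> v \<in> competitors U a r" for r v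
      proof -
        have "T v \<le> k * r ^ DIM('a)" using k that i(1) i1 by auto
        also have "\<dots> \<le> real (Suc i) * r ^ DIM('a)" using that i(2) by (intro mult_right_mono) auto
        finally show ?thesis .
      qed
      ultimately show ?thesis by (auto simp: C_def)
    qed
    obtain j where j: "norm a < real j" using reals_Archimedean2 by blast
    have "a \<in> V i j" using j aC \<rho>[of i] by (simp add: V_def)
    then have "a \<in> Bad i j n" using aC n by (simp add: Bad_def)
    then show "a \<in> (\<Union>i. \<Union>j. \<Union>n. Bad i j n)" by blast
  qed
  ultimately show ?thesis by (rule negligible_subset)
qed

end

section \<open>Powers as Young functions\<close>

definition power_young :: "real \<Rightarrow> real \<Rightarrow> ennreal" where
  "power_young q s = (if q = 1 then (if s \<le> 1 then 0 else \<infinity>) else ennreal (max 0 s powr (q / (q - 1))))"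

text \<open>For finite \<open>p = q / (q - 1)\<close> the affine minorants are the tangents, by Young's inequality, and
  \<open>M * (s / M) powr p = M powr (1 - p) * s powr p\<close> gives superlinearity.  For \<open>p = \<infinity>\<close> the affine
  minorants are the steep ones through the point \<open>1\<close>.\<close>

lemma young_power_young:
  assumes q: "1 \<le> q"
  shows "young (power_young q)"
proof (cases "q = 1")
  case True
  have G: "power_young q = (\<lambda>s. if s \<le> 1 then 0 else \<infinity>)"
    using True by (auto simp: power_young_def fun_eq_iff)
  show ?thesis
    unfolding G
  proof
    show "(\<lambda>s::real. if s \<le> 1 then 0 else \<infinity> :: ennreal) \<in> borel_measurable borel" by measurable
    show "\<exists>\<alpha> \<beta>. 0 \<le> \<alpha> \<and> 0 \<le> \<beta> \<and> y \<le> ennreal (\<alpha> * s - \<beta>) \<and> (\<forall>t\<ge>0. ennreal (\<alpha> * t - \<beta>) \<le> (if t \<le> 1 then 0 else \<infinity>))"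
      if "0 \<le> s" "y < (if s \<le> 1 then 0 else \<infinity>)" for s :: real and y :: ennreal
    proof -
      have s: "s > 1" "y < \<infinity>" using that by (auto split: if_splits)
      then obtain z where z: "z \<ge> 0" "y = ennreal z" by (cases y) auto
      let ?N = "z / (s - 1)"
      have "?N * s - ?N = ?N * (s - 1)" by (simp add: right_diff_distrib)
      then have "?N * s - ?N = z" using s(1) by simp
      moreover have "?N * t - ?N \<le> 0" if "t \<le> 1" for t
        using that z(1) s(1) mult_left_mono[of t 1 ?N] by simp
      ultimately show ?thesis
        using z s(1) by (intro exI[of _ ?N]) (auto simp: ennreal_neg)
    qed
    show "\<exists>M\<ge>1. \<forall>s\<ge>0. ennreal M * (if s / M \<le> 1 then 0 else \<infinity>) \<le> ennreal \<tau> * (if s \<le> 1 then 0 else \<infinity>)"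
      if "0 < \<tau>" for \<tau> :: real
      using that by (intro exI[of _ 1]) (auto simp: ennreal_mult_top)
  qed auto
next
  case False
  then have q1: "1 < q" using q by simp
  define p where "p = q / (q - 1)"
  have p: "p > 1" "1 / p + 1 / q = 1" "p / q = p - 1" "(p - 1) * q = p"
    using q1 by (auto simp: p_def field_simps)
  have G: "power_young q = (\<lambda>s. ennreal (max 0 s powr p))"
    using False by (auto simp: power_young_def p_def fun_eq_iff)
  show ?thesis
    unfolding G
  proof
    show "(\<lambda>s. ennreal (max 0 s powr p)) \<in> borel_measurable borel" by measurable
    show "ennreal (max 0 s powr p) \<le> ennreal (max 0 t powr p)" if "0 \<le> s" "s \<le> t" for s t
      using that p by (intro ennreal_leI powr_mono2) auto
    have "(1::real) \<le> 2 powr p" using p by (simp add: ge_one_powr_ge_zero)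
    then show "1 \<le> ennreal (max 0 2 powr p)" by simp
    show "\<exists>\<alpha> \<beta>. 0 \<le> \<alpha> \<and> 0 \<le> \<beta> \<and> y \<le> ennreal (\<alpha> * s - \<beta>) \<and> (\<forall>t\<ge>0. ennreal (\<alpha> * t - \<beta>) \<le> ennreal (max 0 t powr p))"
      if s: "0 \<le> s" "y < ennreal (max 0 s powr p)" for s :: real and y :: ennreal
    proof (intro exI conjI allI impI)
      have "s \<noteq> 0" using s by auto
      then have pos: "s > 0" using s by simp
      let ?\<alpha> = "p * s powr (p - 1)" and ?\<beta> = "(p - 1) * s powr p"
      show "0 \<le> ?\<alpha>" "0 \<le> ?\<beta>" using p by auto
      have "s powr (p - 1) * s = s powr p"
        using pos by (simp add: powr_diff)
      then have "?\<alpha> * s - ?\<beta> = s powr p" by (simp add: algebra_simps)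
      then show "y \<le> ennreal (?\<alpha> * s - ?\<beta>)" using s pos by (simp add: less_imp_le)
      fix t :: real assume t: "t \<ge> 0"
      have "t * s powr (p - 1) \<le> t powr p / p + (s powr (p - 1)) powr q / q"
        by (rule Youngs_inequality) (use p q1 t in auto)
      also have "(s powr (p - 1)) powr q = s powr p" by (simp add: powr_powr p(4))
      finally have "p * (t * s powr (p - 1)) \<le> p * (t powr p / p + s powr p / q)"
        using p by (intro mult_left_mono) auto
      also have "\<dots> = t powr p + (p / q) * s powr p"
        using p(1) by (simp add: distrib_left)
      finally have "?\<alpha> * t - ?\<beta> \<le> t powr p" by (simp add: p(3) mult_ac)
      then show "ennreal (?\<alpha> * t - ?\<beta>) \<le> ennreal (max 0 t powr p)"
        using t by (intro ennreal_leI) simp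
    qed
    show "\<exists>M\<ge>1. \<forall>s\<ge>0. ennreal M * ennreal (max 0 (s / M) powr p) \<le> ennreal \<tau> * ennreal (max 0 s powr p)"
      if \<tau>: "0 < \<tau>" for \<tau> :: real
    proof -
      define M where "M = max 1 (\<tau> powr (1 / (1 - p)))"
      have M: "M \<ge> 1" "\<tau> powr (1 / (1 - p)) \<le> M" by (auto simp: M_def)
      have "M powr (1 - p) \<le> (\<tau> powr (1 / (1 - p))) powr (1 - p)"
        using M p \<tau> by (intro powr_mono2') auto
      also have "\<dots> = \<tau>" using p \<tau> by (simp add: powr_powr)
      finally have M\<tau>: "M powr (1 - p) \<le> \<tau>" .
      have "ennreal M * ennreal (max 0 (s / M) powr p) \<le> ennreal \<tau> * ennreal (max 0 s powr p)" if s: "s \<ge> 0" for s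
      proof -
        have "M * (s / M) powr p = M powr (1 - p) * s powr p"
          using M s by (simp add: powr_divide powr_diff)
        also have "\<dots> \<le> \<tau> * s powr p" using M\<tau> by (intro mult_right_mono) auto
        finally show ?thesis
          using M s \<tau> by (simp add: ennreal_leI max_def flip: ennreal_mult')
      qed
      then show ?thesis using M(1) by blast
    qed
  qed auto
qed

section \<open>The normalised form of the dual seminorm\<close>

lemma hom_norm_frechet_derivative:
  fixes \<theta> :: "real^'m \<Rightarrow> real^'k"
  assumes "smooth \<theta>"
  shows "hom_norm (frechet_derivative \<theta> (at x)) = grad_norm \<theta> x"
proof -
  let ?D = "frechet_derivative \<theta> (at x)"
  have lin: "linear ?D" using has_derivative_linear[OF smooth_has_derivative[OF assms]] .
  have Basis: "(Basis :: (real^'m) set) = range (\<lambda>i. axis i 1)"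
    by (auto simp: Basis_vec_def)
  have inj: "inj (\<lambda>i::'m. axis i (1::real))"
    by (auto simp: inj_on_def axis_eq_axis)
  have "hom_inner ?D ?D = (\<Sum>i\<in>UNIV. adjoint ?D (?D (axis i 1)) $ i)"
    by (simp add: hom_inner_def trace_def matrix_def)
  also have "\<dots> = (\<Sum>i\<in>UNIV. (norm (?D (axis i 1)))\<^sup>2)"
  proof (rule sum.cong[OF refl])
    fix i :: 'm
    have "adjoint ?D (?D (axis i 1)) $ i = axis i 1 \<bullet> adjoint ?D (?D (axis i 1))"
      by (subst inner_commute) (rule cart_eq_inner_axis)
    also have "\<dots> = (norm (?D (axis i 1)))\<^sup>2"
      by (simp add: adjoint_works[OF lin] power2_norm_eq_inner)
    finally show "adjoint ?D (?D (axis i 1)) $ i = (norm (?D (axis i 1)))\<^sup>2" .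
  qed
  also have "\<dots> = (\<Sum>b\<in>Basis. (norm (?D b))\<^sup>2)"
    unfolding Basis by (subst sum.reindex[OF inj]) simp
  finally show ?thesis
    by (simp add: hom_norm_def grad_norm_def L2_set_def)
qed

lemma conjugate_exponent_eq:
  assumes "1 \<le> q"
  shows "conjugate_exponent (ennreal q) = (if q = 1 then \<infinity> else ennreal (q / (q - 1)))"
proof -
  have "1 \<le> ennreal q" using assms by simp
  from conjugate_exponent_unique[OF this]
  have eq: "conjugate_exponent (ennreal q) = p" if "1 \<le> p" "1 / p + 1 / ennreal q = 1" for p
    unfolding conjugate_exponent_def using that by (intro the1_equality) auto
  show ?thesis
  proof (cases "q = 1")
    case True
    have "conjugate_exponent (ennreal q) = \<infinity>"
      by (rule eq) (use True in simp_all)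
    then show ?thesis using True by simp
  next
    case False
    then have q: "1 < q" using assms by simp
    have "1 / ennreal (q / (q - 1)) + 1 / ennreal q = ennreal ((q - 1) / q) + ennreal (1 / q)"
      using q by (simp add: divide_ennreal flip: ennreal_1)
    also have "\<dots> = 1" using q by (simp add: field_simps flip: ennreal_plus)
    finally have "conjugate_exponent (ennreal q) = ennreal (q / (q - 1))"
      using q by (intro eq) (auto simp: field_simps)
    then show ?thesis using False by simp
  qed
qed

lemma nn_integral_lebesgue_on_ball:
  fixes f :: "'a::euclidean_space \<Rightarrow> ennreal"
  assumes [measurable]: "f \<in> borel_measurable borel" and "\<And>x. x \<notin> ball a r \<Longrightarrow> f x = 0"
  shows "(\<integral>\<^sup>+x. f x \<partial>lebesgue_on (ball a r)) = (\<integral>\<^sup>+x. f x \<partial>lborel)"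
proof -
  have "(\<integral>\<^sup>+x. f x \<partial>lebesgue_on (ball a r)) = (\<integral>\<^sup>+x. f x * indicator (ball a r) x \<partial>lebesgue)"
    by (rule nn_integral_restrict_space) simp
  also have "\<dots> = (\<integral>\<^sup>+x. f x \<partial>lebesgue)"
    using assms(2) by (intro nn_integral_cong) (auto simp: indicator_def)
  also have "\<dots> = (\<integral>\<^sup>+x. f x \<partial>lborel)"
    by (rule nn_integral_completion)
  finally show ?thesis .
qed

text \<open>With \<open>m = DIM('a)\<close> the factor \<open>r powr (m - m / q)\<close> is \<open>r powr (m / p)\<close>.  Its \<open>p\<close>-th power is \<open>r ^ m\<close> for
  finite \<open>p\<close>, and it is \<open>1\<close> for \<open>p = \<infinity>\<close>.\<close>

lemma Lp_norm_le_1_iff: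
  fixes g :: "'a::euclidean_space \<Rightarrow> real"
  assumes q: "1 \<le> q" and r: "0 < r" and g: "continuous_on UNIV g" "\<And>x. 0 \<le> g x" "\<And>x. x \<notin> ball a r \<Longrightarrow> g x = 0"
  shows "Lp_norm (conjugate_exponent (ennreal q)) (lebesgue_on (ball a r)) g \<le> 1 \<longleftrightarrow>
    (\<integral>\<^sup>+x. power_young q (r powr (real DIM('a) - real DIM('a) / q) * g x) \<partial>lborel) \<le> ennreal (r ^ DIM('a))"
proof -
  have [measurable]: "g \<in> borel_measurable borel" using g(1) by (rule borel_measurable_continuous_onI)
  show ?thesis
  proof (cases "q = 1")
    case True
    let ?M = "lebesgue_on (ball a r)"
    have meas: "(\<lambda>x. ennreal \<bar>g x\<bar>) \<in> borel_measurable ?M"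
      by (intro measurable_restrict_space1 measurable_completion) simp
    have P: "Measurable.pred borel (\<lambda>x. g x \<le> 1)" by measurable
    have "Lp_norm (conjugate_exponent (ennreal q)) ?M g \<le> 1 \<longleftrightarrow> esssup ?M (\<lambda>x. ennreal \<bar>g x\<bar>) \<le> 1"
      unfolding Lp_norm_def conjugate_exponent_eq[OF q] using True by simp
    also have "\<dots> \<longleftrightarrow> (AE x in ?M. ennreal \<bar>g x\<bar> \<le> 1)"
    proof
      assume le: "esssup ?M (\<lambda>x. ennreal \<bar>g x\<bar>) \<le> 1"
      show "AE x in ?M. ennreal \<bar>g x\<bar> \<le> 1"
        using esssup_AE[where f = "\<lambda>x. ennreal \<bar>g x\<bar>" and M = ?M]
        by eventually_elim (erule order_trans[OF _ le])
    qed (rule esssup_I[OF meas])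
    also have "\<dots> \<longleftrightarrow> (AE x in lebesgue. x \<in> ball a r \<longrightarrow> ennreal \<bar>g x\<bar> \<le> 1)"
      by (rule AE_restrict_space_iff) simp
    also have "\<dots> \<longleftrightarrow> (AE x in lebesgue. g x \<le> 1)"
      using g(2,3) by (intro AE_cong) (auto simp: ennreal_le_1)
    also have "\<dots> \<longleftrightarrow> (AE x in lborel. g x \<le> 1)"
      using P by (intro AE_completion_iff)
    also have "\<dots> \<longleftrightarrow> (\<integral>\<^sup>+x. power_young q (g x) \<partial>lborel) \<le> ennreal (r ^ DIM('a))"
    proof
      assume "AE x in lborel. g x \<le> 1"
      then have "AE x in lborel. power_young q (g x) = 0"
        by eventually_elim (use True in \<open>simp add: power_young_def\<close>)
      then have "(\<integral>\<^sup>+x. power_young q (g x) \<partial>lborel) = (\<integral>\<^sup>+x. 0 \<partial>(lborel :: 'a measure))"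
        by (rule nn_integral_cong_AE)
      then show "(\<integral>\<^sup>+x. power_young q (g x) \<partial>lborel) \<le> ennreal (r ^ DIM('a))" by simp
    next
      interpret young "power_young q" by (rule young_power_young[OF q])
      assume "(\<integral>\<^sup>+x. power_young q (g x) \<partial>lborel) \<le> ennreal (r ^ DIM('a))"
      then have "(\<integral>\<^sup>+x. power_young q (g x) \<partial>lborel) \<noteq> \<infinity>"
        by (auto simp: top_unique)
      then have "AE x in lborel. power_young q (g x) \<noteq> \<infinity>"
        by (intro nn_integral_noteq_infinite) simp
      then show "AE x in lborel. g x \<le> 1"
        by eventually_elim (use True in \<open>auto simp: power_young_def split: if_splits\<close>)
    qed
    finally show ?thesis using True r by simp
  next
    case False
    then have q1: "1 < q" using q by simp
    define p where "p = q / (q - 1)"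
    have p: "p > 1" using q1 by (simp add: p_def field_simps)
    let ?I = "\<integral>\<^sup>+x. ennreal (\<bar>g x\<bar> powr p) \<partial>lebesgue_on (ball a r)"
    have I: "?I = (\<integral>\<^sup>+x. ennreal (g x powr p) \<partial>lborel)"
      using g p by (subst nn_integral_lebesgue_on_ball) auto
    have "Lp_norm (conjugate_exponent (ennreal q)) (lebesgue_on (ball a r)) g =
        (if ?I = \<infinity> then \<infinity> else ennreal (enn2real ?I powr (1 / p)))"
      using False q p by (simp add: Lp_norm_def conjugate_exponent_eq p_def Let_def)
    also have "\<dots> \<le> 1 \<longleftrightarrow> ?I \<le> 1"
    proof (cases ?I)
      case (real z)
      have "z powr (1 / p) \<le> 1 \<longleftrightarrow> z \<le> 1"
      proof
        assume "z \<le> 1"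
        then have "z powr (1 / p) \<le> 1 powr (1 / p)" using real(1) p by (intro powr_mono2) auto
        then show "z powr (1 / p) \<le> 1" by simp
      next
        assume *: "z powr (1 / p) \<le> 1"
        show "z \<le> 1"
        proof (rule ccontr)
          assume "\<not> z \<le> 1"
          then have "1 powr (1 / p) < z powr (1 / p)" using p by (intro powr_less_mono2) auto
          then show False using * by simp
        qed
      qed
      then show ?thesis using real by (simp add: ennreal_le_1)
    next
      case top
      then show ?thesis by (simp add: top_unique)
    qed
    finally have 1: "Lp_norm (conjugate_exponent (ennreal q)) (lebesgue_on (ball a r)) g \<le> 1 \<longleftrightarrow>
        (\<integral>\<^sup>+x. ennreal (g x powr p) \<partial>lborel) \<le> 1"
      unfolding I .
    have e: "(real DIM('a) - real DIM('a) / q) * p = real DIM('a)"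
      using q1 by (simp add: p_def field_simps)
    have "(\<integral>\<^sup>+x. power_young q (r powr (real DIM('a) - real DIM('a) / q) * g x) \<partial>lborel) =
        (\<integral>\<^sup>+x. ennreal (r ^ DIM('a)) * ennreal (g x powr p) \<partial>lborel)"
    proof (rule nn_integral_cong)
      fix x
      have "(r powr (real DIM('a) - real DIM('a) / q) * g x) powr p = r ^ DIM('a) * g x powr p"
        using r g(2)[of x] by (simp add: powr_mult powr_powr e powr_realpow)
      then show "power_young q (r powr (real DIM('a) - real DIM('a) / q) * g x) = ennreal (r ^ DIM('a)) * ennreal (g x powr p)"
        using False g(2)[of x] r by (simp add: power_young_def p_def ennreal_mult')
    qed
    also have "\<dots> = ennreal (r ^ DIM('a)) * (\<integral>\<^sup>+x. ennreal (g x powr p) \<partial>lborel)"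
      by (rule nn_integral_cmult) simp
    also have "\<dots> \<le> ennreal (r ^ DIM('a)) \<longleftrightarrow> (\<integral>\<^sup>+x. ennreal (g x powr p) \<partial>lborel) \<le> 1"
      using ennreal_mult_le_mult_iff[of "ennreal (r ^ DIM('a))" "\<integral>\<^sup>+x. ennreal (g x powr p) \<partial>lborel" 1] r by simp
    finally show ?thesis using 1 by blast
  qed
qed

text \<open>The passage from \<open>\<theta>\<close> to \<open>r powr (m / p - 1) * \<theta>\<close> turns the scale factor
  \<open>r powr (- 1 - m / q)\<close> into the volume factor \<open>1 / r ^ m\<close> for every exponent.\<close>

lemma neg_norm_le_iff:
  fixes T :: "(real^'m \<Rightarrow> real^'k) \<Rightarrow> real"
  assumes q: "1 \<le> q" and r: "0 < r" and T: "linear_on_test_functions U T"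
  shows "ereal (r powr (- 1 - real CARD('m) / q)) * neg_norm (ennreal q) U a r T \<le> ereal \<kappa> \<longleftrightarrow>
    (\<forall>v\<in>young.competitors (power_young q) U a r. T v \<le> \<kappa> * r ^ CARD('m))"
proof -
  interpret young "power_young q" by (rule young_power_young[OF q])
  interpret T: linear_on_test_functions U T by (rule T)
  let ?d = "real CARD('m)"
  define N where "N = r powr (- 1 - ?d / q)"
  define c where "c = r powr (1 - ?d + ?d / q)"
  have N: "N > 0" and c: "c > 0" using r by (auto simp: N_def c_def)
  have rc: "r / c = r powr (?d - ?d / q)"
  proof -
    have "r / c = r powr 1 / r powr (1 - ?d + ?d / q)" using r by (simp add: c_def)
    also have "\<dots> = r powr (?d - ?d / q)" by (simp only: powr_diff[symmetric]) simp
    finally show ?thesis .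
  qed
  have Nc: "N * c = 1 / r ^ CARD('m)"
  proof -
    have "N * c = r powr (- ?d)" by (simp add: N_def c_def flip: powr_add)
    then show ?thesis using r by (simp add: powr_minus_divide powr_realpow)
  qed
  define A :: "(real^'m \<Rightarrow> real^'k) set" where "A = {\<theta> \<in> test_functions U. spt \<theta> \<subseteq> ball a r \<and>
    Lp_norm (conjugate_exponent (ennreal q)) (lebesgue_on (ball a r))
      (\<lambda>x. hom_norm (frechet_derivative \<theta> (at x))) \<le> 1}"
  have A: "\<theta> \<in> A \<longleftrightarrow> (\<lambda>x. (1 / c) *\<^sub>R \<theta> x) \<in> competitors U a r"
    if \<theta>: "\<theta> \<in> test_functions U" "spt \<theta> \<subseteq> ball a r" for \<theta> :: "real^'m \<Rightarrow> real^'k"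
  proof -
    have smooth: "smooth \<theta>" using \<theta> by (simp add: test_functions_def)
    have "Lp_norm (conjugate_exponent (ennreal q)) (lebesgue_on (ball a r)) (grad_norm \<theta>) \<le> 1 \<longleftrightarrow>
        (\<integral>\<^sup>+x. power_young q (r powr (real DIM(real^'m) - real DIM(real^'m) / q) * grad_norm \<theta> x) \<partial>lborel)
          \<le> ennreal (r ^ DIM(real^'m))"
      by (rule Lp_norm_le_1_iff[OF q r continuous_on_grad_norm[OF smooth] grad_norm_nonneg])
        (use \<theta>(2) in \<open>blast intro: grad_norm_outside_spt\<close>)
    also have "(\<integral>\<^sup>+x. power_young q (r powr (real DIM(real^'m) - real DIM(real^'m) / q) * grad_norm \<theta> x) \<partial>lborel) =
        energy r (\<lambda>x. (1 / c) *\<^sub>R \<theta> x)"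
      using c by (simp add: energy_cmult[OF smooth] mult_ac flip: rc)
    finally show ?thesis
      using \<theta> spt_cmult[of "1 / c" \<theta>] test_functions_cmult[OF \<theta>(1)]
      by (auto simp: A_def competitors_def hom_norm_frechet_derivative[OF smooth])
  qed
  have "ereal N * neg_norm (ennreal q) U a r T \<le> ereal \<kappa> \<longleftrightarrow> neg_norm (ennreal q) U a r T \<le> ereal (\<kappa> / N)"
    using N by (cases "neg_norm (ennreal q) U a r T") (auto simp: field_simps)
  also have "\<dots> \<longleftrightarrow> (\<forall>\<theta>\<in>A. T \<theta> \<le> \<kappa> / N)"
    by (simp add: neg_norm_def A_def SUP_le_iff)
  also have "\<dots> \<longleftrightarrow> (\<forall>v\<in>competitors U a r. T v \<le> \<kappa> * r ^ CARD('m))"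
  proof (intro iffI ballI)
    fix v :: "real^'m \<Rightarrow> real^'k" assume le: "\<forall>\<theta>\<in>A. T \<theta> \<le> \<kappa> / N" and v: "v \<in> competitors U a r"
    then have vt: "v \<in> test_functions U" "spt v \<subseteq> ball a r" by (auto simp: competitors_def)
    have "(\<lambda>x. c *\<^sub>R v x) \<in> A"
      using A[of "\<lambda>x. c *\<^sub>R v x"] test_functions_cmult[OF vt(1), of c] spt_cmult[of c v] vt(2) v c by auto
    then have "c * T v \<le> \<kappa> / N" using le T.T_scale[OF vt(1), of c] by auto
    then have "T v \<le> \<kappa> / (N * c)" using N c by (simp add: field_simps)
    then show "T v \<le> \<kappa> * r ^ CARD('m)" by (simp add: Nc)
  next
    fix \<theta> :: "real^'m \<Rightarrow> real^'k" assume le: "\<forall>v\<in>competitors U a r. T v \<le> \<kappa> * r ^ CARD('m)" and \<theta>: "\<theta> \<in> A"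
    then have \<theta>t: "\<theta> \<in> test_functions U" "spt \<theta> \<subseteq> ball a r" by (auto simp: A_def)
    have "T (\<lambda>x. (1 / c) *\<^sub>R \<theta> x) \<le> \<kappa> / (N * c)" using le A[OF \<theta>t] \<theta> by (auto simp: Nc)
    then have "T \<theta> / c \<le> \<kappa> / (N * c)" using T.T_scale[OF \<theta>t(1), of "1 / c"] by simp
    then show "T \<theta> \<le> \<kappa> / N" using N c by (simp add: field_simps)
  qed
  finally show ?thesis unfolding N_def .
qed

section \<open>Constant distributions\<close>

lemma set_integral_inner_test:
  fixes \<theta> :: "'a::euclidean_space \<Rightarrow> 'b::euclidean_space"
  assumes "\<theta> \<in> test_functions U"
  shows "set_lebesgue_integral lebesgue U (\<lambda>x. c \<bullet> \<theta> x) = (\<integral>x. c \<bullet> \<theta> x \<partial>lborel)"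
proof -
  note [measurable] = borel_measurable_smooth[OF test_functionsD(1)[OF assms]]
  have "indicator U x *\<^sub>R (c \<bullet> \<theta> x) = c \<bullet> \<theta> x" for x
    using zero_outside_spt[of x \<theta>] test_functionsD(3)[OF assms] by (cases "x \<in> spt \<theta>") auto
  then have "set_lebesgue_integral lebesgue U (\<lambda>x. c \<bullet> \<theta> x) = (\<integral>x. c \<bullet> \<theta> x \<partial>lebesgue)"
    unfolding set_lebesgue_integral_def by (simp only:)
  also have "\<dots> = (\<integral>x. c \<bullet> \<theta> x \<partial>lborel)"
    by (rule integral_completion) simp
  finally show ?thesis .
qed

lemma constant_functional_continuous:
  fixes c :: "'b::euclidean_space"
  assumes \<theta>: "\<theta> \<in> test_functions K" and \<eta>: "\<eta> \<in> test_functions K" and K: "compact K"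
    and close: "\<And>x. norm (\<eta> x - \<theta> x) \<le> e"
  shows "\<bar>(\<integral>x. c \<bullet> \<eta> x \<partial>lborel) - (\<integral>x. c \<bullet> \<theta> x \<partial>lborel)\<bar> \<le> norm c * e * measure lborel (K :: 'a::euclidean_space set)"
proof -
  have int: "integrable lborel (\<lambda>x. c \<bullet> \<eta> x)" "integrable lborel (\<lambda>x. c \<bullet> \<theta> x)"
    using integrable_inner_test[OF \<eta>] integrable_inner_test[OF \<theta>] by auto
  have finK: "integrable lborel (indicator K :: 'a \<Rightarrow> real)"
    by (rule integrable_real_indicator) (use K emeasure_compact_finite in \<open>auto intro: borel_compact\<close>)
  have "\<bar>(\<integral>x. c \<bullet> \<eta> x \<partial>lborel) - (\<integral>x. c \<bullet> \<theta> x \<partial>lborel)\<bar> = \<bar>\<integral>x. c \<bullet> (\<eta> x - \<theta> x) \<partial>lborel\<bar>"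
    using int by (simp add: inner_diff_right)
  also have "\<dots> \<le> (\<integral>x. norm c * e * indicator K x \<partial>lborel)"
  proof (rule integral_abs_bound_integral)
    show "integrable lborel (\<lambda>x. c \<bullet> (\<eta> x - \<theta> x))" using int by (simp add: inner_diff_right)
    show "integrable lborel (\<lambda>x. norm c * e * indicator K x)" using finK by simp
    fix x
    show "\<bar>c \<bullet> (\<eta> x - \<theta> x)\<bar> \<le> norm c * e * indicator K x"
    proof (cases "x \<in> K")
      case True
      have "\<bar>c \<bullet> (\<eta> x - \<theta> x)\<bar> \<le> norm c * norm (\<eta> x - \<theta> x)" by (rule Cauchy_Schwarz_ineq2)
      also have "\<dots> \<le> norm c * e" by (intro mult_left_mono close) auto
      finally show ?thesis using True by simp
    next
      case False
      then have "\<eta> x = 0" "\<theta> x = 0"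
        using test_functionsD(3)[OF \<eta>] test_functionsD(3)[OF \<theta>] zero_outside_spt[of x \<eta>] zero_outside_spt[of x \<theta>]
        by auto
      then show ?thesis using False by simp
    qed
  qed
  also have "\<dots> = norm c * e * measure lborel K" using K by (simp add: compact_imp_closed)
  finally show ?thesis .
qed

lemma constant_functional_distribution:
  fixes U :: "'a::euclidean_space set" and c :: "'b::euclidean_space"
  shows "(\<lambda>\<theta>\<in>test_functions U. \<integral>x. c \<bullet> \<theta> x \<partial>lborel) \<in> distributions U" (is "?S \<in> _")
proof -
  have add: "?S (\<lambda>x. \<theta> x + \<eta> x) = ?S \<theta> + ?S \<eta>" if "\<theta> \<in> test_functions U" "\<eta> \<in> test_functions U" for \<theta> \<eta>
    using that integrable_inner_test[of \<theta> U "\<lambda>x. c"] integrable_inner_test[of \<eta> U "\<lambda>x. c"]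
    by (simp add: test_functions_add inner_add_right)
  have scale: "?S (\<lambda>x. s *\<^sub>R \<theta> x) = s * ?S \<theta>" if "\<theta> \<in> test_functions U" for s \<theta>
    using that by (simp add: test_functions_cmult)
  have "continuous_map (test_topology U) euclideanreal ?S"
    unfolding continuous_map_def topspace_test_topology
  proof (intro conjI allI impI)
    fix W :: "real set" assume W: "openin euclideanreal W"
    show "openin (test_topology U) {\<theta> \<in> test_functions U. ?S \<theta> \<in> W}"
      unfolding openin_test_topology openin_test_topology_on
    proof (intro conjI allI impI ballI)
      fix K :: "'a set" and \<theta> :: "'a \<Rightarrow> 'b"
      assume K: "compact K \<and> K \<subseteq> U" and \<theta>: "\<theta> \<in> {\<theta> \<in> test_functions U. ?S \<theta> \<in> W} \<inter> test_functions K"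
      obtain d where d: "d > 0" "\<And>y. dist y (?S \<theta>) < d \<Longrightarrow> y \<in> W"
        using W \<theta> by (auto simp: open_dist)
      define e where "e = d / (2 * (norm c * measure lborel K + 1))"
      have pos: "norm c * measure lborel K + 1 > 0" by (simp add: add_nonneg_pos)
      have e: "e > 0" using d(1) pos by (simp add: e_def)
      have "\<eta> \<in> {\<theta> \<in> test_functions U. ?S \<theta> \<in> W} \<inter> test_functions K" if "\<eta> \<in> test_nbhd K \<theta> 0 e" for \<eta>
      proof -
        have \<eta>: "\<eta> \<in> test_functions K" "\<And>x. norm (\<eta> x - \<theta> x) < e"
          using that by (auto simp: test_nbhd_def)
        then have \<eta>U: "\<eta> \<in> test_functions U" using test_functions_mono K by blast
        have "\<bar>(\<integral>x. c \<bullet> \<eta> x \<partial>lborel) - (\<integral>x. c \<bullet> \<theta> x \<partial>lborel)\<bar> \<le> norm c * e * measure lborel K"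
          by (rule constant_functional_continuous) (use \<theta> \<eta> K in \<open>auto intro: less_imp_le\<close>)
        also have "\<dots> \<le> (norm c * measure lborel K + 1) * e" using e by (simp add: algebra_simps)
        also have "\<dots> = d / 2"
        proof -
          have "X * (d / (2 * X)) = d / 2" if "X > 0" for X :: real using that by simp
          from this[OF pos] show ?thesis unfolding e_def .
        qed
        also have "\<dots> < d" using d(1) by simp
        finally show ?thesis using \<theta> \<eta>(1) \<eta>U d(2)[of "?S \<eta>"] by (auto simp: dist_real_def)
      qed
      then show "\<exists>N e. e > 0 \<and> test_nbhd K \<theta> N e \<subseteq> {\<theta> \<in> test_functions U. ?S \<theta> \<in> W} \<inter> test_functions K"
        using e by blast
    qed auto
  qed auto
  then show ?thesis
    using add scale by (simp only: distributions_def mem_Collect_eq restrict_extensional) blast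
qed

text \<open>Linear functionals on the target space are inner products with a vector.\<close>

lemma constant_distribution_iff:
  fixes U :: "'a::euclidean_space set" and S :: "('a \<Rightarrow> 'b::euclidean_space) \<Rightarrow> real"
  shows "constant_distribution U S \<longleftrightarrow> (\<exists>c. \<forall>\<theta>\<in>test_functions U. S \<theta> = (\<integral>x. c \<bullet> \<theta> x \<partial>lborel))"
proof
  assume "constant_distribution U S"
  then obtain \<alpha> where \<alpha>: "linear \<alpha>" "\<And>\<theta>. \<theta> \<in> test_functions U \<Longrightarrow> S \<theta> = set_lebesgue_integral lebesgue U (\<alpha> \<circ> \<theta>)"
    unfolding constant_distribution_def by blast
  define c where "c = adjoint \<alpha> 1"
  have "\<alpha> v = c \<bullet> v" for v
    using adjoint_works[OF \<alpha>(1), of v 1] by (simp add: c_def inner_commute)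
  then have "\<alpha> \<circ> \<theta> = (\<lambda>x. c \<bullet> \<theta> x)" for \<theta> :: "'a \<Rightarrow> 'b" by (simp add: fun_eq_iff)
  then show "\<exists>c. \<forall>\<theta>\<in>test_functions U. S \<theta> = (\<integral>x. c \<bullet> \<theta> x \<partial>lborel)"
    using \<alpha>(2) set_integral_inner_test[of _ U c] by (intro exI[of _ c]) simp
next
  assume "\<exists>c. \<forall>\<theta>\<in>test_functions U. S \<theta> = (\<integral>x. c \<bullet> \<theta> x \<partial>lborel)"
  then obtain c where c: "\<And>\<theta>. \<theta> \<in> test_functions U \<Longrightarrow> S \<theta> = (\<integral>x. c \<bullet> \<theta> x \<partial>lborel)" by blast
  have "linear (\<lambda>v. c \<bullet> v)" by (simp add: bounded_linear.linear bounded_linear_inner_right)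
  moreover have "S \<theta> = set_lebesgue_integral lebesgue U ((\<lambda>v. c \<bullet> v) \<circ> \<theta>)" if "\<theta> \<in> test_functions U" for \<theta>
    using c[OF that] set_integral_inner_test[OF that, of c] by (simp add: comp_def)
  ultimately show "constant_distribution U S"
    unfolding constant_distribution_def by blast
qed

lemma distributions_linear: "T \<in> distributions U \<Longrightarrow> linear_on_test_functions U T"
  by (simp add: distributions_def linear_on_test_functions_def)

lemma linear_distribution_diff:
  assumes "T \<in> distributions U" "S \<in> distributions U"
  shows "linear_on_test_functions U (distribution_diff U T S)"
proof -
  interpret T: linear_on_test_functions U T by (rule distributions_linear[OF assms(1)])
  interpret S: linear_on_test_functions U S by (rule distributions_linear[OF assms(2)])
  show ?thesis
    by unfold_locales
      (simp_all add: distribution_diff_def test_functions_add test_functions_cmult T.T_add S.T_add T.T_scale S.T_scale right_diff_distrib)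
qed

section \<open>Differentiability of distributions\<close>

text \<open>The scaled norms are nonnegative since \<open>0\<close> is a competitor, so convergence to \<open>0\<close> means upper
  bounds by every positive number.\<close>

lemma tendsto_neg_norm_iff_approximable:
  fixes T S :: "(real^'m \<Rightarrow> real^'k) \<Rightarrow> real"
  assumes q: "1 \<le> q" and T: "T \<in> distributions U" and S: "S \<in> distributions U"
    and c: "\<And>\<theta>. \<theta> \<in> test_functions U \<Longrightarrow> S \<theta> = (\<integral>x. c \<bullet> \<theta> x \<partial>lborel)"
  shows "((\<lambda>r. ereal (r powr (- 1 - real CARD('m) / q)) *
      neg_norm (ennreal q) U a r (distribution_diff U T S)) \<longlongrightarrow> 0) (at_right 0) \<longleftrightarrow>
    (\<forall>\<epsilon>>0. young.approximable (power_young q) U T \<epsilon> a c)" (is "(?f \<longlongrightarrow> 0) _ \<longleftrightarrow> _")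
proof -
  interpret young "power_young q" by (rule young_power_young[OF q])
  let ?D = "distribution_diff U T S"
  have lin: "linear_on_test_functions U ?D" by (rule linear_distribution_diff[OF T S])
  interpret D: linear_on_test_functions U ?D by (rule lin)
  have D: "?D v = T v - (\<integral>x. c \<bullet> v x \<partial>lborel)" if "v \<in> competitors U a r" for v r
    using that c by (simp add: distribution_diff_def competitors_def)
  have le_iff: "?f r \<le> ereal \<epsilon> \<longleftrightarrow> (\<forall>v\<in>competitors U a r. \<bar>T v - (\<integral>x. c \<bullet> v x \<partial>lborel)\<bar> \<le> \<epsilon> * r ^ CARD('m))"
    if r: "r > 0" for r \<epsilon>
  proof -
    have "?f r \<le> ereal \<epsilon> \<longleftrightarrow> (\<forall>v\<in>competitors U a r. ?D v \<le> \<epsilon> * r ^ CARD('m))"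
      by (rule neg_norm_le_iff[OF q r lin])
    also have "\<dots> \<longleftrightarrow> (\<forall>v\<in>competitors U a r. \<bar>?D v\<bar> \<le> \<epsilon> * r ^ CARD('m))"
    proof (intro iffI ballI)
      fix v :: "real^'m \<Rightarrow> real^'k" assume le: "\<forall>v\<in>competitors U a r. ?D v \<le> \<epsilon> * r ^ CARD('m)" and v: "v \<in> competitors U a r"
      have "?D (\<lambda>x. - v x) = - ?D v" using v by (intro D.T_uminus) (simp add: competitors_def)
      then show "\<bar>?D v\<bar> \<le> \<epsilon> * r ^ CARD('m)"
        using le v competitors_uminus[OF v] by (auto simp: abs_le_iff)
    qed auto
    finally show ?thesis using D by (simp cong: ball_cong)
  qed
  have zero_comp: "(\<lambda>x. 0) \<in> competitors U a r" for r
    using test_functions_zero[of U] by (simp add: competitors_def energy_def zero spt_def)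
  have nonneg: "0 \<le> ?f r" if r: "r > 0" for r
  proof (rule ccontr)
    assume "\<not> 0 \<le> ?f r"
    then obtain \<epsilon> where "?f r < ereal \<epsilon>" "ereal \<epsilon> < 0" using ereal_dense2[of "?f r" 0] by (auto simp: not_le)
    then have "\<bar>T (\<lambda>x. 0) - (\<integral>x. c \<bullet> 0 \<partial>(lborel :: (real^'m) measure))\<bar> \<le> \<epsilon> * r ^ CARD('m)"
      using le_iff[OF r, of \<epsilon>] zero_comp[of r] by (auto simp: less_imp_le)
    moreover have "\<epsilon> * r ^ CARD('m) < 0" using \<open>ereal \<epsilon> < 0\<close> r by (simp add: mult_neg_pos)
    ultimately show False by simp
  qed
  show ?thesis
  proof
    assume lim: "(?f \<longlongrightarrow> 0) (at_right 0)"
    show "\<forall>\<epsilon>>0. approximable U T \<epsilon> a c"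
    proof (intro allI impI)
      fix \<epsilon> :: real assume "\<epsilon> > 0"
      then have "eventually (\<lambda>r. ?f r < ereal \<epsilon>) (at_right 0)" using lim by (intro order_tendstoD) auto
      then obtain r0 where r0: "r0 > 0" "\<And>r. 0 < r \<Longrightarrow> r < r0 \<Longrightarrow> ?f r < ereal \<epsilon>"
        unfolding eventually_at_right_field by auto
      show "approximable U T \<epsilon> a c"
        unfolding approximable_def
      proof (intro exI[of _ r0] conjI allI impI r0(1))
        fix r and v :: "real^'m \<Rightarrow> real^'k" assume *: "0 < r \<and> r < r0 \<and> v \<in> competitors U a r"
        then have "?f r \<le> ereal \<epsilon>" using r0(2)[of r] by (simp only: less_imp_le)
        then show "\<bar>T v - (\<integral>y. c \<bullet> v y \<partial>lborel)\<bar> \<le> \<epsilon> * r ^ DIM(real^'m)"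
          using le_iff[of r \<epsilon>] * by simp
      qed
    qed
  next
    assume app: "\<forall>\<epsilon>>0. approximable U T \<epsilon> a c"
    show "(?f \<longlongrightarrow> 0) (at_right 0)"
    proof (rule order_tendstoI)
      fix b :: ereal assume b: "b < 0"
      show "eventually (\<lambda>r. b < ?f r) (at_right 0)"
        unfolding eventually_at_right_field
      proof (intro exI[of _ 1] conjI allI impI)
        fix r :: real assume "0 < r"
        from order.strict_trans2[OF b nonneg[OF this]] show "b < ?f r" .
      qed simp
    next
      fix b :: ereal assume "0 < b"
      then obtain \<epsilon> where \<epsilon>: "0 < ereal \<epsilon>" "ereal \<epsilon> < b" using ereal_dense2 by blast
      then obtain r0 where r0: "r0 > 0" "\<And>r v. \<lbrakk>0 < r; r < r0; v \<in> competitors U a r\<rbrakk> \<Longrightarrow>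
          \<bar>T v - (\<integral>x. c \<bullet> v x \<partial>lborel)\<bar> \<le> \<epsilon> * r ^ CARD('m)"
        using app unfolding approximable_def by auto
      have "?f r < b" if "0 < r" "r < r0" for r
      proof -
        have "?f r \<le> ereal \<epsilon>"
          unfolding le_iff[OF that(1)] using r0(2)[OF that] by blast
        then show ?thesis using \<epsilon>(2) by (rule order.strict_trans1)
      qed
      then show "eventually (\<lambda>r. ?f r < b) (at_right 0)"
        unfolding eventually_at_right_field using r0(1) by auto
    qed
  qed
qed

theorem theorem4:
  fixes U :: "(real^'m) set"
    and T :: "(real^'m \<Rightarrow> real^'k) \<Rightarrow> real"
    and q :: real
    and A :: "(real^'m) set"
  assumes "open U"
    and "1 \<le> q"
    and "T \<in> distributions U"
    and "A = {a \<in> U. Limsup (at_right 0)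
           (\<lambda>r. ereal (r powr (- 1 - real CARD('m) / q)) * neg_norm (ennreal q) U a r T) < \<infinity>}"
  shows "AE a in lebesgue. a \<in> A \<longrightarrow>
           (\<exists>!S. S \<in> distributions U \<and> constant_distribution U S \<and>
             ((\<lambda>r. ereal (r powr (- 1 - real CARD('m) / q)) *
                 neg_norm (ennreal q) U a r (distribution_diff U T S)) \<longlongrightarrow> 0) (at_right 0))"
proof -
  interpret young "power_young q" by (rule young_power_young[OF assms(2)])
  have lin: "linear_on_test_functions U T" by (rule distributions_linear[OF assms(3)])
  let ?P = "\<lambda>a S. S \<in> distributions U \<and> constant_distribution U S \<and>
             ((\<lambda>r. ereal (r powr (- 1 - real CARD('m) / q)) *
                 neg_norm (ennreal q) U a r (distribution_diff U T S)) \<longlongrightarrow> 0) (at_right 0)"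
  define Z where "Z = {a \<in> U.
    (\<exists>k \<rho>. 0 < \<rho> \<and> (\<forall>r v. 0 < r \<and> r < \<rho> \<and> v \<in> competitors U a r \<longrightarrow> T v \<le> k * r ^ DIM(real^'m))) \<and>
    \<not> (\<exists>c. \<forall>\<epsilon>>0. approximable U T \<epsilon> a c)}"
  have "negligible Z"
    unfolding Z_def by (rule almost_everywhere_approximable[OF assms(1) lin])
  then have "Z \<in> null_sets lebesgue" by (simp add: negligible_iff_null_sets)
  then have outside: "AE a in lebesgue. a \<notin> Z" by (rule AE_not_in)
  have unique: "\<exists>!S. ?P a S" if a: "a \<in> A" "a \<notin> Z" for a
  proof -
    have aU: "a \<in> U" using a(1) assms(4) by simp
    have "Limsup (at_right 0) (\<lambda>r. ereal (r powr (- 1 - real CARD('m) / q)) * neg_norm (ennreal q) U a r T) < \<infinity>"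
      using a(1) assms(4) by simp
    then obtain k where "Limsup (at_right 0) (\<lambda>r. ereal (r powr (- 1 - real CARD('m) / q)) * neg_norm (ennreal q) U a r T) < ereal k"
      using ereal_dense2 by blast
    then have "eventually (\<lambda>r. ereal (r powr (- 1 - real CARD('m) / q)) * neg_norm (ennreal q) U a r T < ereal k) (at_right 0)"
      by (rule Limsup_lessD)
    then obtain \<rho> where \<rho>: "\<rho> > 0" "\<And>r. 0 < r \<Longrightarrow> r < \<rho> \<Longrightarrow>
        ereal (r powr (- 1 - real CARD('m) / q)) * neg_norm (ennreal q) U a r T < ereal k"
      unfolding eventually_at_right_field by auto
    have "T v \<le> k * r ^ DIM(real^'m)" if "0 < r" "r < \<rho>" "v \<in> competitors U a r" for r v
      using neg_norm_le_iff[OF assms(2) that(1) lin, of a k] less_imp_le[OF \<rho>(2)[OF that(1,2)]] that(3) by simp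
    then obtain c where c: "\<And>\<epsilon>. \<epsilon> > 0 \<Longrightarrow> approximable U T \<epsilon> a c"
      using a(2) aU \<rho>(1) unfolding Z_def by blast
    define S where "S = (\<lambda>\<theta>\<in>test_functions U. \<integral>x. c \<bullet> \<theta> x \<partial>lborel)"
    have S: "S \<in> distributions U" unfolding S_def by (rule constant_functional_distribution)
    have Sc: "S \<theta> = (\<integral>x. c \<bullet> \<theta> x \<partial>lborel)" if "\<theta> \<in> test_functions U" for \<theta>
      using that by (simp add: S_def)
    show ?thesis
    proof (rule ex1I[of _ S])
      show "?P a S"
        using S Sc c tendsto_neg_norm_iff_approximable[OF assms(2,3) S Sc, of a]
        by (auto simp: constant_distribution_iff)
    next
      fix S' assume S': "?P a S'"
      then obtain c' where c': "\<And>\<theta>. \<theta> \<in> test_functions U \<Longrightarrow> S' \<theta> = (\<integral>x. c' \<bullet> \<theta> x \<partial>lborel)"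
        by (auto simp: constant_distribution_iff)
      have app': "approximable U T \<epsilon> a c'" if "\<epsilon> > 0" for \<epsilon>
        using S' tendsto_neg_norm_iff_approximable[OF assms(2,3) _ c', of a] that by blast
      obtain \<kappa> where \<kappa>: "\<kappa> > 0" "\<And>\<epsilon>. \<epsilon> > 0 \<Longrightarrow> \<kappa> * norm (c - c') \<le> \<epsilon> + \<epsilon>"
        using approximable_constants_close[where ?'a = "real^'m" and ?'b = "real^'k"] assms(1) aU c app' by metis
      have "\<kappa> * norm (c - c') \<le> 0"
      proof (rule field_le_epsilon)
        fix e :: real assume "e > 0"
        then show "\<kappa> * norm (c - c') \<le> 0 + e" using \<kappa>(2)[of "e / 2"] by simp
      qed
      then have "c = c'" using \<kappa>(1) by (simp add: mult_le_0_iff)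
      moreover have "S' \<in> extensional (test_functions U)" using S' by (simp add: distributions_def)
      ultimately show "S' = S"
        using c' Sc S by (intro extensionalityI[of _ "test_functions U"]) (auto simp: distributions_def)
    qed
  qed
  from outside show ?thesis
    by eventually_elim (intro impI unique)
qed

end
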